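(* Let $I=[a,b)$ with $-\infty<a<b\leqslant\infty$, and let $(X_t)_{t\in I}$ be a real centred Gauss-Markov semimartingale. Then, for $t\in I$, almost surely, $$[X]_t=\int_{\tau_{m(t)}}^{t^-} g_{m(t)}^2(s)\,\mathrm d\!\left(\frac{f_{m(t)}}{g_{m(t)}}(s)\right)+(\Delta X_t)^2+\sum_{i=0}^{m(t)-1}\left\{\int_{\tau_i}^{\tau_{i+1}^-} g_i^2(s)\,\mathrm d\!\left(\frac{f_i}{g_i}(s)\right)+(\Delta X_{\tau_{i+1}})^2\right\},$$ where 1. $\tau_0:=a$ and $(\tau_1,\tau_2,\ldots)$ is the ordered set $\mathcal T_X$, consisting of the points of the independence partition of $X$ and the times of discontinuity of its covariance factors (defined in the context); 2. the ordered sets $(f_0,f_1,\ldots)$ and $(g_0,g_1,\ldots)$ are the continuous decompositions of the covariance factors of $X$ (defined in the context); 3. $m(t):=\max\{i\in\mathbb N\mid\tau_i<t\}$ (with $0\in\mathbb N$), and $\Delta X_s:=X_s-\lim_{u\to s^-}X_u$. The integrals are Riemann-Stieltjes integrals, and $\int_c^{t^-}:=\lim_{x\to t^-}\int_c^x$.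
   Context: **Processes.** A Gauss-Markov process is a Gaussian process that has the Markov property; $K_X(s,t)=\mathrm{Cov}(X_s,X_t)$ is its covariance function. Centred means $\mathbb E[X_t]=0$ for all $t$. A semimartingale is in particular càdlàg; a Gauss-Markov semimartingale has at most countably many jumps, occurring only at deterministic times. The quadratic variation $[X]_t$ is the limit in probability of $\sum_j (X_{t_{j+1}}-X_{t_j})^2$ along partitions $a=t_0<t_1<\cdots<t_n=t$ of $[a,t]$ whose mesh tends to $0$ (there is no initial term $X_a^2$). **Independence partition.** Let $\mathcal R_X$ be the set of points of $(a,\sup I)$ lying on the boundary of the set of zeros of $t\mapsto \mathrm{Var}[X_t]$. The independence partition $\mathcal I_X=(\iota_1,\iota_2,\ldots)$ is the increasingly ordered set consisting of $\mathcal R_X$ together with all points $s\in(a,\sup I)$ such that $\mathrm{Var}[X_s]\neq 0$ and $K_X(r,t)=0$ for all $r,t\in I$ with $r<s<t$. (For general Gauss-Markov processes some points are listed twice; for a Gauss-Markov semimartingale the $\iota_i$ are distinct.) Put $\iota_0:=a$ and, if $\mathcal I_X$ is finite, $\iota_{|\mathcal I_X|+1}:=\sup I$. **Covariance factors.** For a Gauss-Markov semimartingale there exist functions $F_i,G_i:[\iota_i,\iota_{i+1})\to\mathbb R$, $i=0,1,\ldots,|\mathcal I_X|$ (all $i\in\mathbb N$ if $\mathcal I_X$ is infinite), such that $F_i/G_i$ is positive (meaning $\geqslant 0$) and nondecreasing on $[\iota_i,\iota_{i+1})$, and $$K_X(s,t)=\sum_{i=0}^{|\mathcal I_X|}F_i(\min(s,t))\,G_i(\max(s,t))\,\mathbf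 1_{[\iota_i,\iota_{i+1})}(s)\,\mathbf 1_{[\iota_i,\iota_{i+1})}(t),\qquad s,t\in I.$$ Any such ordered families $(F_i)$, $(G_i)$ are called the covariance factors of $X$. For a Gauss-Markov semimartingale they are at least piecewise continuous on $[\iota_i,\iota_{i+1})$. **Discontinuity times.** Let $$\mathcal D_X=\bigcup_{i=0}^{|\mathcal I_X|}\Big(\{t\in(\iota_i,\iota_{i+1})\mid F_i(t^-)\neq F_i(t^+)\}\cup\{t\in(\iota_i,\iota_{i+1})\mid G_i(t^-)\neq G_i(t^+)\}\Big),$$ and let $\mathcal T_X=(\tau_1,\tau_2,\ldots)$ be the ordered set of the elements of $\mathcal I_X\cup\mathcal D_X$ in increasing order. If $\mathcal T_X$ is finite, put $\tau_{|\mathcal T_X|+1}:=\sup I$. **Continuous decompositions of the covariance factors.** These are the ordered families $(f_0,f_1,\ldots)$ and $(g_0,g_1,\ldots)$ of the continuous pieces of the covariance factors, listed in increasing order of their domains: $f_k$ and $g_k$ are the continuous functions on $[\tau_k,\tau_{k+1})$ that coincide there with $F_i$ and $G_i$ respectively, where $[\iota_i,\iota_{i+1})$ is the interval containing $[\tau_k,\tau_{k+1})$.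
   Formalization: It is assumed that the set T_X has only finitely many points below each s in I; otherwise (e.g. a Gaussian martingale whose deterministic jump times accumulate inside I) the enumeration τ_1, τ_2, … does not exhaust T_X and m(t) is undefined. *)

theory Defs
  imports "HOL-Probability.Probability"
begin

section \<open>Stochastic processes on a half-open interval\<close>

definition time_set :: "real \<Rightarrow> ereal \<Rightarrow> real set" where
  "time_set a b = {t. a \<le> t \<and> ereal t < b}"

text \<open>Constants count as (degenerate) Gaussian random variables.\<close>

definition gaussian_rv :: "'a measure \<Rightarrow> ('a \<Rightarrow> real) \<Rightarrow> bool" where
  "gaussian_rv M Y \<longleftrightarrow> Y \<in> borel_measurable M \<and>
     ((\<exists>\<mu> \<sigma>. \<sigma> > 0 \<and> distributed M lborel Y (normal_density \<mu> \<sigma>)) \<or>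
      (\<exists>\<mu>. AE \<omega> in M. Y \<omega> = \<mu>))"

definition gaussian_process :: "'a measure \<Rightarrow> real set \<Rightarrow> (real \<Rightarrow> 'a \<Rightarrow> real) \<Rightarrow> bool" where
  "gaussian_process M I X \<longleftrightarrow>
     (\<forall>S c. finite S \<and> S \<subseteq> I \<longrightarrow> gaussian_rv M (\<lambda>\<omega>. \<Sum>s\<in>S. c s * X s \<omega>))"

definition past_algebra :: "'a measure \<Rightarrow> real set \<Rightarrow> (real \<Rightarrow> 'a \<Rightarrow> real) \<Rightarrow> real \<Rightarrow> 'a measure" where
  "past_algebra M I X s =
     sigma (space M) {X u -` B \<inter> space M | u B. u \<in> I \<and> u \<le> s \<and> B \<in> sets borel}"

text \<open>The Markov property refers to the filtration generated by the process itself.\<close>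

definition markov_process :: "'a measure \<Rightarrow> real set \<Rightarrow> (real \<Rightarrow> 'a \<Rightarrow> real) \<Rightarrow> bool" where
  "markov_process M I X \<longleftrightarrow> (\<forall>t\<in>I. X t \<in> borel_measurable M) \<and>
     (\<forall>s\<in>I. \<forall>t\<in>I. \<forall>B\<in>sets borel. s \<le> t \<longrightarrow>
        (AE \<omega> in M.
           real_cond_exp M (past_algebra M I X s) (\<lambda>\<omega>. indicator B (X t \<omega>)) \<omega> =
           real_cond_exp M (vimage_algebra (space M) (X s) borel) (\<lambda>\<omega>. indicator B (X t \<omega>)) \<omega>))"

definition centred :: "'a measure \<Rightarrow> real set \<Rightarrow> (real \<Rightarrow> 'a \<Rightarrow> real) \<Rightarrow> bool" where
  "centred M I X \<longleftrightarrow> (\<forall>t\<in>I. integrable M (X t) \<and> prob_space.expectation M (X t) = 0)"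

definition cov_fun :: "'a measure \<Rightarrow> (real \<Rightarrow> 'a \<Rightarrow> real) \<Rightarrow> real \<Rightarrow> real \<Rightarrow> real" where
  "cov_fun M X s t = prob_space.expectation M
     (\<lambda>\<omega>. (X s \<omega> - prob_space.expectation M (X s)) * (X t \<omega> - prob_space.expectation M (X t)))"


section \<open>Semimartingales\<close>

definition partition_of :: "real \<Rightarrow> real \<Rightarrow> nat \<Rightarrow> (nat \<Rightarrow> real) \<Rightarrow> bool" where
  "partition_of c d n p \<longleftrightarrow> p 0 = c \<and> p n = d \<and> (\<forall>j<n. p j < p (Suc j))"

definition mesh_less :: "nat \<Rightarrow> (nat \<Rightarrow> real) \<Rightarrow> real \<Rightarrow> bool" where
  "mesh_less n p \<delta> \<longleftrightarrow> (\<forall>j<n. p (Suc j) - p j < \<delta>)"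

definition cadlag_path :: "real \<Rightarrow> ereal \<Rightarrow> (real \<Rightarrow> real) \<Rightarrow> bool" where
  "cadlag_path a b x \<longleftrightarrow> (\<forall>t\<in>time_set a b.
     (x \<longlongrightarrow> x t) (at_right t) \<and> (a < t \<longrightarrow> (\<exists>l. (x \<longlongrightarrow> l) (at_left t))))"

definition finite_variation_path :: "real \<Rightarrow> ereal \<Rightarrow> (real \<Rightarrow> real) \<Rightarrow> bool" where
  "finite_variation_path a b x \<longleftrightarrow> (\<forall>t\<in>time_set a b.
     bdd_above {\<Sum>j<n. \<bar>x (p (Suc j)) - x (p j)\<bar> | n p. partition_of a t n p})"

text \<open>Filtrations are indexed by \<^typ>\<open>ereal\<close> (only the algebras \<open>\<F> t\<close> with \<open>t \<in> [a, b)\<close> carry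
  information), so that \<^const>\<open>stopping_time\<close> applies to times with values in \<open>[a, b]\<close>.\<close>

definition filtered_space :: "'a measure \<Rightarrow> (ereal \<Rightarrow> 'a measure) \<Rightarrow> bool" where
  "filtered_space M \<F> \<longleftrightarrow> filtration (space M) \<F> \<and> (\<forall>t. subalgebra M (\<F> t))"

definition adapted_process ::
  "(ereal \<Rightarrow> 'a measure) \<Rightarrow> real \<Rightarrow> ereal \<Rightarrow> (real \<Rightarrow> 'a \<Rightarrow> real) \<Rightarrow> bool" where
  "adapted_process \<F> a b X \<longleftrightarrow> (\<forall>t\<in>time_set a b. X t \<in> borel_measurable (\<F> (ereal t)))"

definition martingale ::
  "'a measure \<Rightarrow> (ereal \<Rightarrow> 'a measure) \<Rightarrow> real \<Rightarrow> ereal \<Rightarrow> (real \<Rightarrow> 'a \<Rightarrow> real) \<Rightarrow> bool" where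
  "martingale M \<F> a b N \<longleftrightarrow> adapted_process \<F> a b N \<and>
     (\<forall>t\<in>time_set a b. integrable M (N t)) \<and>
     (\<forall>s\<in>time_set a b. \<forall>t\<in>time_set a b. s \<le> t \<longrightarrow>
        (AE \<omega> in M. real_cond_exp M (\<F> (ereal s)) (N t) \<omega> = N s \<omega>))"

definition stopped_process ::
  "('a \<Rightarrow> ereal) \<Rightarrow> (real \<Rightarrow> 'a \<Rightarrow> real) \<Rightarrow> real \<Rightarrow> 'a \<Rightarrow> real" where
  "stopped_process T N t \<omega> = N (real_of_ereal (min (ereal t) (T \<omega>))) \<omega>"

definition local_martingale ::
  "'a measure \<Rightarrow> (ereal \<Rightarrow> 'a measure) \<Rightarrow> real \<Rightarrow> ereal \<Rightarrow> (real \<Rightarrow> 'a \<Rightarrow> real) \<Rightarrow> bool" where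
  "local_martingale M \<F> a b N \<longleftrightarrow> adapted_process \<F> a b N \<and>
     (AE \<omega> in M. cadlag_path a b (\<lambda>t. N t \<omega>)) \<and>
     (\<exists>T :: nat \<Rightarrow> 'a \<Rightarrow> ereal.
        (\<forall>n. stopping_time \<F> (T n) \<and> (\<forall>\<omega>\<in>space M. ereal a \<le> T n \<omega> \<and> T n \<omega> \<le> b)) \<and>
        (AE \<omega> in M. incseq (\<lambda>n. T n \<omega>) \<and> (\<lambda>n. T n \<omega>) \<longlonglongrightarrow> b) \<and>
        (\<forall>n. martingale M \<F> a b (stopped_process (T n) N)))"

definition finite_variation_process ::
  "'a measure \<Rightarrow> (ereal \<Rightarrow> 'a measure) \<Rightarrow> real \<Rightarrow> ereal \<Rightarrow> (real \<Rightarrow> 'a \<Rightarrow> real) \<Rightarrow> bool" where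
  "finite_variation_process M \<F> a b A \<longleftrightarrow> adapted_process \<F> a b A \<and>
     (AE \<omega> in M. cadlag_path a b (\<lambda>t. A t \<omega>) \<and> finite_variation_path a b (\<lambda>t. A t \<omega>))"

definition semimartingale ::
  "'a measure \<Rightarrow> (ereal \<Rightarrow> 'a measure) \<Rightarrow> real \<Rightarrow> ereal \<Rightarrow> (real \<Rightarrow> 'a \<Rightarrow> real) \<Rightarrow> bool" where
  "semimartingale M \<F> a b X \<longleftrightarrow> filtered_space M \<F> \<and> adapted_process \<F> a b X \<and>
     (AE \<omega> in M. cadlag_path a b (\<lambda>t. X t \<omega>)) \<and>
     (\<exists>N A. local_martingale M \<F> a b N \<and> finite_variation_process M \<F> a b A \<and>
        (AE \<omega> in M. N a \<omega> = 0 \<and> A a \<omega> = 0 \<and>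
           (\<forall>t\<in>time_set a b. X t \<omega> = X a \<omega> + N t \<omega> + A t \<omega>)))"


section \<open>Quadratic variation and jumps\<close>

definition has_quadratic_variation ::
  "'a measure \<Rightarrow> real \<Rightarrow> (real \<Rightarrow> 'a \<Rightarrow> real) \<Rightarrow> real \<Rightarrow> ('a \<Rightarrow> real) \<Rightarrow> bool" where
  "has_quadratic_variation M a X t Q \<longleftrightarrow> Q \<in> borel_measurable M \<and>
     (\<forall>\<epsilon>>0. \<forall>\<eta>>0. \<exists>\<delta>>0. \<forall>n p. partition_of a t n p \<and> mesh_less n p \<delta> \<longrightarrow>
        measure M {\<omega> \<in> space M. \<bar>(\<Sum>j<n. (X (p (Suc j)) \<omega> - X (p j) \<omega>)\<^sup>2) - Q \<omega>\<bar> > \<epsilon>} < \<eta>)"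

text \<open>There is no jump at the initial time \<open>a\<close>, by convention \<open>X (a-) = X a\<close>.\<close>

definition jump :: "real \<Rightarrow> (real \<Rightarrow> 'a \<Rightarrow> real) \<Rightarrow> real \<Rightarrow> 'a \<Rightarrow> real" where
  "jump a X s \<omega> = (if s \<le> a then 0 else X s \<omega> - Lim (at_left s) (\<lambda>u. X u \<omega>))"


section \<open>Riemann-Stieltjes integrals\<close>

definition has_RS_integral ::
  "(real \<Rightarrow> real) \<Rightarrow> (real \<Rightarrow> real) \<Rightarrow> real \<Rightarrow> real \<Rightarrow> real \<Rightarrow> bool" where
  "has_RS_integral h \<phi> c d J \<longleftrightarrow>
     (\<forall>\<epsilon>>0. \<exists>\<delta>>0. \<forall>n p \<xi>. partition_of c d n p \<and> mesh_less n p \<delta> \<and>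
        (\<forall>j<n. p j \<le> \<xi> j \<and> \<xi> j \<le> p (Suc j)) \<longrightarrow>
        \<bar>(\<Sum>j<n. h (\<xi> j) * (\<phi> (p (Suc j)) - \<phi> (p j))) - J\<bar> < \<epsilon>)"

definition RS_integral :: "real \<Rightarrow> real \<Rightarrow> (real \<Rightarrow> real) \<Rightarrow> (real \<Rightarrow> real) \<Rightarrow> real" where
  "RS_integral c d h \<phi> = (THE J. has_RS_integral h \<phi> c d J)"

text \<open>The integral from \<open>c\<close> to \<open>t-\<close>; it is empty if \<open>t \<le> c\<close>.\<close>

definition RS_integral_left :: "real \<Rightarrow> real \<Rightarrow> (real \<Rightarrow> real) \<Rightarrow> (real \<Rightarrow> real) \<Rightarrow> real" where
  "RS_integral_left c t h \<phi> =
     (if c < t then Lim (at_left t) (\<lambda>x. RS_integral c x h \<phi>) else 0)"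


section \<open>Independence partition, covariance factors, continuous decompositions\<close>

text \<open>\<open>listing a b S 0 = a\<close>, and \<open>listing a b S n\<close> is the \<open>n\<close>-th smallest element of \<open>S \<subseteq> (a, b)\<close>
  (for \<open>n \<ge> 1\<close>). When there are fewer than \<open>n\<close> elements the value is \<open>b\<close>. This enumerates \<open>S\<close>
  provided that \<open>S \<inter> (a, t)\<close> is finite for all \<open>t < b\<close>.\<close>

primrec listing :: "real \<Rightarrow> ereal \<Rightarrow> real set \<Rightarrow> nat \<Rightarrow> ereal" where
  "listing a b S 0 = ereal a"
| "listing a b S (Suc n) = Inf (insert b (ereal ` {s \<in> S. listing a b S n < ereal s}))"

text \<open>The \<open>i\<close>-th interval \<open>[\<iota> i, \<iota> (i+1))\<close>; it is empty for indices beyond the last interval, where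
  both endpoints equal \<open>b\<close>.\<close>

definition piece :: "(nat \<Rightarrow> ereal) \<Rightarrow> nat \<Rightarrow> real set" where
  "piece \<iota> i = {s. \<iota> i \<le> ereal s \<and> ereal s < \<iota> (Suc i)}"

definition independence_partition ::
  "'a measure \<Rightarrow> real \<Rightarrow> ereal \<Rightarrow> (real \<Rightarrow> 'a \<Rightarrow> real) \<Rightarrow> real set" where
  "independence_partition M a b X =
     {s. a < s \<and> ereal s < b \<and>
        s \<in> frontier {t \<in> time_set a b. prob_space.variance M (X t) = 0}} \<union>
     {s. a < s \<and> ereal s < b \<and> prob_space.variance M (X s) \<noteq> 0 \<and>
        (\<forall>r\<in>time_set a b. \<forall>t\<in>time_set a b. r < s \<and> s < t \<longrightarrow> cov_fun M X r t = 0)}"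

abbreviation iota :: "'a measure \<Rightarrow> real \<Rightarrow> ereal \<Rightarrow> (real \<Rightarrow> 'a \<Rightarrow> real) \<Rightarrow> nat \<Rightarrow> ereal" where
  "iota M a b X \<equiv> listing a b (independence_partition M a b X)"

text \<open>At most one term of the series below is nonzero. Values of \<open>F i\<close> and \<open>G i\<close> outside
  \<open>piece \<iota> i\<close> are irrelevant. At zeros of \<open>G i\<close>, which can only occur where the variance
  vanishes, the quotient is read as 0; if \<open>G i\<close> has no zeros it is the ordinary quotient.\<close>

definition covariance_factors ::
  "'a measure \<Rightarrow> real \<Rightarrow> ereal \<Rightarrow> (real \<Rightarrow> 'a \<Rightarrow> real) \<Rightarrow>
     (nat \<Rightarrow> real \<Rightarrow> real) \<Rightarrow> (nat \<Rightarrow> real \<Rightarrow> real) \<Rightarrow> bool" where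
  "covariance_factors M a b X F G \<longleftrightarrow>
     (\<forall>i. (\<forall>s\<in>piece (iota M a b X) i. F i s / G i s \<ge> 0) \<and>
          mono_on (piece (iota M a b X) i) (\<lambda>s. F i s / G i s)) \<and>
     (\<forall>s\<in>time_set a b. \<forall>t\<in>time_set a b.
        cov_fun M X s t =
          (\<Sum>i. F i (min s t) * G i (max s t) *
                indicator (piece (iota M a b X) i) s * indicator (piece (iota M a b X) i) t))"

text \<open>The condition \<open>h (t-) \<noteq> h (t+)\<close>, both limits existing.\<close>

definition jump_point :: "(real \<Rightarrow> real) \<Rightarrow> real \<Rightarrow> bool" where
  "jump_point h t \<longleftrightarrow> (\<exists>l r. (h \<longlongrightarrow> l) (at_left t) \<and> (h \<longlongrightarrow> r) (at_right t) \<and> l \<noteq> r)"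

definition discontinuity_times ::
  "(nat \<Rightarrow> ereal) \<Rightarrow> (nat \<Rightarrow> real \<Rightarrow> real) \<Rightarrow> (nat \<Rightarrow> real \<Rightarrow> real) \<Rightarrow> real set" where
  "discontinuity_times \<iota> F G =
     (\<Union>i. {t. \<iota> i < ereal t \<and> ereal t < \<iota> (Suc i) \<and> jump_point (F i) t} \<union>
           {t. \<iota> i < ereal t \<and> ereal t < \<iota> (Suc i) \<and> jump_point (G i) t})"

definition transition_times ::
  "'a measure \<Rightarrow> real \<Rightarrow> ereal \<Rightarrow> (real \<Rightarrow> 'a \<Rightarrow> real) \<Rightarrow>
     (nat \<Rightarrow> real \<Rightarrow> real) \<Rightarrow> (nat \<Rightarrow> real \<Rightarrow> real) \<Rightarrow> real set" where
  "transition_times M a b X F G =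
     independence_partition M a b X \<union> discontinuity_times (iota M a b X) F G"

definition continuous_decomposition ::
  "(nat \<Rightarrow> ereal) \<Rightarrow> (nat \<Rightarrow> ereal) \<Rightarrow> (nat \<Rightarrow> real \<Rightarrow> real) \<Rightarrow> (nat \<Rightarrow> real \<Rightarrow> real) \<Rightarrow> bool" where
  "continuous_decomposition \<iota> \<tau> F f \<longleftrightarrow>
     (\<forall>k i. piece \<tau> k \<noteq> {} \<and> piece \<tau> k \<subseteq> piece \<iota> i \<longrightarrow>
        continuous_on (piece \<tau> k) (f k) \<and> (\<forall>s\<in>piece \<tau> k. f k s = F i s))"

text \<open>The largest \<open>i\<close> with \<open>\<tau> i < t\<close>. For \<open>t = \<tau> 0\<close> there is none, and the value is 0.\<close>

definition last_index :: "(nat \<Rightarrow> ereal) \<Rightarrow> real \<Rightarrow> nat" where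
  "last_index \<tau> t = (if \<exists>i. \<tau> i < ereal t then Max {i. \<tau> i < ereal t} else 0)"

end

theory Submission imports Defs begin

text \<open>On an interval \<open>[c, e)\<close> between consecutive transition times the covariance is \<open>f s * g u\<close> for
\<open>s \<le> u\<close>, with \<open>f\<close> and \<open>g\<close> continuous and \<open>v = f / g\<close> nonnegative and nondecreasing: there \<open>X\<close> looks
like \<open>g\<close> times a Gaussian martingale with variance function \<open>v\<close>. Split an increment as
\<open>X u - X s = W + (g u / g s - 1) * X s\<close>, where the innovation \<open>W = X u - (g u / g s) * X s\<close> is
orthogonal to the past. Innovations over disjoint intervals are orthogonal and have the variances
\<open>(g u)\<^sup>2 * (v u - v s)\<close>, so the expected sum of their squares is a Riemann-Stieltjes sum for the
integral of \<open>g\<^sup>2\<close> against \<open>v\<close>, and by the Isserlis formula (\<open>variance_sum_squares_orthogonal\<close>)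
its fluctuations disappear with the mesh. The remainders contribute squares of total expectation
\<open>\<Sum> v s * (g u - g s)\<^sup>2\<close>. This need not become small for a general Gauss-Markov process (\<open>g\<close> could be
a fixed path of Brownian motion); it does so because \<open>X\<close> is a semimartingale.

Besides cadlag paths, all that is used of the semimartingale property is that the simple integrals of \<open>X\<close> with adapted
integrands bounded by 1 are bounded in probability (\<open>semimartingale_bdd_in_prob\<close>), which for the
martingale part is the weak type inequality for martingale transforms. A family of Gaussian variables,
or of suitable quadratic forms in them, that is bounded in probability is bounded in mean, by the
Paley-Zygmund inequality. Applied to deterministic signs as integrands, this bounds
\<open>\<Sum> E (X u - X s)\<^sup>2\<close> over all partitions; applied to signs times \<open>X s\<close>, it bounds
\<open>\<Sum> \<bar>f s * (g u - g s)\<bar>\<close>.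

Since these sums are bounded, the parts of them close to \<open>c\<close> and close to \<open>e\<close> are small
(\<open>csum_tail_small\<close>). On a compact interval inside \<open>(c, e)\<close> either the variance is identically zero or
\<open>\<bar>g\<bar>\<close> is bounded below; the definition of the independence partition excludes anything else. In the
second case uniform continuity makes \<open>v s * (g u - g s)\<^sup>2\<close> a small multiple of \<open>\<bar>f s * (g u - g s)\<bar>\<close>.
Hence the sum of squared increments up to the last partition point before \<open>e\<close> converges to the
integral, the last increment contributes the squared jump at \<open>e\<close> (\<open>segment_qv\<close>), and the intervals
are glued by right continuity (\<open>list_qv_concat\<close>).\<close>

section \<open>Sums over consecutive points of a partition\<close>

text \<open>Partitions are handled as strictly increasing lists, because they have to be cut at given points and
glued together; \<open>csum\<close> sums a function of two points over the neighbouring pairs of such a list.\<close>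

fun csum :: "(real \<Rightarrow> real \<Rightarrow> 'b::comm_monoid_add) \<Rightarrow> real list \<Rightarrow> 'b" where
  "csum \<nu> (x # y # zs) = \<nu> x y + csum \<nu> (y # zs)"
| "csum \<nu> xs = 0"

lemma csum_conv_sum: "csum \<nu> xs = (\<Sum>j<length xs - 1. \<nu> (xs ! j) (xs ! Suc j))"
proof (induction \<nu> xs rule: csum.induct)
  case (1 \<nu> x y zs)
  show ?case using 1 by (simp add: lessThan_Suc_eq_insert_0 sum.reindex zero_notin_Suc_image del: sum.lessThan_Suc)
qed auto

lemma csum_map_upt: "csum \<nu> (map p [0..<Suc n]) = (\<Sum>j<n. \<nu> (p j) (p (Suc j)))"
  unfolding csum_conv_sum by (intro sum.cong) (auto simp del: upt_Suc)

lemma csum_append_snoc: "csum \<nu> (xs @ x # ys) = csum \<nu> (xs @ [x]) + csum \<nu> (x # ys)"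
proof (induction xs)
  case (Cons z xs)
  then show ?case by (cases xs) (auto simp: add.assoc)
qed simp

lemma csum_append:
  assumes "xs \<noteq> []" "ys \<noteq> []"
  shows "csum \<nu> (xs @ ys) = csum \<nu> xs + \<nu> (last xs) (hd ys) + csum \<nu> ys"
proof -
  obtain as x where x: "xs = as @ [x]" using assms(1) by (cases xs rule: rev_cases) auto
  obtain y bs where y: "ys = y # bs" using assms(2) by (cases ys) auto
  show ?thesis using csum_append_snoc[of \<nu> as x ys] by (simp add: x y add.assoc)
qed

lemma csum_nonneg:
  fixes \<nu> :: "real \<Rightarrow> real \<Rightarrow> real"
  assumes "successively (\<lambda>s u. 0 \<le> \<nu> s u) xs"
  shows "0 \<le> csum \<nu> xs"
  using assms by (induction \<nu> xs rule: csum.induct) auto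

lemma csum_mono:
  fixes \<nu> :: "real \<Rightarrow> real \<Rightarrow> real"
  assumes "successively (\<lambda>s u. \<nu> s u \<le> \<mu> s u) xs"
  shows "csum \<nu> xs \<le> csum \<mu> xs"
  using assms by (induction \<nu> xs rule: csum.induct) auto

lemma csum_cmult: "csum (\<lambda>s u. (k::real) * \<nu> s u) xs = k * csum \<nu> xs"
  by (induction xs rule: induct_list012) (auto simp: algebra_simps)

lemma successively_sorted_imp:
  assumes "sorted_wrt (<) xs" "\<And>s u. s \<in> set xs \<Longrightarrow> u \<in> set xs \<Longrightarrow> s < u \<Longrightarrow> P s u"
  shows "successively P xs"
  using assms by (induction xs rule: induct_list012) auto

lemma sorted_filter_split:
  assumes "sorted_wrt (<) (xs::real list)"
  shows "xs = filter (\<lambda>s. s < y) xs @ filter (\<lambda>s. y \<le> s) xs"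
  using assms
proof (induction xs)
  case (Cons x xs)
  show ?case
  proof (cases "x < y")
    case False
    then have "\<forall>z\<in>set xs. \<not> z < y" using Cons.prems by auto
    then show ?thesis using False Cons by (auto simp: filter_empty_conv not_less)
  qed (use Cons in auto)
qed simp

lemma sorted_filter_split':
  assumes "sorted_wrt (<) (xs::real list)"
  shows "xs = filter (\<lambda>s. s \<le> y) xs @ filter (\<lambda>s. y < s) xs"
  using assms
proof (induction xs)
  case (Cons x xs)
  show ?case
  proof (cases "x \<le> y")
    case False
    then have "\<forall>z\<in>set xs. \<not> z \<le> y" using Cons.prems by force
    then show ?thesis using False Cons by (auto simp: filter_empty_conv not_less)
  qed (use Cons in auto)
qed simp

definition plist :: "real \<Rightarrow> real \<Rightarrow> real list \<Rightarrow> bool" where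
  "plist c d xs \<longleftrightarrow> sorted_wrt (<) xs \<and> xs \<noteq> [] \<and> hd xs = c \<and> last xs = d"

abbreviation gaps_less :: "real \<Rightarrow> real list \<Rightarrow> bool" where
  "gaps_less \<delta> \<equiv> successively (\<lambda>s u. u - s < \<delta>)"

lemma strict_steps_less:
  assumes "\<forall>j<n. p j < (p (Suc j) :: real)" "i < j" "j \<le> n"
  shows "p i < p j"
  using assms(2,3)
proof (induction j)
  case (Suc j)
  then show ?case using assms(1) by (cases "i = j") (auto intro: less_trans)
qed simp

lemma partition_of_imp_plist:
  assumes "partition_of c d n p"
  shows "plist c d (map p [0..<Suc n])"
  using assms unfolding plist_def partition_of_def
  by (auto simp: sorted_wrt_iff_nth_less hd_map last_map intro: strict_steps_less simp del: upt_Suc)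

lemma mesh_less_imp_gaps_less:
  "mesh_less n p \<delta> \<Longrightarrow> gaps_less \<delta> (map p [0..<Suc n])"
  unfolding mesh_less_def successively_conv_nth by (auto simp del: upt_Suc)

lemma plist_imp_partition_of:
  assumes "plist c d xs"
  shows "partition_of c d (length xs - 1) ((!) xs)"
  using assms unfolding plist_def partition_of_def
  by (auto simp: hd_conv_nth last_conv_nth sorted_wrt_iff_nth_less)

lemma gaps_less_imp_mesh_less:
  "gaps_less \<delta> xs \<Longrightarrow> mesh_less (length xs - 1) ((!) xs) \<delta>"
  unfolding mesh_less_def successively_conv_nth by auto

lemma plist_bounds:
  assumes "plist c d xs" "s \<in> set xs"
  shows "c \<le> s" "s \<le> d"
proof -
  have 1: "sorted_wrt (<) xs" "xs \<noteq> []" "hd xs = c" "last xs = d" using assms unfolding plist_def by auto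
  show "c \<le> s" using 1 assms(2) by (cases xs) (auto simp: less_imp_le)
  have "xs = butlast xs @ [d]" using append_butlast_last_id[OF 1(2)] 1(4) by simp
  then have "sorted_wrt (<) (butlast xs @ [d])" "s \<in> set (butlast xs @ [d])" using 1(1) assms(2) by metis+
  then show "s \<le> d" by (auto simp: sorted_wrt_append less_imp_le)
qed

lemma plist_exists:
  assumes "c < d" "\<delta> > 0"
  shows "\<exists>xs. plist c d xs \<and> gaps_less \<delta> xs"
proof -
  obtain n :: nat where n: "real n > (d - c) / \<delta>" using reals_Archimedean2 by blast
  have n0: "n > 0" using n assms by (cases n) (auto simp: divide_less_0_iff)
  define p where "p j = c + (d - c) * real j / real n" for j
  have st: "p (Suc j) - p j = (d - c) / real n" for j
    unfolding p_def using n0 by (simp add: field_simps)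
  have "(d - c) / real n < \<delta>" using n n0 assms by (simp add: field_simps)
  then have "mesh_less n p \<delta>" unfolding mesh_less_def st by auto
  moreover have "partition_of c d n p" unfolding partition_of_def
  proof (intro conjI allI impI)
    fix j
    have "p (Suc j) - p j > 0" unfolding st using n0 assms by simp
    then show "p j < p (Suc j)" by simp
  qed (use n0 in \<open>auto simp: p_def\<close>)
  ultimately show ?thesis using partition_of_imp_plist mesh_less_imp_gaps_less by blast
qed

lemma partition_exists:
  assumes "c < d" "\<delta> > 0"
  shows "\<exists>n p. partition_of c d n p \<and> mesh_less n p \<delta>"
  using plist_exists[OF assms] plist_imp_partition_of gaps_less_imp_mesh_less by blast

text \<open>This is how bounded total variation makes the ends of an interval negligible. Choose a list whose sum
is within \<open>\<epsilon>\<close> of the supremum; any list lying to the left or to the right of it can be appended, so its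
sum cannot exceed \<open>\<epsilon>\<close>.\<close>

lemma csum_tail_small:
  fixes \<nu> :: "real \<Rightarrow> real \<Rightarrow> real"
  assumes "c < e"
    and nn: "\<And>s u. c < s \<Longrightarrow> s < u \<Longrightarrow> u < e \<Longrightarrow> 0 \<le> \<nu> s u"
    and bd: "\<And>xs. sorted_wrt (<) xs \<Longrightarrow> set xs \<subseteq> {c<..<e} \<Longrightarrow> csum \<nu> xs \<le> C"
    and "\<epsilon> > 0"
  shows "\<exists>x y. c < x \<and> x \<le> y \<and> y < e \<and>
    (\<forall>xs. sorted_wrt (<) xs \<longrightarrow> set xs \<subseteq> {c<..<x} \<or> set xs \<subseteq> {y<..<e} \<longrightarrow> csum \<nu> xs \<le> \<epsilon>)"
proof -
  define A where "A = csum \<nu> ` {xs. sorted_wrt (<) xs \<and> set xs \<subseteq> {c<..<e} \<and> xs \<noteq> []}"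
  have ne: "A \<noteq> {}"
  proof -
    have "csum \<nu> [(c+e)/2] \<in> A" unfolding A_def using \<open>c < e\<close> by (intro imageI) auto
    then show ?thesis by auto
  qed
  have bA: "bdd_above A" unfolding A_def using bd by (intro bdd_aboveI[of _ C]) auto
  have "Sup A - \<epsilon> < Sup A" using \<open>\<epsilon> > 0\<close> by simp
  then obtain zs where zs: "sorted_wrt (<) zs" "set zs \<subseteq> {c<..<e}" "zs \<noteq> []" "Sup A - \<epsilon> < csum \<nu> zs"
    using less_cSup_iff[OF ne bA] unfolding A_def by auto
  let ?x = "hd zs" and ?y = "last zs"
  have pl: "plist ?x ?y zs" using zs unfolding plist_def by auto
  have xye: "?x \<in> {c<..<e}" "?y \<in> {c<..<e}"
    using zs(2,3) hd_in_set[of zs] last_in_set[of zs] by blast+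
  then have xe: "?x < e" and cy: "c < ?y" by auto
  have nn': "csum \<nu> (xs @ ys) \<ge> csum \<nu> xs + csum \<nu> ys"
    if "sorted_wrt (<) (xs @ ys)" "set (xs @ ys) \<subseteq> {c<..<e}" for xs ys
  proof (cases "xs = [] \<or> ys = []")
    case False
    then have ne: "xs \<noteq> []" "ys \<noteq> []" by auto
    have "last xs \<in> set xs" "hd ys \<in> set ys" using ne by auto
    then have "0 \<le> \<nu> (last xs) (hd ys)" using that by (intro nn) (auto simp: sorted_wrt_append)
    then show ?thesis using csum_append[OF ne, of \<nu>] by linarith
  qed auto
  show ?thesis
  proof (rule exI[of _ ?x], rule exI[of _ ?y], intro conjI allI impI)
    show "c < ?x" "?y < e" using xye by auto
    show "?x \<le> ?y" using plist_bounds(1)[OF pl] zs(3) by auto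
    fix xs :: "real list"
    assume xs: "sorted_wrt (<) xs" "set xs \<subseteq> {c<..<?x} \<or> set xs \<subseteq> {?y<..<e}"
    show "csum \<nu> xs \<le> \<epsilon>"
    proof (cases "set xs \<subseteq> {c<..<?x}")
      case True
      have lt: "s < u" if "s \<in> set xs" "u \<in> set zs" for s u
        using True that plist_bounds(1)[OF pl that(2)] by auto
      have st: "sorted_wrt (<) (xs @ zs)"
        using xs(1) zs(1) lt by (simp add: sorted_wrt_append)
      have sub: "set (xs @ zs) \<subseteq> {c<..<e}" using True zs(2) xe by auto
      have "csum \<nu> (xs @ zs) \<in> A" unfolding A_def using st sub zs(3) by (intro imageI) auto
      then have "csum \<nu> (xs @ zs) \<le> Sup A" using bA by (rule cSup_upper)
      then show ?thesis using nn'[OF st sub] zs(4) by linarith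
    next
      case False
      then have False: "set xs \<subseteq> {?y<..<e}" using xs by auto
      have lt: "u < s" if "s \<in> set xs" "u \<in> set zs" for s u
        using False that plist_bounds(2)[OF pl that(2)] by auto
      have st: "sorted_wrt (<) (zs @ xs)"
        using xs(1) zs(1) lt by (simp add: sorted_wrt_append)
      have sub: "set (zs @ xs) \<subseteq> {c<..<e}" using False zs(2) cy by auto
      have "csum \<nu> (zs @ xs) \<in> A" unfolding A_def using st sub zs(3) by (intro imageI) auto
      then have "csum \<nu> (zs @ xs) \<le> Sup A" using bA by (rule cSup_upper)
      then show ?thesis using nn'[OF st sub] zs(4) by linarith
    qed
  qed
qed

lemma csum_append_le:
  fixes \<nu> :: "real \<Rightarrow> real \<Rightarrow> real"
  assumes "successively (\<lambda>s u. \<nu> s u \<le> r) (xs @ ys)" "0 \<le> r"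
  shows "csum \<nu> (xs @ ys) \<le> csum \<nu> xs + csum \<nu> ys + r"
proof (cases "xs = [] \<or> ys = []")
  case False
  then show ?thesis using assms csum_append[of xs ys \<nu>] by (auto simp: successively_append_iff)
qed (use assms in auto)

section \<open>Riemann-Stieltjes integrals against monotone functions\<close>

lemma overlap_sum:
  fixes \<phi> :: "real \<Rightarrow> real"
  assumes q: "partition_of c d n q" and "c \<le> x" "x \<le> y" "y \<le> d"
  shows "(\<Sum>k<n. \<phi> (max x (min y (q (Suc k)))) - \<phi> (max x (min y (q k)))) = \<phi> y - \<phi> x"
proof -
  have "(\<Sum>k<n. \<phi> (max x (min y (q (Suc k)))) - \<phi> (max x (min y (q k)))) =
    \<phi> (max x (min y (q n))) - \<phi> (max x (min y (q 0)))"
    by (rule sum_lessThan_telescope)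
  moreover have "max x (min y (q n)) = y" "max x (min y (q 0)) = x"
    using assms unfolding partition_of_def by (auto simp: max_def min_def)
  ultimately show ?thesis by simp
qed

lemma partition_of_bounds:
  assumes "partition_of c d n p" "j \<le> n"
  shows "c \<le> p j" "p j \<le> d"
proof -
  have *: "\<forall>j<n. p j < p (Suc j)" "p 0 = c" "p n = d" using assms(1) unfolding partition_of_def by auto
  show "c \<le> p j" using strict_steps_less[OF *(1), of 0 j] assms(2) * by (cases "j = 0") auto
  show "p j \<le> d" using strict_steps_less[OF *(1), of j n] assms(2) * by (cases "j = n") auto
qed

text \<open>Instead of passing to a common refinement, give each pair of intervals of the two partitions the
\<open>\<phi>\<close>-mass \<open>\<mu> j k\<close> of their intersection. Both sums become double sums against \<open>\<mu>\<close>, and where \<open>\<mu> j k\<close> is not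
zero the intervals meet, so the tags are closer than twice the mesh.\<close>

lemma RS_sums_close:
  fixes h \<phi> :: "real \<Rightarrow> real"
  assumes mono: "mono_on {c..d} \<phi>"
    and osc: "\<And>s u. s \<in> {c..d} \<Longrightarrow> u \<in> {c..d} \<Longrightarrow> \<bar>s - u\<bar> < 2 * \<delta> \<Longrightarrow> \<bar>h s - h u\<bar> \<le> \<epsilon>"
    and p: "partition_of c d n p" "mesh_less n p \<delta>" "\<forall>j<n. p j \<le> \<xi> j \<and> \<xi> j \<le> p (Suc j)"
    and q: "partition_of c d m q" "mesh_less m q \<delta>" "\<forall>j<m. q j \<le> \<zeta> j \<and> \<zeta> j \<le> q (Suc j)"
  shows "\<bar>(\<Sum>j<n. h (\<xi> j) * (\<phi> (p (Suc j)) - \<phi> (p j))) -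
          (\<Sum>k<m. h (\<zeta> k) * (\<phi> (q (Suc k)) - \<phi> (q k)))\<bar> \<le> \<epsilon> * (\<phi> d - \<phi> c)"
proof -
  have pl: "p j < p (Suc j)" "c \<le> p j" "p (Suc j) \<le> d" "p (Suc j) - p j < \<delta>" "p j \<le> \<xi> j" "\<xi> j \<le> p (Suc j)"
    if "j < n" for j
    using that p partition_of_bounds[OF p(1)] unfolding partition_of_def mesh_less_def by auto
  have ql: "q j < q (Suc j)" "c \<le> q j" "q (Suc j) \<le> d" "q (Suc j) - q j < \<delta>" "q j \<le> \<zeta> j" "\<zeta> j \<le> q (Suc j)"
    if "j < m" for j
    using that q partition_of_bounds[OF q(1)] unfolding partition_of_def mesh_less_def by auto
  define \<mu> where "\<mu> j k = \<phi> (max (p j) (min (p (Suc j)) (q (Suc k)))) - \<phi> (max (p j) (min (p (Suc j)) (q k)))" for j k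
  have mu1: "(\<Sum>k<m. \<mu> j k) = \<phi> (p (Suc j)) - \<phi> (p j)" if "j < n" for j
    unfolding \<mu>_def using pl[OF that] by (intro overlap_sum[OF q(1)]) auto
  have mu_sym: "\<mu> j k = \<phi> (max (q k) (min (q (Suc k)) (p (Suc j)))) - \<phi> (max (q k) (min (q (Suc k)) (p j)))"
    if "j < n" "k < m" for j k
    unfolding \<mu>_def using pl[OF that(1)] ql[OF that(2)] by (auto simp: max_def min_def)
  have mu2: "(\<Sum>j<n. \<mu> j k) = \<phi> (q (Suc k)) - \<phi> (q k)" if "k < m" for k
  proof -
    have "(\<Sum>j<n. \<mu> j k) = (\<Sum>j<n. \<phi> (max (q k) (min (q (Suc k)) (p (Suc j)))) - \<phi> (max (q k) (min (q (Suc k)) (p j))))"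
      using mu_sym that by (intro sum.cong) auto
    also have "\<dots> = \<phi> (q (Suc k)) - \<phi> (q k)" using ql[OF that] by (intro overlap_sum[OF p(1)]) auto
    finally show ?thesis .
  qed
  have mu_nn: "\<mu> j k \<ge> 0" if "j < n" "k < m" for j k
    unfolding \<mu>_def using pl[OF that(1)] ql[OF that(2)]
    by (intro diff_ge_0_iff_ge[THEN iffD2] mono_onD[OF mono]) (auto simp: max_def min_def)
  have trm: "\<bar>(h (\<xi> j) - h (\<zeta> k)) * \<mu> j k\<bar> \<le> \<epsilon> * \<mu> j k" if "j < n" "k < m" for j k
  proof (cases "\<mu> j k = 0")
    case False
    have "\<bar>\<xi> j - \<zeta> k\<bar> < 2 * \<delta>"
    proof (rule ccontr)
      assume "\<not> ?thesis"
      then have "q (Suc k) \<le> p j \<or> p (Suc j) \<le> q k" using pl[OF that(1)] ql[OF that(2)] by linarith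
      then have "\<mu> j k = 0" unfolding \<mu>_def using pl[OF that(1)] ql[OF that(2)] by (auto simp: max_def min_def)
      with False show False by simp
    qed
    then have "\<bar>h (\<xi> j) - h (\<zeta> k)\<bar> \<le> \<epsilon>" using pl[OF that(1)] ql[OF that(2)] by (intro osc) auto
    then show ?thesis using mu_nn[OF that] by (auto simp: abs_mult intro!: mult_right_mono)
  qed simp
  have "(\<Sum>j<n. h (\<xi> j) * (\<phi> (p (Suc j)) - \<phi> (p j))) = (\<Sum>j<n. \<Sum>k<m. h (\<xi> j) * \<mu> j k)"
    by (intro sum.cong) (auto simp: mu1 sum_distrib_left[symmetric])
  moreover have "(\<Sum>k<m. h (\<zeta> k) * (\<phi> (q (Suc k)) - \<phi> (q k))) = (\<Sum>k<m. \<Sum>j<n. h (\<zeta> k) * \<mu> j k)"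
    by (intro sum.cong) (auto simp: mu2 sum_distrib_left[symmetric])
  moreover have "(\<Sum>k<m. \<Sum>j<n. h (\<zeta> k) * \<mu> j k) = (\<Sum>j<n. \<Sum>k<m. h (\<zeta> k) * \<mu> j k)"
    by (rule sum.swap)
  ultimately have "(\<Sum>j<n. h (\<xi> j) * (\<phi> (p (Suc j)) - \<phi> (p j))) - (\<Sum>k<m. h (\<zeta> k) * (\<phi> (q (Suc k)) - \<phi> (q k)))
    = (\<Sum>j<n. \<Sum>k<m. (h (\<xi> j) - h (\<zeta> k)) * \<mu> j k)"
    by (simp add: sum_subtractf left_diff_distrib)
  also have "\<bar>\<dots>\<bar> \<le> (\<Sum>j<n. \<Sum>k<m. \<epsilon> * \<mu> j k)"
    using trm by (intro order_trans[OF sum_abs] sum_mono) auto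
  also have "\<dots> = \<epsilon> * (\<Sum>j<n. \<phi> (p (Suc j)) - \<phi> (p j))"
    unfolding sum_distrib_left by (intro sum.cong refl) (auto simp: mu1 sum_distrib_left[symmetric])
  also have "\<dots> = \<epsilon> * (\<phi> d - \<phi> c)"
    using p(1) sum_lessThan_telescope[of "\<lambda>j. \<phi> (p j)" n] unfolding partition_of_def by simp
  finally show ?thesis .
qed

lemma has_RS_integral_exists:
  fixes h \<phi> :: "real \<Rightarrow> real"
  assumes "c < d" and mono: "mono_on {c..d} \<phi>" and cont: "continuous_on {c..d} h"
  shows "\<exists>J. has_RS_integral h \<phi> c d J"
proof -
  let ?S = "\<lambda>n p \<xi>. \<Sum>j<n. h (\<xi> j) * (\<phi> (p (Suc j)) - \<phi> (p j))"
  define V where "V = \<phi> d - \<phi> c + 1"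
  have V: "V > 0" "\<phi> d - \<phi> c \<le> V" unfolding V_def using mono_onD[OF mono, of c d] assms(1) by auto
  have close: "\<exists>\<delta>>0. \<forall>n p \<xi> m q \<zeta>. partition_of c d n p \<and> mesh_less n p \<delta> \<and> (\<forall>j<n. p j \<le> \<xi> j \<and> \<xi> j \<le> p (Suc j)) \<longrightarrow>
      partition_of c d m q \<and> mesh_less m q \<delta> \<and> (\<forall>j<m. q j \<le> \<zeta> j \<and> \<zeta> j \<le> q (Suc j)) \<longrightarrow>
      \<bar>?S n p \<xi> - ?S m q \<zeta>\<bar> < \<epsilon>" if "\<epsilon> > 0" for \<epsilon> :: real
  proof -
    have "uniformly_continuous_on {c..d} h" using cont by (intro compact_uniformly_continuous) auto
    moreover have e: "\<epsilon> / (2 * V) > 0" using that V by auto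
    ultimately obtain \<delta> where d: "\<delta> > 0" "\<And>s u. s \<in> {c..d} \<Longrightarrow> u \<in> {c..d} \<Longrightarrow> dist u s < \<delta> \<Longrightarrow> dist (h u) (h s) < \<epsilon> / (2 * V)"
      unfolding uniformly_continuous_on_def by blast
    have osc: "\<bar>h s - h u\<bar> \<le> \<epsilon> / (2 * V)" if "s \<in> {c..d}" "u \<in> {c..d}" "\<bar>s - u\<bar> < 2 * (\<delta> / 2)" for s u
      using d(2)[OF that(2,1)] that(3) by (auto simp: dist_real_def)
    have "\<epsilon> / (2 * V) * (\<phi> d - \<phi> c) \<le> \<epsilon> / (2 * V) * V" using e V by (intro mult_left_mono) auto
    also have "\<dots> < \<epsilon>" using V that by simp
    finally have lt: "\<epsilon> / (2 * V) * (\<phi> d - \<phi> c) < \<epsilon>" .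
    show ?thesis
    proof (intro exI[of _ "\<delta> / 2"] conjI allI impI)
      fix n p \<xi> m q \<zeta>
      assume "partition_of c d n p \<and> mesh_less n p (\<delta>/2) \<and> (\<forall>j<n. p j \<le> \<xi> j \<and> \<xi> j \<le> p (Suc j))"
         "partition_of c d m q \<and> mesh_less m q (\<delta>/2) \<and> (\<forall>j<m. q j \<le> \<zeta> j \<and> \<zeta> j \<le> q (Suc j))"
      then have "\<bar>?S n p \<xi> - ?S m q \<zeta>\<bar> \<le> \<epsilon> / (2 * V) * (\<phi> d - \<phi> c)"
        by (intro RS_sums_close[OF mono, where \<delta> = "\<delta> / 2"] osc) auto
      then show "\<bar>?S n p \<xi> - ?S m q \<zeta>\<bar> < \<epsilon>" using lt by linarith
    qed (use d in auto)
  qed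
  have "\<forall>i::nat. \<exists>np. partition_of c d (fst np) (snd np) \<and> mesh_less (fst np) (snd np) (1 / real (Suc i))"
    using partition_exists[OF assms(1)] by (auto simp: split_paired_Ex)
  then obtain np where np: "\<And>i. partition_of c d (fst (np i)) (snd (np i))"
     "\<And>i. mesh_less (fst (np i)) (snd (np i)) (1 / real (Suc i))" by metis
  define A where "A i = ?S (fst (np i)) (snd (np i)) (snd (np i))" for i
  have npt: "\<forall>j<fst (np i). snd (np i) j \<le> snd (np i) j \<and> snd (np i) j \<le> snd (np i) (Suc j)" for i
    using np(1)[of i] unfolding partition_of_def by (auto intro: less_imp_le)
  have fine: "\<exists>i0. \<forall>i\<ge>i0. mesh_less (fst (np i)) (snd (np i)) \<delta>" if "\<delta> > 0" for \<delta>
  proof -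
    obtain i0 where i0: "1 / real (Suc i0) < \<delta>" using \<open>\<delta> > 0\<close> nat_approx_posE by blast
    have "mesh_less (fst (np i)) (snd (np i)) \<delta>" if "i \<ge> i0" for i
    proof -
      have "1 / real (Suc i) \<le> 1 / real (Suc i0)" using that by (intro divide_left_mono) auto
      then show ?thesis using np(2)[of i] i0 unfolding mesh_less_def by force
    qed
    then show ?thesis by blast
  qed
  have "Cauchy A"
  proof (rule metric_CauchyI)
    fix \<epsilon> :: real assume "\<epsilon> > 0"
    from close[OF this] obtain \<delta> where d: "\<delta> > 0" "\<And>n p \<xi> m q \<zeta>. partition_of c d n p \<Longrightarrow> mesh_less n p \<delta> \<Longrightarrow> (\<forall>j<n. p j \<le> \<xi> j \<and> \<xi> j \<le> p (Suc j)) \<Longrightarrow>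
      partition_of c d m q \<Longrightarrow> mesh_less m q \<delta> \<Longrightarrow> (\<forall>j<m. q j \<le> \<zeta> j \<and> \<zeta> j \<le> q (Suc j)) \<Longrightarrow>
      \<bar>?S n p \<xi> - ?S m q \<zeta>\<bar> < \<epsilon>" by blast
    obtain i0 where i0: "\<And>i. i \<ge> i0 \<Longrightarrow> mesh_less (fst (np i)) (snd (np i)) \<delta>" using fine[OF d(1)] by blast
    show "\<exists>i0. \<forall>i\<ge>i0. \<forall>k\<ge>i0. dist (A i) (A k) < \<epsilon>"
      unfolding A_def dist_real_def using d(2)[OF np(1) i0 npt np(1) i0 npt] by blast
  qed
  then obtain J where J: "A \<longlonglongrightarrow> J" using Cauchy_convergent convergent_def by blast
  have "has_RS_integral h \<phi> c d J" unfolding has_RS_integral_def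
  proof (intro allI impI)
    fix \<epsilon> :: real assume "\<epsilon> > 0"
    then have e2: "\<epsilon> / 2 > 0" by simp
    from close[OF this] obtain \<delta> where d: "\<delta> > 0" "\<And>n p \<xi> m q \<zeta>. partition_of c d n p \<Longrightarrow> mesh_less n p \<delta> \<Longrightarrow> (\<forall>j<n. p j \<le> \<xi> j \<and> \<xi> j \<le> p (Suc j)) \<Longrightarrow>
      partition_of c d m q \<Longrightarrow> mesh_less m q \<delta> \<Longrightarrow> (\<forall>j<m. q j \<le> \<zeta> j \<and> \<zeta> j \<le> q (Suc j)) \<Longrightarrow>
      \<bar>?S n p \<xi> - ?S m q \<zeta>\<bar> < \<epsilon> / 2" by blast
    obtain i0 where i0: "\<And>i. i \<ge> i0 \<Longrightarrow> mesh_less (fst (np i)) (snd (np i)) \<delta>" using fine[OF d(1)] by blast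
    obtain i1 where i1: "\<And>i. i \<ge> i1 \<Longrightarrow> \<bar>A i - J\<bar> < \<epsilon> / 2"
      using J e2 unfolding LIMSEQ_iff real_norm_def by blast
    define i where "i = max i0 i1"
    show "\<exists>\<delta>>0. \<forall>n p \<xi>. partition_of c d n p \<and> mesh_less n p \<delta> \<and> (\<forall>j<n. p j \<le> \<xi> j \<and> \<xi> j \<le> p (Suc j)) \<longrightarrow>
        \<bar>?S n p \<xi> - J\<bar> < \<epsilon>"
    proof (intro exI[of _ \<delta>] conjI allI impI)
      fix n p \<xi> assume *: "partition_of c d n p \<and> mesh_less n p \<delta> \<and> (\<forall>j<n. p j \<le> \<xi> j \<and> \<xi> j \<le> p (Suc j))"
      have "\<bar>?S n p \<xi> - A i\<bar> < \<epsilon> / 2" unfolding A_def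
        using * i0[of i] by (intro d(2) np npt) (auto simp: i_def)
      moreover have "\<bar>A i - J\<bar> < \<epsilon> / 2" by (intro i1) (simp add: i_def)
      ultimately show "\<bar>?S n p \<xi> - J\<bar> < \<epsilon>" by linarith
    qed (rule d)
  qed
  then show ?thesis ..
qed

lemma has_RS_integral_unique:
  assumes "c < d" "has_RS_integral h \<phi> c d J" "has_RS_integral h \<phi> c d J'"
  shows "J = J'"
proof (rule ccontr)
  assume "J \<noteq> J'"
  define \<epsilon> where "\<epsilon> = \<bar>J - J'\<bar> / 2"
  have e: "\<epsilon> > 0" using \<open>J \<noteq> J'\<close> unfolding \<epsilon>_def by simp
  obtain \<delta> where d: "\<delta> > 0" "\<And>n p \<xi>. partition_of c d n p \<Longrightarrow> mesh_less n p \<delta> \<Longrightarrow> (\<forall>j<n. p j \<le> \<xi> j \<and> \<xi> j \<le> p (Suc j)) \<Longrightarrow>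
        \<bar>(\<Sum>j<n. h (\<xi> j) * (\<phi> (p (Suc j)) - \<phi> (p j))) - J\<bar> < \<epsilon>" using assms(2) e unfolding has_RS_integral_def by meson
  obtain \<delta>' where d': "\<delta>' > 0" "\<And>n p \<xi>. partition_of c d n p \<Longrightarrow> mesh_less n p \<delta>' \<Longrightarrow> (\<forall>j<n. p j \<le> \<xi> j \<and> \<xi> j \<le> p (Suc j)) \<Longrightarrow>
        \<bar>(\<Sum>j<n. h (\<xi> j) * (\<phi> (p (Suc j)) - \<phi> (p j))) - J'\<bar> < \<epsilon>" using assms(3) e unfolding has_RS_integral_def by meson
  obtain n p where p: "partition_of c d n p" "mesh_less n p (min \<delta> \<delta>')"
    using partition_exists[OF assms(1), of "min \<delta> \<delta>'"] d(1) d'(1) by auto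
  have *: "mesh_less n p \<delta>" "mesh_less n p \<delta>'" "\<forall>j<n. p j \<le> p j \<and> p j \<le> p (Suc j)"
    using p unfolding mesh_less_def partition_of_def by (auto intro: less_imp_le)
  show False using d(2)[OF p(1) *(1,3)] d'(2)[OF p(1) *(2,3)] unfolding \<epsilon>_def abs_real_def by (auto split: if_splits)
qed

lemma has_RS_integral_RS_integral:
  assumes "c < d" "mono_on {c..d} \<phi>" "continuous_on {c..d} h"
  shows "has_RS_integral h \<phi> c d (RS_integral c d h \<phi>)"
  unfolding RS_integral_def
  using has_RS_integral_exists[OF assms] has_RS_integral_unique[OF assms(1)] by (metis theI)

lemma RS_integral_csum:
  assumes "c < d" "mono_on {c..d} \<phi>" "continuous_on {c..d} h" "\<epsilon> > 0"
  shows "\<exists>\<delta>>0. \<forall>xs. plist c d xs \<and> gaps_less \<delta> xs \<longrightarrow>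
    \<bar>csum (\<lambda>s u. h u * (\<phi> u - \<phi> s)) xs - RS_integral c d h \<phi>\<bar> < \<epsilon>"
proof -
  obtain \<delta> where d: "\<delta> > 0" "\<And>n p \<xi>. partition_of c d n p \<Longrightarrow> mesh_less n p \<delta> \<Longrightarrow> (\<forall>j<n. p j \<le> \<xi> j \<and> \<xi> j \<le> p (Suc j)) \<Longrightarrow>
        \<bar>(\<Sum>j<n. h (\<xi> j) * (\<phi> (p (Suc j)) - \<phi> (p j))) - RS_integral c d h \<phi>\<bar> < \<epsilon>"
    using has_RS_integral_RS_integral[OF assms(1-3)] assms(4) unfolding has_RS_integral_def by meson
  show ?thesis
  proof (intro exI[of _ \<delta>] conjI allI impI)
    fix xs assume xs: "plist c d xs \<and> gaps_less \<delta> xs"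
    then have p: "partition_of c d (length xs - 1) ((!) xs)" using plist_imp_partition_of by blast
    then show "\<bar>csum (\<lambda>s u. h u * (\<phi> u - \<phi> s)) xs - RS_integral c d h \<phi>\<bar> < \<epsilon>"
      unfolding csum_conv_sum using d(2)[OF p, of "\<lambda>j. xs ! Suc j"] gaps_less_imp_mesh_less xs
      by (auto simp: partition_of_def intro: less_imp_le)
  qed (rule d)
qed

section \<open>Moments of Gaussian random variables\<close>

lemma gaussian_rv_moments:
  assumes "prob_space M" "gaussian_rv M Y" and m0: "prob_space.expectation M Y = 0"
  shows "integrable M (\<lambda>\<omega>. Y \<omega> ^ 4)"
    "prob_space.expectation M (\<lambda>\<omega>. Y \<omega> ^ 4) = 3 * (prob_space.expectation M (\<lambda>\<omega>. (Y \<omega>)\<^sup>2))\<^sup>2"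
proof -
  interpret prob_space M by fact
  have Y: "Y \<in> borel_measurable M" and
    c: "(\<exists>\<mu> \<sigma>. \<sigma> > 0 \<and> distributed M lborel Y (normal_density \<mu> \<sigma>)) \<or> (\<exists>\<mu>. AE \<omega> in M. Y \<omega> = \<mu>)"
    using assms unfolding gaussian_rv_def by auto
  have "integrable M (\<lambda>\<omega>. Y \<omega> ^ 4) \<and> expectation (\<lambda>\<omega>. Y \<omega> ^ 4) = 3 * (expectation (\<lambda>\<omega>. (Y \<omega>)\<^sup>2))\<^sup>2"
    using c
  proof
    assume "\<exists>\<mu> \<sigma>. \<sigma> > 0 \<and> distributed M lborel Y (normal_density \<mu> \<sigma>)"
    then obtain \<mu> \<sigma> where s: "\<sigma> > 0" and d: "distributed M lborel Y (normal_density \<mu> \<sigma>)" by blast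
    have "\<mu> = 0" using normal_distributed_expectation[OF s d] m0 by simp
    then have d: "distributed M lborel Y (normal_density 0 \<sigma>)" using d by simp
    have m4: "has_bochner_integral lborel (\<lambda>x. normal_density 0 \<sigma> x * (x - 0) ^ (2 * 2)) (fact (2 * 2) / ((2 / \<sigma>\<^sup>2)^2 * fact 2))"
      by (rule normal_moment_even[OF s])
    have m2: "has_bochner_integral lborel (\<lambda>x. normal_density 0 \<sigma> x * (x - 0) ^ (2 * 1)) (fact (2 * 1) / ((2 / \<sigma>\<^sup>2)^1 * fact 1))"
      by (rule normal_moment_even[OF s])
    have 1: "integrable M (\<lambda>\<omega>. Y \<omega> ^ 4)"
      using m4 distributed_integrable[OF d, of "\<lambda>x. x ^ 4"] by (auto simp: has_bochner_integral_iff)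
    have 2: "expectation (\<lambda>\<omega>. Y \<omega> ^ 4) = 3 * \<sigma> ^ 4"
      using m4 distributed_integral[OF d, of "\<lambda>x. x ^ 4"] s
      by (auto simp: has_bochner_integral_iff fact_numeral power_divide field_simps)
    have 3: "expectation (\<lambda>\<omega>. (Y \<omega>)\<^sup>2) = \<sigma>\<^sup>2"
      using m2 distributed_integral[OF d, of "\<lambda>x. x ^ 2"] s
      by (simp add: has_bochner_integral_iff)
    show ?thesis using 1 2 3 by simp
  next
    assume "\<exists>\<mu>. AE \<omega> in M. Y \<omega> = \<mu>"
    then obtain \<mu> where ae: "AE \<omega> in M. Y \<omega> = \<mu>" by blast
    have "expectation Y = expectation (\<lambda>_. \<mu>)" using ae Y by (intro integral_cong_AE) auto
    then have "\<mu> = 0" using m0 prob_space by simp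
    then have z: "AE \<omega> in M. Y \<omega> = 0" using ae by simp
    have 1: "expectation (\<lambda>\<omega>. Y \<omega> ^ 4) = expectation (\<lambda>_. 0)" using z Y by (intro integral_cong_AE) auto
    have 2: "expectation (\<lambda>\<omega>. (Y \<omega>)\<^sup>2) = expectation (\<lambda>_. 0)" using z Y by (intro integral_cong_AE) auto
    have 3: "integrable M (\<lambda>\<omega>. Y \<omega> ^ 4) = integrable M (\<lambda>_. 0::real)" using z Y by (intro integrable_cong_AE) auto
    show ?thesis using 1 2 3 by simp
  qed
  then show "integrable M (\<lambda>\<omega>. Y \<omega> ^ 4)"
    "expectation (\<lambda>\<omega>. Y \<omega> ^ 4) = 3 * (expectation (\<lambda>\<omega>. (Y \<omega>)\<^sup>2))\<^sup>2" by auto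
qed

text \<open>A nonnegative variable whose second moment is comparable to the square of its mean exceeds a fixed
fraction of the mean with a fixed probability. In the form given here: a bound in probability is a
bound in mean.\<close>

lemma (in prob_space) paley_zygmund:
  fixes Y :: "'a \<Rightarrow> real"
  assumes nn: "\<And>\<omega>. \<omega> \<in> space M \<Longrightarrow> 0 \<le> Y \<omega>"
    and int: "integrable M Y" "integrable M (\<lambda>\<omega>. (Y \<omega>)\<^sup>2)"
    and "\<kappa> > 0" and \<kappa>: "expectation (\<lambda>\<omega>. (Y \<omega>)\<^sup>2) \<le> \<kappa> * (expectation Y)\<^sup>2"
    and small: "prob {\<omega> \<in> space M. Y \<omega> > K} < 1 / (4 * \<kappa>)" and "K \<ge> 0"
  shows "expectation Y \<le> 2 * K"
proof (rule ccontr)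
  assume neg: "\<not> expectation Y \<le> 2 * K"
  define m where "m = expectation Y"
  have m: "m > 0" "m / 2 > K" using neg \<open>K \<ge> 0\<close> unfolding m_def by auto
  define A where "A = {\<omega> \<in> space M. Y \<omega> > K}"
  have Ym[measurable]: "Y \<in> borel_measurable M" using int by auto
  have A[measurable]: "A \<in> sets M" unfolding A_def by measurable
  define l where "l = 1 / (2 * \<kappa> * m)"
  have l: "l > 0" unfolding l_def using m \<open>\<kappa> > 0\<close> by simp
  \<comment> \<open>On the event \<open>Y > K\<close> this is Young's inequality; \<open>l\<close> makes the two resulting terms equal to \<open>m / 4\<close>.\<close>
  have bound: "Y \<omega> \<le> K + (l / 2 * (Y \<omega>)\<^sup>2 + 1 / (2 * l) * indicator A \<omega>)" if "\<omega> \<in> space M" for \<omega>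
  proof (cases "\<omega> \<in> A")
    case True
    have "0 \<le> (l * Y \<omega> - 1)\<^sup>2 / (2 * l)" using l by simp
    also have "\<dots> = l / 2 * (Y \<omega>)\<^sup>2 + 1 / (2 * l) - Y \<omega>" using l by (simp add: field_simps power2_eq_square)
    finally show ?thesis using True \<open>K \<ge> 0\<close> by simp
  next
    case False
    then have "Y \<omega> \<le> K" using that unfolding A_def by auto
    moreover have "0 \<le> l / 2 * (Y \<omega>)\<^sup>2" using l by simp
    ultimately show ?thesis using False by simp
  qed
  have i1: "integrable M (indicator A :: 'a \<Rightarrow> real)"
    by (rule integrable_const_bound[where B = 1]) auto
  have "m \<le> expectation (\<lambda>\<omega>. K + (l / 2 * (Y \<omega>)\<^sup>2 + 1 / (2 * l) * indicator A \<omega>))"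
    unfolding m_def using bound int i1 by (intro integral_mono) auto
  also have "\<dots> = K + (l / 2 * expectation (\<lambda>\<omega>. (Y \<omega>)\<^sup>2) + 1 / (2 * l) * prob A)"
    using int i1 by (simp add: prob_space)
  also have "\<dots> \<le> K + (l / 2 * (\<kappa> * m\<^sup>2) + 1 / (2 * l) * prob A)"
    using \<kappa> l unfolding m_def by (intro add_mono mult_left_mono) auto
  also have "1 / (2 * l) * prob A < 1 / (2 * l) * (1 / (4 * \<kappa>))"
    using small l unfolding A_def by (intro mult_strict_left_mono) auto
  also have "l / 2 * (\<kappa> * m\<^sup>2) = m / 4" unfolding l_def using m \<open>\<kappa> > 0\<close> by (simp add: field_simps power2_eq_square)
  also have "1 / (2 * l) * (1 / (4 * \<kappa>)) = m / 4" unfolding l_def using m \<open>\<kappa> > 0\<close> by (simp add: field_simps)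
  finally show False using m by simp
qed

text \<open>The properties of a linear space of centred jointly Gaussian variables that the argument needs. By
polarisation the fourth moment identity determines all mixed fourth moments, so that joint densities
and independence never enter.\<close>

locale gaussian_space = prob_space +
  fixes L :: "('a \<Rightarrow> real) set"
  assumes L_add: "U \<in> L \<Longrightarrow> V \<in> L \<Longrightarrow> (\<lambda>\<omega>. U \<omega> + V \<omega>) \<in> L"
    and L_scale: "U \<in> L \<Longrightarrow> (\<lambda>\<omega>. r * U \<omega>) \<in> L"
    and L_zero: "(\<lambda>_. 0) \<in> L"
    and L_measurable: "U \<in> L \<Longrightarrow> U \<in> borel_measurable M"
    and L_integrable4: "U \<in> L \<Longrightarrow> integrable M (\<lambda>\<omega>. U \<omega> ^ 4)"
    and L_moment4: "U \<in> L \<Longrightarrow> expectation (\<lambda>\<omega>. U \<omega> ^ 4) = 3 * (expectation (\<lambda>\<omega>. (U \<omega>)\<^sup>2))\<^sup>2"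
begin

lemma L_diff: "U \<in> L \<Longrightarrow> V \<in> L \<Longrightarrow> (\<lambda>\<omega>. U \<omega> - V \<omega>) \<in> L"
  using L_add[OF _ L_scale[of V "-1"]] by simp

lemma L_sum: "(\<And>j. j \<in> A \<Longrightarrow> U j \<in> L) \<Longrightarrow> (\<lambda>\<omega>. \<Sum>j\<in>A. U j \<omega>) \<in> L"
proof (induction A rule: infinite_finite_induct)
  case (insert x F)
  then show ?case using L_add[of "U x" "\<lambda>\<omega>. \<Sum>j\<in>F. U j \<omega>"] by simp
qed (use L_zero in auto)

lemma L_integrable_prod4:
  assumes "U \<in> L" "V \<in> L" "W \<in> L" "Z \<in> L"
  shows "integrable M (\<lambda>\<omega>. U \<omega> * V \<omega> * W \<omega> * Z \<omega>)"
proof (rule Bochner_Integration.integrable_bound)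
  show "integrable M (\<lambda>\<omega>. U \<omega> ^ 4 + V \<omega> ^ 4 + W \<omega> ^ 4 + Z \<omega> ^ 4)"
    using assms by (intro Bochner_Integration.integrable_add L_integrable4)
  show "(\<lambda>\<omega>. U \<omega> * V \<omega> * W \<omega> * Z \<omega>) \<in> borel_measurable M"
    using assms[THEN L_measurable] by measurable
  have "\<bar>a * b * c * d\<bar> \<le> \<bar>a ^ 4 + b ^ 4 + c ^ 4 + d ^ 4\<bar>" for a b c d :: real
  proof -
    have *: "\<bar>x * y\<bar> \<le> (x\<^sup>2 + y\<^sup>2) / 2" for x y :: real
      using sum_squares_bound[of "\<bar>x\<bar>" "\<bar>y\<bar>"] by (simp add: abs_mult)
    have "\<bar>a * b * (c * d)\<bar> \<le> ((a * b)\<^sup>2 + (c * d)\<^sup>2) / 2" by (rule *)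
    also have "\<dots> = (\<bar>a\<^sup>2 * b\<^sup>2\<bar> + \<bar>c\<^sup>2 * d\<^sup>2\<bar>) / 2" by (simp add: power_mult_distrib)
    also have "\<dots> \<le> ((((a\<^sup>2)\<^sup>2 + (b\<^sup>2)\<^sup>2) / 2) + (((c\<^sup>2)\<^sup>2 + (d\<^sup>2)\<^sup>2) / 2)) / 2"
      by (intro divide_right_mono add_mono *) auto
    also have "\<dots> = (a ^ 4 + b ^ 4 + c ^ 4 + d ^ 4) / 4" by (simp add: field_simps)
    also have "\<dots> \<le> \<bar>a ^ 4 + b ^ 4 + c ^ 4 + d ^ 4\<bar>" by simp
    finally show ?thesis by (simp add: mult.assoc)
  qed
  then show "AE x in M. norm (U x * V x * W x * Z x) \<le> norm (U x ^ 4 + V x ^ 4 + W x ^ 4 + Z x ^ 4)" by simp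
qed

lemma L_integrable_prod2:
  assumes "U \<in> L" "V \<in> L"
  shows "integrable M (\<lambda>\<omega>. U \<omega> * V \<omega>)"
proof (rule Bochner_Integration.integrable_bound)
  show "integrable M (\<lambda>\<omega>. 1 + U \<omega> ^ 4 + V \<omega> ^ 4)"
    using assms by (intro Bochner_Integration.integrable_add L_integrable4) auto
  show "(\<lambda>\<omega>. U \<omega> * V \<omega>) \<in> borel_measurable M"
    using assms[THEN L_measurable] by measurable
  have "\<bar>a * b\<bar> \<le> \<bar>1 + a ^ 4 + b ^ 4\<bar>" for a b :: real
  proof -
    have *: "\<bar>x * y\<bar> \<le> (x\<^sup>2 + y\<^sup>2) / 2" for x y :: real
      using sum_squares_bound[of "\<bar>x\<bar>" "\<bar>y\<bar>"] by (simp add: abs_mult)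
    have "\<bar>a * b\<bar> \<le> \<bar>1 * a\<^sup>2\<bar> / 2 + \<bar>1 * b\<^sup>2\<bar> / 2" using *[of a b] by simp
    also have "\<dots> \<le> ((1\<^sup>2 + (a\<^sup>2)\<^sup>2) / 2) / 2 + ((1\<^sup>2 + (b\<^sup>2)\<^sup>2) / 2) / 2"
      by (intro add_mono divide_right_mono *) auto
    also have "\<dots> \<le> 1 + a ^ 4 + b ^ 4" by (simp add: field_simps)
    finally show ?thesis by simp
  qed
  then show "AE x in M. norm (U x * V x) \<le> norm (1 + U x ^ 4 + V x ^ 4)" by simp
qed

lemma L_integrable_sq: "U \<in> L \<Longrightarrow> integrable M (\<lambda>\<omega>. (U \<omega>)\<^sup>2)"
  using L_integrable_prod2[of U U] by (simp add: power2_eq_square)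

lemma L_integrable_sqsq: "U \<in> L \<Longrightarrow> V \<in> L \<Longrightarrow> integrable M (\<lambda>\<omega>. (U \<omega>)\<^sup>2 * (V \<omega>)\<^sup>2)"
  using L_integrable_prod4[of U U V V] by (simp add: power2_eq_square mult.assoc)

lemma L_integrable_prodsq: "U \<in> L \<Longrightarrow> V \<in> L \<Longrightarrow> W \<in> L \<Longrightarrow> integrable M (\<lambda>\<omega>. U \<omega> * V \<omega> * (W \<omega>)\<^sup>2)"
  using L_integrable_prod4[of U V W W] by (simp add: power2_eq_square mult.assoc)

definition ip :: "('a \<Rightarrow> real) \<Rightarrow> ('a \<Rightarrow> real) \<Rightarrow> real" where
  "ip U V = expectation (\<lambda>\<omega>. U \<omega> * V \<omega>)"

lemma ip_commute: "ip U V = ip V U" unfolding ip_def by (simp add: mult.commute)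

lemma ip_add_left: "U \<in> L \<Longrightarrow> V \<in> L \<Longrightarrow> W \<in> L \<Longrightarrow> ip (\<lambda>\<omega>. U \<omega> + V \<omega>) W = ip U W + ip V W"
  unfolding ip_def by (simp add: L_integrable_prod2 distrib_right)

lemma ip_diff_left: "U \<in> L \<Longrightarrow> V \<in> L \<Longrightarrow> W \<in> L \<Longrightarrow> ip (\<lambda>\<omega>. U \<omega> - V \<omega>) W = ip U W - ip V W"
  unfolding ip_def by (simp add: L_integrable_prod2 left_diff_distrib)

lemma ip_scale_left: "ip (\<lambda>\<omega>. r * U \<omega>) W = r * ip U W"
  unfolding ip_def by (simp add: mult.assoc)

lemma ip_add_right: "U \<in> L \<Longrightarrow> V \<in> L \<Longrightarrow> W \<in> L \<Longrightarrow> ip W (\<lambda>\<omega>. U \<omega> + V \<omega>) = ip W U + ip W V"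
  by (simp add: ip_commute[of W] ip_add_left)

lemma ip_diff_right: "U \<in> L \<Longrightarrow> V \<in> L \<Longrightarrow> W \<in> L \<Longrightarrow> ip W (\<lambda>\<omega>. U \<omega> - V \<omega>) = ip W U - ip W V"
  by (simp add: ip_commute[of W] ip_diff_left)

lemma ip_scale_right: "ip W (\<lambda>\<omega>. r * U \<omega>) = r * ip W U"
  by (simp add: ip_commute[of W] ip_scale_left)

lemma ip_self_nonneg: "ip U U \<ge> 0" unfolding ip_def by (auto intro: integral_nonneg_AE)

lemma ip_self: "ip U U = expectation (\<lambda>\<omega>. (U \<omega>)\<^sup>2)" unfolding ip_def by (simp add: power2_eq_square)

lemmas ip_simps = ip_add_left ip_diff_left ip_scale_left ip_add_right ip_diff_right ip_scale_right
  L_add L_diff L_scale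

lemma ip_cauchy_schwarz:
  assumes "U \<in> L" "V \<in> L"
  shows "(ip U V)\<^sup>2 \<le> ip U U * ip V V"
proof (cases "ip V V = 0")
  case False
  have "0 \<le> ip (\<lambda>\<omega>. ip V V * U \<omega> - ip U V * V \<omega>) (\<lambda>\<omega>. ip V V * U \<omega> - ip U V * V \<omega>)" by (rule ip_self_nonneg)
  also have "\<dots> = ip V V * (ip V V * ip U U - (ip U V)\<^sup>2)"
    using assms ip_commute[of U V] by (simp add: ip_simps, (simp add: algebra_simps power2_eq_square)?)
  finally show ?thesis using False ip_self_nonneg[of V] by (auto simp: zero_le_mult_iff mult.commute)
next
  case True
  have pos: "0 \<le> ip U U + 2 * r * ip U V" for r
  proof -
    have "0 \<le> ip (\<lambda>\<omega>. U \<omega> + r * V \<omega>) (\<lambda>\<omega>. U \<omega> + r * V \<omega>)" by (rule ip_self_nonneg)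
    also have "\<dots> = ip U U + 2 * r * ip U V"
      using assms ip_commute[of U V] True by (simp add: ip_simps, (simp add: algebra_simps)?)
    finally show ?thesis .
  qed
  have "ip U V = 0"
  proof (rule ccontr)
    assume "ip U V \<noteq> 0"
    then have "2 * (- (ip U U + 1) / (2 * ip U V)) * ip U V = - (ip U U + 1)" by simp
    with pos[of "- (ip U U + 1) / (2 * ip U V)"] show False by linarith
  qed
  then show ?thesis using True by simp
qed

text \<open>Add the fourth moments of \<open>U + V\<close> and \<open>U - V\<close>. The next two lemmas polarise the result once more in
each square.\<close>

lemma isserlis_sq:
  assumes U: "U \<in> L" and V: "V \<in> L"
  shows "expectation (\<lambda>\<omega>. (U \<omega>)\<^sup>2 * (V \<omega>)\<^sup>2) = ip U U * ip V V + 2 * (ip U V)\<^sup>2"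
proof -
  let ?E = expectation
  have "?E (\<lambda>\<omega>. (U \<omega> + V \<omega>) ^ 4) + ?E (\<lambda>\<omega>. (U \<omega> - V \<omega>) ^ 4) =
    ?E (\<lambda>\<omega>. (U \<omega> + V \<omega>) ^ 4 + (U \<omega> - V \<omega>) ^ 4)"
    using L_integrable4[OF L_add[OF U V]] L_integrable4[OF L_diff[OF U V]] by simp
  also have "(\<lambda>\<omega>. (U \<omega> + V \<omega>) ^ 4 + (U \<omega> - V \<omega>) ^ 4) =
     (\<lambda>\<omega>. 2 * U \<omega> ^ 4 + 12 * ((U \<omega>)\<^sup>2 * (V \<omega>)\<^sup>2) + 2 * V \<omega> ^ 4)"
    by (intro ext) (simp add: algebra_simps power4_eq_xxxx power2_eq_square)
  also have "?E \<dots> = 2 * ?E (\<lambda>\<omega>. U \<omega> ^ 4) + 12 * ?E (\<lambda>\<omega>. (U \<omega>)\<^sup>2 * (V \<omega>)\<^sup>2) + 2 * ?E (\<lambda>\<omega>. V \<omega> ^ 4)"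
    using L_integrable4[OF U] L_integrable4[OF V] L_integrable_sqsq[OF U V] by simp
  finally have "3 * (ip (\<lambda>\<omega>. U \<omega> + V \<omega>) (\<lambda>\<omega>. U \<omega> + V \<omega>))\<^sup>2 + 3 * (ip (\<lambda>\<omega>. U \<omega> - V \<omega>) (\<lambda>\<omega>. U \<omega> - V \<omega>))\<^sup>2
    = 6 * (ip U U)\<^sup>2 + 12 * ?E (\<lambda>\<omega>. (U \<omega>)\<^sup>2 * (V \<omega>)\<^sup>2) + 6 * (ip V V)\<^sup>2"
    using L_moment4[OF L_add[OF U V]] L_moment4[OF L_diff[OF U V]] L_moment4[OF U] L_moment4[OF V]
    by (simp add: ip_self)
  then show ?thesis using U V ip_commute[of V U] by (simp add: ip_simps, (simp add: algebra_simps power2_eq_square)?)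
qed

lemma isserlis_prod_sq:
  assumes U: "U \<in> L" and V: "V \<in> L" and W: "W \<in> L"
  shows "expectation (\<lambda>\<omega>. U \<omega> * V \<omega> * (W \<omega>)\<^sup>2) = ip U V * ip W W + 2 * ip U W * ip V W"
proof -
  let ?E = expectation
  have "4 * ?E (\<lambda>\<omega>. U \<omega> * V \<omega> * (W \<omega>)\<^sup>2) = ?E (\<lambda>\<omega>. (U \<omega> + V \<omega>)\<^sup>2 * (W \<omega>)\<^sup>2 - (U \<omega> - V \<omega>)\<^sup>2 * (W \<omega>)\<^sup>2)"
    unfolding integral_mult_right_zero[symmetric]
    by (intro arg_cong[of _ _ ?E] ext) (simp add: algebra_simps power2_eq_square)
  also have "\<dots> = ?E (\<lambda>\<omega>. (U \<omega> + V \<omega>)\<^sup>2 * (W \<omega>)\<^sup>2) - ?E (\<lambda>\<omega>. (U \<omega> - V \<omega>)\<^sup>2 * (W \<omega>)\<^sup>2)"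
    using L_integrable_sqsq[OF L_add[OF U V] W] L_integrable_sqsq[OF L_diff[OF U V] W] by simp
  finally show ?thesis using isserlis_sq[OF L_add[OF U V] W] isserlis_sq[OF L_diff[OF U V] W] U V W
    ip_commute[of V U]
    by (simp add: ip_simps, (simp add: algebra_simps power2_eq_square)?)
qed

lemma isserlis:
  assumes U: "U \<in> L" and V: "V \<in> L" and W: "W \<in> L" and Z: "Z \<in> L"
  shows "expectation (\<lambda>\<omega>. U \<omega> * V \<omega> * (W \<omega> * Z \<omega>)) = ip U V * ip W Z + ip U W * ip V Z + ip U Z * ip V W"
proof -
  let ?E = expectation
  have "4 * ?E (\<lambda>\<omega>. U \<omega> * V \<omega> * (W \<omega> * Z \<omega>)) = ?E (\<lambda>\<omega>. U \<omega> * V \<omega> * (W \<omega> + Z \<omega>)\<^sup>2 - U \<omega> * V \<omega> * (W \<omega> - Z \<omega>)\<^sup>2)"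
    unfolding integral_mult_right_zero[symmetric]
    by (intro arg_cong[of _ _ ?E] ext) (simp add: algebra_simps power2_eq_square)
  also have "\<dots> = ?E (\<lambda>\<omega>. U \<omega> * V \<omega> * (W \<omega> + Z \<omega>)\<^sup>2) - ?E (\<lambda>\<omega>. U \<omega> * V \<omega> * (W \<omega> - Z \<omega>)\<^sup>2)"
    using L_integrable_prodsq[OF U V L_add[OF W Z]] L_integrable_prodsq[OF U V L_diff[OF W Z]] by simp
  finally show ?thesis using isserlis_prod_sq[OF U V L_add[OF W Z]] isserlis_prod_sq[OF U V L_diff[OF W Z]] U V W Z
    ip_commute[of Z W]
    by (simp add: ip_simps, (simp add: algebra_simps power2_eq_square)?)
qed

lemma expectation_double_sum:
  fixes T :: "nat \<Rightarrow> 'a \<Rightarrow> real"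
  assumes "\<And>j k. j < n \<Longrightarrow> k < n \<Longrightarrow> integrable M (\<lambda>\<omega>. T j \<omega> * T k \<omega>)"
  shows "integrable M (\<lambda>\<omega>. (\<Sum>j<n. T j \<omega>)\<^sup>2)"
    "expectation (\<lambda>\<omega>. (\<Sum>j<n. T j \<omega>)\<^sup>2) = (\<Sum>j<n. \<Sum>k<n. expectation (\<lambda>\<omega>. T j \<omega> * T k \<omega>))"
proof -
  have *: "(\<lambda>\<omega>. (\<Sum>j<n. T j \<omega>)\<^sup>2) = (\<lambda>\<omega>. \<Sum>j<n. \<Sum>k<n. T j \<omega> * T k \<omega>)"
    by (simp add: power2_eq_square sum_product)
  show "integrable M (\<lambda>\<omega>. (\<Sum>j<n. T j \<omega>)\<^sup>2)" unfolding * using assms by (intro Bochner_Integration.integrable_sum) auto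
  show "expectation (\<lambda>\<omega>. (\<Sum>j<n. T j \<omega>)\<^sup>2) = (\<Sum>j<n. \<Sum>k<n. expectation (\<lambda>\<omega>. T j \<omega> * T k \<omega>))"
    unfolding * using assms by (subst Bochner_Integration.integral_sum, force)+ (auto intro!: sum.cong)
qed

lemma weighted_squares_moment:
  fixes U :: "nat \<Rightarrow> 'a \<Rightarrow> real" and c :: "nat \<Rightarrow> real"
  assumes U: "\<And>j. j < n \<Longrightarrow> U j \<in> L" and c: "\<And>j. j < n \<Longrightarrow> 0 \<le> c j"
  defines "Y \<equiv> \<lambda>\<omega>. \<Sum>j<n. c j * (U j \<omega>)\<^sup>2"
  shows "integrable M Y" "integrable M (\<lambda>\<omega>. (Y \<omega>)\<^sup>2)" "expectation Y = (\<Sum>j<n. c j * ip (U j) (U j))"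
    "expectation (\<lambda>\<omega>. (Y \<omega>)\<^sup>2) \<le> 3 * (expectation Y)\<^sup>2"
proof -
  show "integrable M Y" unfolding Y_def using L_integrable_sq[OF U] by auto
  show EY: "expectation Y = (\<Sum>j<n. c j * ip (U j) (U j))" unfolding Y_def
    using L_integrable_sq[OF U] by (simp add: ip_self)
  have *: "(\<lambda>\<omega>. (c j * (U j \<omega>)\<^sup>2) * (c k * (U k \<omega>)\<^sup>2)) = (\<lambda>\<omega>. (c j * c k) * ((U j \<omega>)\<^sup>2 * (U k \<omega>)\<^sup>2))" for j k
    by (simp add: algebra_simps)
  have int: "integrable M (\<lambda>\<omega>. (c j * (U j \<omega>)\<^sup>2) * (c k * (U k \<omega>)\<^sup>2))" if "j < n" "k < n" for j k
    unfolding * using L_integrable_sqsq U that by auto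
  show "integrable M (\<lambda>\<omega>. (Y \<omega>)\<^sup>2)" unfolding Y_def by (rule expectation_double_sum(1)) (rule int)
  have "expectation (\<lambda>\<omega>. (Y \<omega>)\<^sup>2) = (\<Sum>j<n. \<Sum>k<n. (c j * c k) * expectation (\<lambda>\<omega>. (U j \<omega>)\<^sup>2 * (U k \<omega>)\<^sup>2))"
    unfolding Y_def by (subst expectation_double_sum(2)[OF int]) (auto simp: * intro!: sum.cong)
  also have "\<dots> \<le> (\<Sum>j<n. \<Sum>k<n. (c j * c k) * (3 * (ip (U j) (U j) * ip (U k) (U k))))"
  proof (intro sum_mono mult_left_mono)
    fix j k assume "j \<in> {..<n}" "k \<in> {..<n}"
    then show "expectation (\<lambda>\<omega>. (U j \<omega>)\<^sup>2 * (U k \<omega>)\<^sup>2) \<le> 3 * (ip (U j) (U j) * ip (U k) (U k))" "0 \<le> c j * c k"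
      using isserlis_sq[OF U U, of j k] ip_cauchy_schwarz[OF U U, of j k] c by auto
  qed
  also have "\<dots> = 3 * (\<Sum>j<n. c j * ip (U j) (U j))\<^sup>2"
    by (simp add: power2_eq_square sum_product sum_distrib_left algebra_simps)
  finally show "expectation (\<lambda>\<omega>. (Y \<omega>)\<^sup>2) \<le> 3 * (expectation Y)\<^sup>2" unfolding EY .
qed

text \<open>For orthogonal \<open>W j\<close> the covariances \<open>2 * (ip (W j) (W k))\<^sup>2\<close> of the squares vanish off the diagonal.
The variance is therefore at most twice the largest term times the sum of the \<open>w j\<close>.\<close>

lemma variance_sum_squares_orthogonal:
  fixes W :: "nat \<Rightarrow> 'a \<Rightarrow> real"
  assumes W: "\<And>j. j < n \<Longrightarrow> W j \<in> L" and orth: "\<And>j k. j < k \<Longrightarrow> k < n \<Longrightarrow> ip (W j) (W k) = 0"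
  defines "w \<equiv> \<lambda>j. ip (W j) (W j)"
  shows "integrable M (\<lambda>\<omega>. ((\<Sum>j<n. (W j \<omega>)\<^sup>2) - (\<Sum>j<n. w j))\<^sup>2)"
    "expectation (\<lambda>\<omega>. ((\<Sum>j<n. (W j \<omega>)\<^sup>2) - (\<Sum>j<n. w j))\<^sup>2) = 2 * (\<Sum>j<n. (w j)\<^sup>2)"
proof -
  have *: "(\<lambda>\<omega>. ((\<Sum>j<n. (W j \<omega>)\<^sup>2) - (\<Sum>j<n. w j))\<^sup>2) = (\<lambda>\<omega>. (\<Sum>j<n. (W j \<omega>)\<^sup>2 - w j)\<^sup>2)"
    by (simp add: sum_subtractf)
  have **: "(\<lambda>\<omega>. ((W j \<omega>)\<^sup>2 - w j) * ((W k \<omega>)\<^sup>2 - w k)) =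
    (\<lambda>\<omega>. (W j \<omega>)\<^sup>2 * (W k \<omega>)\<^sup>2 - w j * (W k \<omega>)\<^sup>2 - w k * (W j \<omega>)\<^sup>2 + w j * w k)" for j k
    by (simp add: algebra_simps)
  have int: "integrable M (\<lambda>\<omega>. ((W j \<omega>)\<^sup>2 - w j) * ((W k \<omega>)\<^sup>2 - w k))" if "j < n" "k < n" for j k
    unfolding ** using L_integrable_sqsq[OF W W] L_integrable_sq[OF W] that by auto
  show "integrable M (\<lambda>\<omega>. ((\<Sum>j<n. (W j \<omega>)\<^sup>2) - (\<Sum>j<n. w j))\<^sup>2)"
    unfolding * by (rule expectation_double_sum(1)) (rule int)
  have orth': "ip (W j) (W k) = 0" if "j \<noteq> k" "j < n" "k < n" for j k
    using orth[of j k] orth[of k j] that ip_commute[of "W j" "W k"] by (cases "j < k") auto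
  have val: "expectation (\<lambda>\<omega>. ((W j \<omega>)\<^sup>2 - w j) * ((W k \<omega>)\<^sup>2 - w k)) = (if k = j then 2 * (w j)\<^sup>2 else 0)"
    if "j < n" "k < n" for j k
  proof -
    have "expectation (\<lambda>\<omega>. ((W j \<omega>)\<^sup>2 - w j) * ((W k \<omega>)\<^sup>2 - w k)) = 2 * (ip (W j) (W k))\<^sup>2"
      unfolding ** using L_integrable_sqsq[OF W W] L_integrable_sq[OF W] that isserlis_sq[OF W W, of j k]
      by (simp add: prob_space ip_self[symmetric] w_def algebra_simps)
    then show ?thesis using orth'[of j k] that by (auto simp: w_def)
  qed
  have "expectation (\<lambda>\<omega>. ((\<Sum>j<n. (W j \<omega>)\<^sup>2) - (\<Sum>j<n. w j))\<^sup>2) = (\<Sum>j<n. \<Sum>k<n. if k = j then 2 * (w j)\<^sup>2 else 0)"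
  proof -
    have "expectation (\<lambda>\<omega>. (\<Sum>j<n. (W j \<omega>)\<^sup>2 - w j)\<^sup>2) =
      (\<Sum>j<n. \<Sum>k<n. expectation (\<lambda>\<omega>. ((W j \<omega>)\<^sup>2 - w j) * ((W k \<omega>)\<^sup>2 - w k)))"
      by (rule expectation_double_sum(2)) (rule int)
    also have "\<dots> = (\<Sum>j<n. \<Sum>k<n. if k = j then 2 * (w j)\<^sup>2 else 0)"
      by (intro sum.cong refl val) auto
    finally show ?thesis unfolding * .
  qed
  also have "\<dots> = 2 * (\<Sum>j<n. (w j)\<^sup>2)" by (simp add: sum_distrib_left)
  finally show "expectation (\<lambda>\<omega>. ((\<Sum>j<n. (W j \<omega>)\<^sup>2) - (\<Sum>j<n. w j))\<^sup>2) = 2 * (\<Sum>j<n. (w j)\<^sup>2)" .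
qed

text \<open>The discrete analogue of the Ito isometry for the unbounded integrand \<open>c j * U j\<close>: in the Isserlis
formula each of the three pairings contains a factor that is zero unless \<open>j = k\<close>.\<close>

lemma transform_second_moment:
  fixes U W :: "nat \<Rightarrow> 'a \<Rightarrow> real" and c :: "nat \<Rightarrow> real"
  assumes U: "\<And>j. j < n \<Longrightarrow> U j \<in> L" and W: "\<And>j. j < n \<Longrightarrow> W j \<in> L"
    and orth: "\<And>j k. j < k \<Longrightarrow> k < n \<Longrightarrow> ip (W j) (W k) = 0"
      "\<And>j k. j \<le> k \<Longrightarrow> k < n \<Longrightarrow> ip (U j) (W k) = 0"
  defines "Z \<equiv> \<lambda>\<omega>. \<Sum>j<n. c j * (U j \<omega> * W j \<omega>)"
  shows "integrable M (\<lambda>\<omega>. (Z \<omega>)\<^sup>2)"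
    "expectation (\<lambda>\<omega>. (Z \<omega>)\<^sup>2) = (\<Sum>j<n. (c j)\<^sup>2 * (ip (U j) (U j) * ip (W j) (W j)))"
proof -
  have **: "(\<lambda>\<omega>. c j * (U j \<omega> * W j \<omega>) * (c k * (U k \<omega> * W k \<omega>))) =
    (\<lambda>\<omega>. (c j * c k) * (U j \<omega> * W j \<omega> * (U k \<omega> * W k \<omega>)))" for j k
    by (simp add: algebra_simps)
  have int: "integrable M (\<lambda>\<omega>. c j * (U j \<omega> * W j \<omega>) * (c k * (U k \<omega> * W k \<omega>)))" if "j < n" "k < n" for j k
    unfolding ** using L_integrable_prod4[OF U W U W, of j j k k] that by (auto simp: mult.assoc)
  show "integrable M (\<lambda>\<omega>. (Z \<omega>)\<^sup>2)"
    unfolding Z_def by (rule expectation_double_sum(1)) (rule int)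
  have val: "expectation (\<lambda>\<omega>. c j * (U j \<omega> * W j \<omega>) * (c k * (U k \<omega> * W k \<omega>))) =
     (if k = j then (c j)\<^sup>2 * (ip (U j) (U j) * ip (W j) (W j)) else 0)"
    if "j < n" "k < n" for j k
  proof -
    have *: "expectation (\<lambda>\<omega>. c j * (U j \<omega> * W j \<omega>) * (c k * (U k \<omega> * W k \<omega>))) =
      (c j * c k) * (ip (U j) (W j) * ip (U k) (W k) + ip (U j) (U k) * ip (W j) (W k) + ip (U j) (W k) * ip (W j) (U k))"
      unfolding ** using isserlis[OF U W U W, of j j k k] that by simp
    consider "k = j" | "j < k" | "k < j" by linarith
    then show ?thesis
    proof cases
      case 1
      then show ?thesis using * orth(2)[of j j] that by (simp add: power2_eq_square)
    next
      case 2
      then show ?thesis using * orth(1)[of j k] orth(2)[of j j] orth(2)[of j k] that by simp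
    next
      case 3
      then show ?thesis using * orth(1)[of k j] orth(2)[of k k] orth(2)[of k j] ip_commute[of "W j"] that by simp
    qed
  qed
  have "expectation (\<lambda>\<omega>. (Z \<omega>)\<^sup>2) = (\<Sum>j<n. \<Sum>k<n. if k = j then (c j)\<^sup>2 * (ip (U j) (U j) * ip (W j) (W j)) else 0)"
  proof -
    have "expectation (\<lambda>\<omega>. (Z \<omega>)\<^sup>2) =
      (\<Sum>j<n. \<Sum>k<n. expectation (\<lambda>\<omega>. c j * (U j \<omega> * W j \<omega>) * (c k * (U k \<omega> * W k \<omega>))))"
      unfolding Z_def by (rule expectation_double_sum(2)) (rule int)
    also have "\<dots> = (\<Sum>j<n. \<Sum>k<n. if k = j then (c j)\<^sup>2 * (ip (U j) (U j) * ip (W j) (W j)) else 0)"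
      by (intro sum.cong refl val) auto
    finally show ?thesis .
  qed
  also have "\<dots> = (\<Sum>j<n. (c j)\<^sup>2 * (ip (U j) (U j) * ip (W j) (W j)))" by simp
  finally show "expectation (\<lambda>\<omega>. (Z \<omega>)\<^sup>2) = (\<Sum>j<n. (c j)\<^sup>2 * (ip (U j) (U j) * ip (W j) (W j)))" .
qed

text \<open>Choose the signs one after the other so that no cross term is negative.\<close>

lemma greedy_signs:
  fixes D :: "nat \<Rightarrow> 'a \<Rightarrow> real"
  assumes "\<And>j. j < n \<Longrightarrow> D j \<in> L"
  shows "\<exists>\<sigma>::nat \<Rightarrow> real. (\<forall>j. \<bar>\<sigma> j\<bar> \<le> 1) \<and>
    (\<Sum>j<n. ip (D j) (D j)) \<le> ip (\<lambda>\<omega>. \<Sum>j<n. \<sigma> j * D j \<omega>) (\<lambda>\<omega>. \<Sum>j<n. \<sigma> j * D j \<omega>)"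
  using assms
proof (induction n)
  case 0
  show ?case by (intro exI[of _ "\<lambda>_. 0"]) (auto simp: ip_self_nonneg)
next
  case (Suc n)
  then obtain \<sigma> where s: "\<And>j. \<bar>\<sigma> j\<bar> \<le> 1" "(\<Sum>j<n. ip (D j) (D j)) \<le> ip (\<lambda>\<omega>. \<Sum>j<n. \<sigma> j * D j \<omega>) (\<lambda>\<omega>. \<Sum>j<n. \<sigma> j * D j \<omega>)"
    by auto
  define S where "S = (\<lambda>\<omega>. \<Sum>j<n. \<sigma> j * D j \<omega>)"
  have S: "S \<in> L" unfolding S_def using Suc.prems by (intro L_sum L_scale) auto
  have Dn: "D n \<in> L" using Suc.prems by simp
  define \<tau> where "\<tau> = (if ip S (D n) \<ge> 0 then 1 else -1 :: real)"
  have t: "\<bar>\<tau>\<bar> \<le> 1" "\<tau> * \<tau> = 1" "\<tau> * ip S (D n) \<ge> 0" unfolding \<tau>_def by auto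
  have eq: "(\<lambda>\<omega>. \<Sum>j<Suc n. (\<sigma>(n := \<tau>)) j * D j \<omega>) = (\<lambda>\<omega>. S \<omega> + \<tau> * D n \<omega>)"
    unfolding S_def by (intro ext) (auto intro!: sum.cong)
  have "ip (\<lambda>\<omega>. S \<omega> + \<tau> * D n \<omega>) (\<lambda>\<omega>. S \<omega> + \<tau> * D n \<omega>) = ip S S + 2 * (\<tau> * ip S (D n)) + (\<tau> * \<tau>) * ip (D n) (D n)"
    using S Dn ip_commute[of "D n" S] by (simp add: ip_simps, (simp add: algebra_simps)?)
  then have "(\<Sum>j<Suc n. ip (D j) (D j)) \<le>
     ip (\<lambda>\<omega>. \<Sum>j<Suc n. (\<sigma>(n := \<tau>)) j * D j \<omega>) (\<lambda>\<omega>. \<Sum>j<Suc n. (\<sigma>(n := \<tau>)) j * D j \<omega>)"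
    unfolding eq using s(2) t unfolding S_def[symmetric] by simp
  moreover have "\<forall>j. \<bar>(\<sigma>(n := \<tau>)) j\<bar> \<le> 1" using s(1) t(1) by simp
  ultimately show ?case by blast
qed

end

section \<open>Martingale transforms\<close>

text \<open>Burkholder's function: it majorises the indicator of \<open>\<bar>y\<bar> \<ge> 1\<close> minus \<open>2 * \<bar>x\<bar>\<close>, is at most 0 on the axis
\<open>y = 0\<close>, and is concave along every line of slope at most 1 in absolute value. A transform with an
integrand bounded by 1 moves along such lines, so that a martingale together with its transform turns
it into a supermartingale. The functions \<open>burkholder_x\<close> and \<open>burkholder_y\<close> are the coefficients of
the supporting affine function.\<close>

definition burkholder :: "real \<Rightarrow> real \<Rightarrow> real" where
  "burkholder x y = (if \<bar>x\<bar> + \<bar>y\<bar> \<le> 1 then y\<^sup>2 - x\<^sup>2 else 1 - 2 * \<bar>x\<bar>)"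

definition burkholder_x :: "real \<Rightarrow> real \<Rightarrow> real" where
  "burkholder_x x y = (if \<bar>x\<bar> + \<bar>y\<bar> \<le> 1 then - 2 * x else - 2 * sgn x)"

definition burkholder_y :: "real \<Rightarrow> real \<Rightarrow> real" where
  "burkholder_y x y = (if \<bar>x\<bar> + \<bar>y\<bar> \<le> 1 then 2 * y else 0)"

lemma burkholder_le_outer: "burkholder x y \<le> 1 - 2 * \<bar>x\<bar>"
proof (cases "\<bar>x\<bar> + \<bar>y\<bar> \<le> 1")
  case True
  then have "\<bar>y\<bar>\<^sup>2 \<le> (1 - \<bar>x\<bar>)\<^sup>2" by (intro power_mono) auto
  then show ?thesis using True by (simp add: burkholder_def power2_eq_square algebra_simps)
qed (simp add: burkholder_def)

lemma burkholder_lower: "(if 1 \<le> \<bar>y\<bar> then 1 else 0) - 2 * \<bar>x\<bar> \<le> burkholder x y"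
proof (cases "\<bar>x\<bar> + \<bar>y\<bar> \<le> 1")
  case True
  then have "\<bar>x\<bar> * \<bar>x\<bar> \<le> 1 * \<bar>x\<bar>" by (intro mult_right_mono) auto
  moreover have "x = 0" "y\<^sup>2 = 1" if "1 \<le> \<bar>y\<bar>"
  proof -
    have "\<bar>y\<bar> = 1" "x = 0" using True that by auto
    then show "x = 0" "y\<^sup>2 = 1" by (auto simp: abs_square_eq_1)
  qed
  moreover have "0 \<le> y * y" "0 \<le> \<bar>x\<bar>" by simp_all
  ultimately have "- (2 * \<bar>x\<bar>) \<le> y * y - x * x" "1 \<le> \<bar>y\<bar> \<Longrightarrow> burkholder x y = 1 \<and> x = 0"
    using True by (simp_all only: abs_mult_self_eq mult_1 burkholder_def power2_eq_square) auto
  moreover have "burkholder x y = y * y - x * x" using True by (simp add: burkholder_def power2_eq_square)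
  ultimately show ?thesis by (cases "1 \<le> \<bar>y\<bar>") auto
qed (auto simp: burkholder_def)

lemma burkholder_start: "burkholder x 0 \<le> 0"
  by (auto simp: burkholder_def)

lemma burkholder_bound: "\<bar>burkholder x y\<bar> \<le> 1 + 2 * \<bar>x\<bar>"
  using burkholder_le_outer[of x y] burkholder_lower[of y x] by (auto split: if_splits)

lemma burkholder_x_bound: "\<bar>burkholder_x x y\<bar> \<le> 2" and burkholder_y_bound: "\<bar>burkholder_y x y\<bar> \<le> 2"
  by (auto simp: burkholder_x_def burkholder_y_def sgn_if)

text \<open>Only a step from the square \<open>\<bar>x\<bar> + \<bar>y\<bar> \<le> 1\<close> to its complement needs an argument. If the end point
\<open>(x', y')\<close> has \<open>\<bar>x'\<bar> \<le> 1 + \<bar>y'\<bar>\<close>, the extension \<open>y'\<^sup>2 - x'\<^sup>2\<close> of the inner formula still dominates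
\<open>1 - 2 * \<bar>x'\<bar>\<close>. Otherwise \<open>\<bar>x'\<bar> > 1\<close>, and one estimates \<open>y * k\<close> from below by \<open>- \<bar>y\<bar> * \<bar>h\<bar>\<close>.\<close>

lemma burkholder_step:
  assumes "\<bar>k\<bar> \<le> \<bar>h\<bar>"
  shows "burkholder (x + h) (y + k) \<le> burkholder x y + burkholder_x x y * h + burkholder_y x y * k"
proof (cases "\<bar>x\<bar> + \<bar>y\<bar> \<le> 1")
  case False
  have "sgn x * (x + h) \<le> \<bar>x + h\<bar>" by (auto simp: sgn_if)
  moreover have "sgn x * x = \<bar>x\<bar>" by (simp add: sgn_if)
  ultimately have "1 - 2 * \<bar>x + h\<bar> \<le> 1 - 2 * \<bar>x\<bar> - 2 * sgn x * h" by (simp add: algebra_simps)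
  then show ?thesis using False burkholder_le_outer[of "x + h" "y + k"]
    by (simp add: burkholder_def[of x y] burkholder_x_def burkholder_y_def)
next
  case True
  have "\<bar>k\<bar>\<^sup>2 \<le> \<bar>h\<bar>\<^sup>2" using assms by (intro power_mono) auto
  then have kh: "k\<^sup>2 \<le> h\<^sup>2" by simp
  define x' y' where "x' = x + h" and "y' = y + k"
  have rhs: "burkholder x y + burkholder_x x y * h + burkholder_y x y * k = y'\<^sup>2 - x'\<^sup>2 + (h\<^sup>2 - k\<^sup>2)"
    using True by (simp add: burkholder_def burkholder_x_def burkholder_y_def x'_def y'_def power2_eq_square algebra_simps)
  show ?thesis
  proof (cases "\<bar>x'\<bar> + \<bar>y'\<bar> \<le> 1")
    case True
    then show ?thesis using kh unfolding rhs unfolding x'_def[symmetric] y'_def[symmetric] by (simp add: burkholder_def)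
  next
    case out: False
    then have lhs: "burkholder (x + h) (y + k) = 1 - 2 * \<bar>x'\<bar>" unfolding x'_def y'_def by (simp add: burkholder_def)
    show ?thesis
    proof (cases "\<bar>x'\<bar> \<le> 1 + \<bar>y'\<bar>")
      case True
      then have "\<bar>1 - \<bar>x'\<bar>\<bar>\<^sup>2 \<le> \<bar>y'\<bar>\<^sup>2" using out by (intro power_mono) auto
      then show ?thesis using kh unfolding rhs lhs by (simp add: power2_eq_square algebra_simps)
    next
      case False
      then have x1: "\<bar>x'\<bar> > 1" by auto
      have "y * k \<ge> - (\<bar>y\<bar> * \<bar>h\<bar>)"
      proof -
        have "\<bar>y * k\<bar> \<le> \<bar>y\<bar> * \<bar>h\<bar>" using assms by (simp add: abs_mult mult_left_mono)
        then show ?thesis by linarith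
      qed
      then have lb: "burkholder x y + burkholder_x x y * h + burkholder_y x y * k \<ge> \<bar>y\<bar>\<^sup>2 - x\<^sup>2 - 2 * x * h - 2 * (\<bar>y\<bar> * \<bar>h\<bar>)"
        using True by (simp add: burkholder_def burkholder_x_def burkholder_y_def algebra_simps)
      define Y where "Y = \<bar>y\<bar>"
      have xy: "x + Y \<le> 1" "Y - x \<le> 1" using True unfolding Y_def by auto
      have h: "h = x' - x" unfolding x'_def by simp
      show ?thesis
      proof (cases "x' > 0")
        case True
        then have "x' > 1" using x1 by simp
        then have ah: "\<bar>h\<bar> = x' - x" using xy \<open>\<bar>x\<bar> + \<bar>y\<bar> \<le> 1\<close> unfolding h by auto
        have "0 \<le> (1 - (x + Y)) * (2 * x' - 1 - (x + Y))" using xy \<open>x' > 1\<close> by (intro mult_nonneg_nonneg) auto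
        then have "1 - 2 * x' \<le> Y\<^sup>2 - x\<^sup>2 - 2 * x * (x' - x) - 2 * (Y * (x' - x))"
          by (simp add: algebra_simps power2_eq_square)
        then show ?thesis using lb True unfolding lhs ah unfolding h Y_def by simp
      next
        case False
        then have "x' < -1" using x1 by simp
        then have ah: "\<bar>h\<bar> = x - x'" using xy \<open>\<bar>x\<bar> + \<bar>y\<bar> \<le> 1\<close> unfolding h by auto
        have "0 \<le> (1 - (Y - x)) * (- 2 * x' - 1 - (Y - x))" using xy \<open>x' < -1\<close> by (intro mult_nonneg_nonneg) auto
        then have "1 + 2 * x' \<le> Y\<^sup>2 - x\<^sup>2 - 2 * x * (x' - x) - 2 * (Y * (x - x'))"
          by (simp add: algebra_simps power2_eq_square)
        then show ?thesis using lb False unfolding lhs ah unfolding h Y_def by simp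
      qed
    qed
  qed
qed

lemma (in prob_space) martingale_difference_orthogonal:
  fixes C U V :: "'a \<Rightarrow> real"
  assumes F: "subalgebra M F" and C: "C \<in> borel_measurable F" "\<And>\<omega>. \<bar>C \<omega>\<bar> \<le> B"
    and int: "integrable M U" "integrable M V"
    and ce: "AE \<omega> in M. real_cond_exp M F V \<omega> = U \<omega>"
  shows "integrable M (\<lambda>\<omega>. C \<omega> * U \<omega>)" "integrable M (\<lambda>\<omega>. C \<omega> * V \<omega>)"
    "expectation (\<lambda>\<omega>. C \<omega> * V \<omega>) = expectation (\<lambda>\<omega>. C \<omega> * U \<omega>)"
proof -
  interpret finite_measure_subalgebra M F by unfold_locales (rule F)
  have [measurable]: "C \<in> borel_measurable M" using measurable_from_subalg[OF F C(1)] .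
  have bd: "integrable M (\<lambda>\<omega>. C \<omega> * W \<omega>)" if "integrable M W" for W :: "'a \<Rightarrow> real"
  proof (rule Bochner_Integration.integrable_bound)
    show "integrable M (\<lambda>\<omega>. B * W \<omega>)" using that by simp
    show "(\<lambda>\<omega>. C \<omega> * W \<omega>) \<in> borel_measurable M" using that by measurable
    have "0 \<le> B" using C(2) abs_ge_zero order_trans by blast
    then show "AE \<omega> in M. norm (C \<omega> * W \<omega>) \<le> norm (B * W \<omega>)"
      using C(2) by (auto simp: abs_mult intro!: mult_right_mono)
  qed
  show 1: "integrable M (\<lambda>\<omega>. C \<omega> * U \<omega>)" and 2: "integrable M (\<lambda>\<omega>. C \<omega> * V \<omega>)" using bd int by auto
  have "expectation (\<lambda>\<omega>. C \<omega> * V \<omega>) = expectation (\<lambda>\<omega>. C \<omega> * real_cond_exp M F V \<omega>)"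
    using real_cond_exp_intg(2)[OF 2 C(1)] int by simp
  also have "\<dots> = expectation (\<lambda>\<omega>. C \<omega> * U \<omega>)" using ce int by (intro integral_cong_AE) auto
  finally show "expectation (\<lambda>\<omega>. C \<omega> * V \<omega>) = expectation (\<lambda>\<omega>. C \<omega> * U \<omega>)" .
qed

text \<open>By \<open>burkholder_step\<close> the expectation of Burkholder's function along the pair consisting of the
martingale and its transform does not increase, as the linear terms have expectation zero; it starts
at a value that is at most 0, and \<open>burkholder_lower\<close> turns this into the tail bound.\<close>

lemma (in prob_space) martingale_transform_weak_type:
  fixes N H :: "nat \<Rightarrow> 'a \<Rightarrow> real" and F :: "nat \<Rightarrow> 'a measure"
  assumes F: "\<And>j. j \<le> n \<Longrightarrow> subalgebra M (F j)"
    and F_mono: "\<And>j. j < n \<Longrightarrow> sets (F j) \<subseteq> sets (F (Suc j))"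
    and N: "\<And>j. j \<le> n \<Longrightarrow> N j \<in> borel_measurable (F j)" "\<And>j. j \<le> n \<Longrightarrow> integrable M (N j)"
    and mart: "\<And>j. j < n \<Longrightarrow> AE \<omega> in M. real_cond_exp M (F j) (N (Suc j)) \<omega> = N j \<omega>"
    and H: "\<And>j. j < n \<Longrightarrow> H j \<in> borel_measurable (F j)" "\<And>j \<omega>. j < n \<Longrightarrow> \<bar>H j \<omega>\<bar> \<le> 1"
    and "r > 0"
  shows "prob {\<omega> \<in> space M. r \<le> \<bar>\<Sum>j<n. H j \<omega> * (N (Suc j) \<omega> - N j \<omega>)\<bar>} \<le> 2 * expectation (\<lambda>\<omega>. \<bar>N n \<omega>\<bar>) / r"
proof -
  define Z where "Z i \<omega> = (\<Sum>j<i. H j \<omega> * (N (Suc j) \<omega> - N j \<omega>))" for i \<omega>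
  define \<Phi> where "\<Phi> i \<omega> = burkholder (N i \<omega> / r) (Z i \<omega> / r)" for i \<omega>
  have F_mono': "sets (F i) \<subseteq> sets (F j)" if "i \<le> j" "j \<le> n" for i j
    using that
  proof (induction j rule: dec_induct)
    case (step k)
    then show ?case using F_mono[of k] by simp
  qed simp
  have mF: "f \<in> borel_measurable (F j)" if "f \<in> borel_measurable (F i)" "i \<le> j" "j \<le> n" for f :: "'a \<Rightarrow> real" and i j
  proof -
    have "subalgebra (F j) (F i)" using F[of i] F[of j] F_mono'[of i j] that unfolding subalgebra_def by auto
    then show ?thesis using that measurable_from_subalg by blast
  qed
  have Zm: "Z i \<in> borel_measurable (F i)" if "i \<le> n" for i
    unfolding Z_def using that by (intro borel_measurable_sum borel_measurable_times borel_measurable_diff)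
      (auto intro!: mF[OF H(1)] mF[OF N(1)])
  have [measurable]: "(\<lambda>x. burkholder (fst x) (snd x)) \<in> borel_measurable (borel \<Otimes>\<^sub>M borel)"
    unfolding burkholder_def by measurable
  have burkholder_m: "(\<lambda>\<omega>. burkholder (u \<omega>) (v \<omega>)) \<in> borel_measurable G"
    if [measurable]: "u \<in> borel_measurable G" "v \<in> borel_measurable G" for u v and G :: "'a measure"
    unfolding burkholder_def by measurable
  have \<Phi>m: "\<Phi> i \<in> borel_measurable M" if "i \<le> n" for i
    unfolding \<Phi>_def using measurable_from_subalg[OF F[OF that] Zm[OF that]] measurable_from_subalg[OF F[OF that] N(1)[OF that]]
    by (intro burkholder_m) auto
  have \<Phi>int: "integrable M (\<Phi> i)" if "i \<le> n" for i
  proof (rule Bochner_Integration.integrable_bound)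
    show "integrable M (\<lambda>\<omega>. 1 + 2 * \<bar>N i \<omega> / r\<bar>)" using N(2)[OF that] by auto
    show "AE \<omega> in M. norm (\<Phi> i \<omega>) \<le> norm (1 + 2 * \<bar>N i \<omega> / r\<bar>)"
      unfolding \<Phi>_def real_norm_def by (intro AE_I2 order_trans[OF burkholder_bound abs_ge_self])
  qed (rule \<Phi>m[OF that])
  have "expectation (\<Phi> i) \<le> 0" if "i \<le> n" for i
    using that
  proof (induction i)
    case 0
    have "expectation (\<Phi> 0) \<le> expectation (\<lambda>_. 0)"
      using \<Phi>int[of 0] by (intro integral_mono) (auto simp: burkholder_start \<Phi>_def Z_def cong: if_cong)
    then show ?case by simp
  next
    case (Suc i)
    define C where "C \<omega> = (burkholder_x (N i \<omega> / r) (Z i \<omega> / r) + burkholder_y (N i \<omega> / r) (Z i \<omega> / r) * H i \<omega>) / r" for \<omega>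
    have [measurable]: "N i \<in> borel_measurable (F i)" "Z i \<in> borel_measurable (F i)" "H i \<in> borel_measurable (F i)"
      using Suc.prems N(1) Zm H(1) by auto
    have Cm: "C \<in> borel_measurable (F i)" unfolding C_def burkholder_x_def burkholder_y_def by measurable
    have Cb: "\<bar>C \<omega>\<bar> \<le> 4 / r" for \<omega>
    proof -
      let ?x = "N i \<omega> / r" and ?y = "Z i \<omega> / r"
      have x: "\<bar>burkholder_x ?x ?y\<bar> \<le> 2" by (rule burkholder_x_bound)
      have y: "\<bar>burkholder_y ?x ?y\<bar> \<le> 2" by (rule burkholder_y_bound)
      have "\<bar>burkholder_y ?x ?y * H i \<omega>\<bar> \<le> 2 * 1" unfolding abs_mult using y H(2)[of i \<omega>] Suc.prems
        by (intro mult_mono) auto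
      then have "\<bar>burkholder_x ?x ?y + burkholder_y ?x ?y * H i \<omega>\<bar> \<le> 4" using x by linarith
      then show ?thesis unfolding C_def using \<open>r > 0\<close> by (simp add: abs_divide divide_right_mono)
    qed
    have orth: "integrable M (\<lambda>\<omega>. C \<omega> * N i \<omega>)" "integrable M (\<lambda>\<omega>. C \<omega> * N (Suc i) \<omega>)"
      "expectation (\<lambda>\<omega>. C \<omega> * N (Suc i) \<omega>) = expectation (\<lambda>\<omega>. C \<omega> * N i \<omega>)"
      using martingale_difference_orthogonal[OF F Cm Cb N(2) N(2) mart] Suc.prems by auto
    have ptw: "\<Phi> (Suc i) \<omega> \<le> \<Phi> i \<omega> + (C \<omega> * N (Suc i) \<omega> - C \<omega> * N i \<omega>)" for \<omega>
    proof -
      define h where "h = (N (Suc i) \<omega> - N i \<omega>) / r"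
      have 1: "N (Suc i) \<omega> / r = N i \<omega> / r + h" unfolding h_def by (simp add: diff_divide_distrib)
      have 2: "Z (Suc i) \<omega> / r = Z i \<omega> / r + H i \<omega> * h" unfolding h_def Z_def by (simp add: add_divide_distrib)
      have 3: "\<bar>H i \<omega> * h\<bar> \<le> \<bar>h\<bar>" using H(2)[of i \<omega>] Suc.prems by (simp add: abs_mult mult_left_le_one_le)
      have "\<Phi> (Suc i) \<omega> \<le> \<Phi> i \<omega> + burkholder_x (N i \<omega> / r) (Z i \<omega> / r) * h + burkholder_y (N i \<omega> / r) (Z i \<omega> / r) * (H i \<omega> * h)"
        unfolding \<Phi>_def 1 2 by (rule burkholder_step[OF 3])
      also have "\<dots> = \<Phi> i \<omega> + (C \<omega> * N (Suc i) \<omega> - C \<omega> * N i \<omega>)"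
        unfolding C_def h_def using \<open>r > 0\<close> by (simp add: field_simps)
      finally show ?thesis .
    qed
    have "expectation (\<Phi> (Suc i)) \<le> expectation (\<lambda>\<omega>. \<Phi> i \<omega> + (C \<omega> * N (Suc i) \<omega> - C \<omega> * N i \<omega>))"
      using ptw \<Phi>int[of i] \<Phi>int[of "Suc i"] orth Suc.prems
      by (intro integral_mono Bochner_Integration.integrable_add Bochner_Integration.integrable_diff) auto
    also have "\<dots> = expectation (\<Phi> i)"
      using \<Phi>int[of i] orth Suc.prems by simp
    also have "\<dots> \<le> 0" using Suc by simp
    finally show ?case .
  qed
  from this[of n] have E0: "expectation (\<Phi> n) \<le> 0" by simp
  define A where "A = {\<omega> \<in> space M. r \<le> \<bar>Z n \<omega>\<bar>}"
  have Zn[measurable]: "Z n \<in> borel_measurable M" using measurable_from_subalg[OF F[OF order_refl] Zm[OF order_refl]] .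
  have A[measurable]: "A \<in> sets M" unfolding A_def by measurable
  have i1: "integrable M (indicator A :: 'a \<Rightarrow> real)"
    by (rule integrable_const_bound[where B = 1]) auto
  have "prob A - 2 * expectation (\<lambda>\<omega>. \<bar>N n \<omega>\<bar>) / r = expectation (\<lambda>\<omega>. indicator A \<omega> - 2 * \<bar>N n \<omega>\<bar> / r)"
    using i1 N(2)[of n] by simp
  also have "\<dots> \<le> expectation (\<Phi> n)"
  proof (rule integral_mono)
    show "integrable M (\<lambda>\<omega>. indicator A \<omega> - 2 * \<bar>N n \<omega>\<bar> / r)" using i1 N(2)[of n] by simp
    fix \<omega> assume "\<omega> \<in> space M"
    then show "indicator A \<omega> - 2 * \<bar>N n \<omega>\<bar> / r \<le> \<Phi> n \<omega>"
      using burkholder_lower[of "Z n \<omega> / r" "N n \<omega> / r"] \<open>r > 0\<close> unfolding \<Phi>_def A_def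
      by (auto simp: indicator_def abs_divide split: if_splits)
  qed (rule \<Phi>int, simp)
  finally show ?thesis using E0 unfolding A_def Z_def by linarith
qed

section \<open>Semimartingales as integrators\<close>

abbreviation tail_prob :: "'a measure \<Rightarrow> ('a \<Rightarrow> real) \<Rightarrow> real \<Rightarrow> real" where
  "tail_prob M Y K \<equiv> measure M {\<omega> \<in> space M. K < \<bar>Y \<omega>\<bar>}"

definition bdd_in_prob :: "'a measure \<Rightarrow> ('a \<Rightarrow> real) set \<Rightarrow> bool" where
  "bdd_in_prob M S \<longleftrightarrow> (\<forall>\<eta>>0. \<exists>K>0. \<forall>Y\<in>S. tail_prob M Y K < \<eta>)"

lemma (in prob_space) measure_tendsto_0_AE:
  assumes [measurable]: "\<And>n::nat. A n \<in> sets M" and ae: "AE \<omega> in M. \<forall>\<^sub>F n in sequentially. \<omega> \<notin> A n"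
  shows "(\<lambda>n. prob (A n)) \<longlonglongrightarrow> 0"
proof -
  have "(\<lambda>n. \<integral>\<omega>. indicat_real (A n) \<omega> \<partial>M) \<longlonglongrightarrow> (\<integral>\<omega>. (0::real) \<partial>M)"
  proof (rule integral_dominated_convergence[where w = "\<lambda>_. 1"])
    show "AE \<omega> in M. (\<lambda>n. indicat_real (A n) \<omega>) \<longlonglongrightarrow> 0"
      using ae
    proof eventually_elim
      case (elim \<omega>)
      then have "\<forall>\<^sub>F n in sequentially. indicat_real (A n) \<omega> = 0" by eventually_elim simp
      then show ?case by (rule tendsto_eventually)
    qed
  qed auto
  then show ?thesis by simp
qed

text \<open>If the family were not bounded in probability, a sequence from it would exceed \<open>n\<close> with probability at
least \<open>\<eta>\<close> for every \<open>n\<close>, while these events occur only finitely often almost surely. No measurability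
of a supremum over an uncountable family is involved.\<close>

lemma (in prob_space) bdd_in_prob_AE:
  assumes S: "\<And>Y. Y \<in> S \<Longrightarrow> Y \<in> borel_measurable M"
    and ae: "AE \<omega> in M. \<exists>B. \<forall>Y\<in>S. \<bar>Y \<omega>\<bar> \<le> B"
  shows "bdd_in_prob M S"
  unfolding bdd_in_prob_def
proof (intro allI impI, rule ccontr)
  fix \<eta> :: real assume "\<eta> > 0"
  assume neg: "\<not> (\<exists>K>0. \<forall>Y\<in>S. tail_prob M Y K < \<eta>)"
  have "\<exists>Y\<in>S. \<eta> \<le> tail_prob M Y (real (Suc n))" for n
  proof -
    have "real (Suc n) > 0" by simp
    with neg show ?thesis by (meson not_less)
  qed
  then obtain Y where Y: "\<And>n. Y n \<in> S" "\<And>n. \<eta> \<le> tail_prob M (\<lambda>\<omega>. Y n \<omega>) (real (Suc n))" by metis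
  have [measurable]: "Y n \<in> borel_measurable M" for n using S Y by auto
  have "(\<lambda>n. tail_prob M (\<lambda>\<omega>. Y n \<omega>) (real (Suc n))) \<longlonglongrightarrow> 0"
  proof (rule measure_tendsto_0_AE)
    show "AE \<omega> in M. \<forall>\<^sub>F n in sequentially. \<omega> \<notin> {\<omega> \<in> space M. \<bar>Y n \<omega>\<bar> > real (Suc n)}"
      using ae
    proof eventually_elim
      case (elim \<omega>)
      then obtain B where B: "\<forall>Y\<in>S. \<bar>Y \<omega>\<bar> \<le> B" by blast
      obtain n0 :: nat where n0: "B \<le> real n0" using real_arch_simple by blast
      have "\<omega> \<notin> {\<omega> \<in> space M. \<bar>Y n \<omega>\<bar> > real (Suc n)}" if "n \<ge> n0" for n
        using B Y(1)[of n] n0 that by force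
      then show ?case unfolding eventually_sequentially by blast
    qed
  qed measurable
  then have "\<eta> \<le> 0" by (rule LIMSEQ_le_const) (use Y in auto)
  with \<open>\<eta> > 0\<close> show False by simp
qed

lemma (in prob_space) bdd_in_prob_mono:
  "bdd_in_prob M S \<Longrightarrow> S' \<subseteq> S \<Longrightarrow> bdd_in_prob M S'"
  unfolding bdd_in_prob_def by blast

lemma (in prob_space) prob_le_add_AE:
  assumes [measurable]: "A \<in> sets M" "B \<in> sets M" "C \<in> sets M"
    and "AE \<omega> in M. \<omega> \<in> A \<longrightarrow> \<omega> \<in> B \<or> \<omega> \<in> C"
  shows "prob A \<le> prob B + prob C"
proof -
  have "prob A \<le> prob (B \<union> C)" using assms by (intro finite_measure_mono_AE) auto
  also have "\<dots> \<le> prob B + prob C" by (intro measure_Un_le) auto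
  finally show ?thesis .
qed

lemma (in prob_space) tail_prob_add:
  assumes [measurable]: "Y \<in> borel_measurable M" "U \<in> borel_measurable M" "V \<in> borel_measurable M"
    and "AE \<omega> in M. \<bar>Y \<omega>\<bar> \<le> \<bar>U \<omega>\<bar> + \<bar>V \<omega>\<bar>"
  shows "tail_prob M Y (K + K') \<le> tail_prob M U K + tail_prob M V K'"
  using assms(4) by (intro prob_le_add_AE) (auto elim!: eventually_mono)

lemma (in prob_space) tail_prob_le_mean:
  assumes "integrable M Y" "K > 0"
  shows "tail_prob M Y K \<le> expectation (\<lambda>\<omega>. \<bar>Y \<omega>\<bar>) / K"
proof -
  have [measurable]: "Y \<in> borel_measurable M" using assms by auto
  have "tail_prob M Y K \<le> prob {\<omega> \<in> space M. K \<le> \<bar>Y \<omega>\<bar>}" by (intro finite_measure_mono) auto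
  also have "\<dots> \<le> expectation (\<lambda>\<omega>. \<bar>Y \<omega>\<bar>) / K"
    using assms by (intro integral_Markov_inequality_measure[where A = "space M"]) auto
  finally show ?thesis .
qed

definition ascending :: "real set \<Rightarrow> nat \<Rightarrow> (nat \<Rightarrow> real) \<Rightarrow> bool" where
  "ascending S n p \<longleftrightarrow> (\<forall>j\<le>n. p j \<in> S) \<and> (\<forall>j<n. p j < p (Suc j))"

definition simple_integrals :: "(ereal \<Rightarrow> 'a measure) \<Rightarrow> real \<Rightarrow> real \<Rightarrow> (real \<Rightarrow> 'a \<Rightarrow> real) \<Rightarrow> ('a \<Rightarrow> real) set" where
  "simple_integrals \<F> a t X = {\<lambda>\<omega>. \<Sum>j<n. H j \<omega> * (X (p (Suc j)) \<omega> - X (p j) \<omega>) | n p H.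
     ascending {a..t} n p \<and> (\<forall>j<n. H j \<in> borel_measurable (\<F> (ereal (p j))) \<and> (\<forall>\<omega>. \<bar>H j \<omega>\<bar> \<le> 1))}"

lemma filtered_space_subalgebra:
  assumes "filtered_space M \<F>"
  shows "subalgebra M (\<F> s)" "s \<le> u \<Longrightarrow> subalgebra (\<F> u) (\<F> s)"
proof -
  have 1: "filtration (space M) \<F>" and 2: "\<And>s. subalgebra M (\<F> s)" using assms unfolding filtered_space_def by auto
  show "subalgebra M (\<F> s)" by (rule 2)
  show "s \<le> u \<Longrightarrow> subalgebra (\<F> u) (\<F> s)"
    using filtration.sets_F_mono[OF 1] filtration.space_F[OF 1] unfolding subalgebra_def by auto
qed

lemma adapted_process_measurable:
  assumes "filtered_space M \<F>" "adapted_process \<F> a b X" "s \<in> time_set a b"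
  shows "X s \<in> borel_measurable M"
  using measurable_from_subalg[OF filtered_space_subalgebra(1)[OF assms(1)]] assms(2,3)
  unfolding adapted_process_def by blast

lemma time_set_mono: "t \<in> time_set a b \<Longrightarrow> s \<in> {a..t} \<Longrightarrow> s \<in> time_set a b"
  unfolding time_set_def by (auto intro: le_less_trans[of "ereal s" "ereal t" b])

lemma simple_integrals_measurable:
  assumes "filtered_space M \<F>" "adapted_process \<F> a b X" "t \<in> time_set a b" "Y \<in> simple_integrals \<F> a t X"
  shows "Y \<in> borel_measurable M"
proof -
  from assms(4) obtain n p H where Y: "Y = (\<lambda>\<omega>. \<Sum>j<n. H j \<omega> * (X (p (Suc j)) \<omega> - X (p j) \<omega>))"
    and p: "ascending {a..t} n p" and H: "\<forall>j<n. H j \<in> borel_measurable (\<F> (ereal (p j)))"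
    unfolding simple_integrals_def by blast
  have Hm: "H j \<in> borel_measurable M" if "j < n" for j
    using measurable_from_subalg[OF filtered_space_subalgebra(1)[OF assms(1)]] H that by blast
  have Xm: "X (p j) \<in> borel_measurable M" if "j \<le> n" for j
    using p that time_set_mono[OF assms(3)] unfolding ascending_def
    by (intro adapted_process_measurable[OF assms(1,2)]) auto
  show ?thesis unfolding Y using Hm Xm
    by (intro borel_measurable_sum borel_measurable_times borel_measurable_diff) auto
qed

text \<open>Every simple integral is bounded pathwise by the total variation on \<open>[a, t]\<close>.\<close>

lemma (in prob_space) finite_variation_bdd_in_prob:
  assumes "filtered_space M \<F>" "finite_variation_process M \<F> a b A" "t \<in> time_set a b"
  shows "bdd_in_prob M (simple_integrals \<F> a t A)"
proof (rule bdd_in_prob_AE)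
  have ad: "adapted_process \<F> a b A" and fv: "AE \<omega> in M. finite_variation_path a b (\<lambda>t. A t \<omega>)"
    using assms(2) unfolding finite_variation_process_def by auto
  show "Y \<in> borel_measurable M" if "Y \<in> simple_integrals \<F> a t A" for Y
    by (rule simple_integrals_measurable[OF assms(1) ad assms(3) that])
  show "AE \<omega> in M. \<exists>B. \<forall>Y\<in>simple_integrals \<F> a t A. \<bar>Y \<omega>\<bar> \<le> B"
    using fv
  proof eventually_elim
    case (elim \<omega>)
    define x where "x = (\<lambda>t. A t \<omega>)"
    have "bdd_above {\<Sum>j<n. \<bar>x (p (Suc j)) - x (p j)\<bar> | n p. partition_of a t n p}"
      using bspec[OF elim[unfolded finite_variation_path_def] assms(3)] by (simp add: x_def)
    then obtain B where B: "\<And>n p. partition_of a t n p \<Longrightarrow> (\<Sum>j<n. \<bar>x (p (Suc j)) - x (p j)\<bar>) \<le> B"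
      unfolding bdd_above_def by blast
    have Bl: "csum (\<lambda>s u. \<bar>x u - x s\<bar>) xs \<le> B" if "plist a t xs" for xs
      using B[OF plist_imp_partition_of[OF that]] unfolding csum_conv_sum .
    have nn: "0 \<le> csum (\<lambda>s u. \<bar>x u - x s\<bar>) xs" for xs by (induction xs rule: induct_list012) auto
    have mono: "csum (\<lambda>s u. \<bar>x u - x s\<bar>) ys \<le> csum (\<lambda>s u. \<bar>x u - x s\<bar>) (xs @ ys @ zs)" for xs ys zs
    proof -
      have 1: "csum (\<lambda>s u. \<bar>x u - x s\<bar>) us \<le> csum (\<lambda>s u. \<bar>x u - x s\<bar>) (us @ vs)" for us vs
        using csum_append[of us vs "\<lambda>s u. \<bar>x u - x s\<bar>"] nn[of vs] by (cases "us = [] \<or> vs = []") (use nn in auto)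
      have 2: "csum (\<lambda>s u. \<bar>x u - x s\<bar>) vs \<le> csum (\<lambda>s u. \<bar>x u - x s\<bar>) (us @ vs)" for us vs
        using csum_append[of us vs "\<lambda>s u. \<bar>x u - x s\<bar>"] nn[of us] by (cases "us = [] \<or> vs = []") (use nn in auto)
      show ?thesis using 1[of ys zs] 2[of "ys @ zs" xs] by linarith
    qed
    have main: "csum (\<lambda>s u. \<bar>x u - x s\<bar>) xs \<le> B" if xs: "sorted_wrt (<) xs" "set xs \<subseteq> {a..t}" "xs \<noteq> []" for xs
    proof -
      \<comment> \<open>The variation is bounded along partitions of the whole of \<open>[a, t]\<close>, so add missing end points.\<close>
      define l r where "l = (if hd xs = a then [] else [a])" and "r = (if last xs = t then [] else [t])"
      have pl: "plist (hd xs) (last xs) xs" using xs unfolding plist_def by auto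
      have h: "a \<le> hd xs" "last xs \<le> t" using xs(2,3) hd_in_set[of xs] last_in_set[of xs] by (meson atLeastAtMost_iff subsetD)+
      have s1: "s < u" if "s \<in> set l" "u \<in> set xs" for s u
        using that h plist_bounds(1)[OF pl] unfolding l_def by (fastforce split: if_splits)
      have s2: "s < u" if "s \<in> set xs" "u \<in> set r" for s u
        using that h plist_bounds(2)[OF pl] unfolding r_def by (fastforce split: if_splits)
      have s3: "s < u" if "s \<in> set l" "u \<in> set r" for s u
        using that s1[OF that(1) hd_in_set[OF xs(3)]] s2[OF hd_in_set[OF xs(3)] that(2)] by simp
      have "plist a t (l @ xs @ r)" unfolding plist_def
        using xs s1 s2 s3 h by (auto simp: sorted_wrt_append) (auto simp: l_def r_def)
      then show ?thesis using Bl mono order_trans by blast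
    qed
    have "\<bar>Y \<omega>\<bar> \<le> B" if "Y \<in> simple_integrals \<F> a t A" for Y
    proof -
      from that obtain n p H where Y: "Y = (\<lambda>\<omega>. \<Sum>j<n. H j \<omega> * (A (p (Suc j)) \<omega> - A (p j) \<omega>))"
        and p: "ascending {a..t} n p" and H: "\<forall>j<n. \<bar>H j \<omega>\<bar> \<le> 1"
        unfolding simple_integrals_def by blast
      have "\<bar>Y \<omega>\<bar> \<le> (\<Sum>j<n. \<bar>x (p (Suc j)) - x (p j)\<bar>)"
        unfolding Y x_def using H by (intro order_trans[OF sum_abs] sum_mono) (auto simp: abs_mult intro: mult_left_le_one_le)
      also have "\<dots> = csum (\<lambda>s u. \<bar>x u - x s\<bar>) (map p [0..<Suc n])" by (rule csum_map_upt[symmetric])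
      also have "\<dots> \<le> B" using p unfolding ascending_def
        by (intro main) (auto simp: sorted_wrt_iff_nth_less intro: strict_steps_less simp del: upt_Suc)
      finally show ?thesis .
    qed
    then show ?case by blast
  qed
qed

lemma (in prob_space) martingale_bdd_in_prob:
  assumes fs: "filtered_space M \<F>" and mart: "martingale M \<F> a b N" and t: "t \<in> time_set a b"
  shows "bdd_in_prob M (simple_integrals \<F> a t N)"
  unfolding bdd_in_prob_def
proof (intro allI impI)
  fix \<eta> :: real assume "\<eta> > 0"
  have ad: "adapted_process \<F> a b N" and int: "\<And>s. s \<in> time_set a b \<Longrightarrow> integrable M (N s)" and
    ce: "\<And>s u. s \<in> time_set a b \<Longrightarrow> u \<in> time_set a b \<Longrightarrow> s \<le> u \<Longrightarrow> AE \<omega> in M. real_cond_exp M (\<F> (ereal s)) (N u) \<omega> = N s \<omega>"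
    using mart unfolding martingale_def by auto
  define C where "C = expectation (\<lambda>\<omega>. \<bar>N t \<omega>\<bar>)"
  have C: "C \<ge> 0" unfolding C_def by simp
  define K where "K = 2 * (C + 1) / \<eta>"
  have K: "K > 0" "2 * C / K < \<eta>" unfolding K_def using C \<open>\<eta> > 0\<close> by (auto simp: field_simps)
  have Nle: "expectation (\<lambda>\<omega>. \<bar>N s \<omega>\<bar>) \<le> C" if s: "s \<in> {a..t}" for s
  proof -
    have sI: "s \<in> time_set a b" using time_set_mono[OF t s] .
    have sm: "(\<lambda>\<omega>. sgn (N s \<omega>)) \<in> borel_measurable (\<F> (ereal s))"
      using ad sI unfolding adapted_process_def by auto
    note o = martingale_difference_orthogonal[OF filtered_space_subalgebra(1)[OF fs] sm _ int[OF sI] int[OF t] ce[OF sI t], where B = 1]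
    have "expectation (\<lambda>\<omega>. \<bar>N s \<omega>\<bar>) = expectation (\<lambda>\<omega>. sgn (N s \<omega>) * N s \<omega>)"
      by (intro arg_cong[of _ _ expectation] ext) (auto simp: sgn_if)
    also have "\<dots> = expectation (\<lambda>\<omega>. sgn (N s \<omega>) * N t \<omega>)" using o(3) s by (auto simp: abs_sgn_eq)
    also have "\<dots> \<le> C" unfolding C_def using o(2) s int[OF t] by (intro integral_mono) (auto simp: sgn_if abs_sgn_eq)
    finally show ?thesis .
  qed
  show "\<exists>K>0. \<forall>Y\<in>simple_integrals \<F> a t N. tail_prob M Y K < \<eta>"
  proof (intro exI[of _ K] conjI ballI)
    fix Y assume "Y \<in> simple_integrals \<F> a t N"
    then obtain n p H where Y: "Y = (\<lambda>\<omega>. \<Sum>j<n. H j \<omega> * (N (p (Suc j)) \<omega> - N (p j) \<omega>))"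
      and p: "ascending {a..t} n p" and H: "\<And>j. j < n \<Longrightarrow> H j \<in> borel_measurable (\<F> (ereal (p j)))" "\<And>j \<omega>. j < n \<Longrightarrow> \<bar>H j \<omega>\<bar> \<le> 1"
      unfolding simple_integrals_def by blast
    have pt: "p j \<in> time_set a b" "p j \<in> {a..t}" if "j \<le> n" for j
      using time_set_mono[OF t] p that unfolding ascending_def by auto
    have "prob {\<omega> \<in> space M. K \<le> \<bar>\<Sum>j<n. H j \<omega> * (N (p (Suc j)) \<omega> - N (p j) \<omega>)\<bar>} \<le> 2 * expectation (\<lambda>\<omega>. \<bar>N (p n) \<omega>\<bar>) / K"
    proof (rule martingale_transform_weak_type[where F = "\<lambda>j. \<F> (ereal (p j))"])
      show "sets (\<F> (ereal (p j))) \<subseteq> sets (\<F> (ereal (p (Suc j))))" if "j < n" for j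
        using filtered_space_subalgebra(2)[OF fs, of "p j" "p (Suc j)"] p that
        unfolding subalgebra_def ascending_def by (auto simp: less_imp_le)
      show "AE \<omega> in M. real_cond_exp M (\<F> (ereal (p j))) (N (p (Suc j))) \<omega> = N (p j) \<omega>" if "j < n" for j
        using ce[of "p j" "p (Suc j)"] pt that p unfolding ascending_def by (auto simp: less_imp_le)
      show "N (p j) \<in> borel_measurable (\<F> (ereal (p j)))" if "j \<le> n" for j
        using ad pt that unfolding adapted_process_def by auto
    qed (use H pt int K filtered_space_subalgebra(1)[OF fs] in auto)
    also have "\<dots> \<le> 2 * C / K" using Nle[OF pt(2)[of n]] K by (intro divide_right_mono) auto
    also have "\<dots> < \<eta>" by (rule K)
    finally have *: "prob {\<omega> \<in> space M. K \<le> \<bar>Y \<omega>\<bar>} < \<eta>" unfolding Y .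
    have [measurable]: "Y \<in> borel_measurable M"
      using simple_integrals_measurable[OF fs ad t \<open>Y \<in> simple_integrals \<F> a t N\<close>] .
    have "tail_prob M Y K \<le> prob {\<omega> \<in> space M. K \<le> \<bar>Y \<omega>\<bar>}"
      by (intro finite_measure_mono) auto
    with * show "tail_prob M Y K < \<eta>" by linarith
  qed (rule K)
qed

text \<open>Stop at a localising time that exceeds \<open>t\<close> with probability close to 1: up to time \<open>t\<close> the stopped
process then agrees with \<open>N\<close> outside a small event.\<close>

lemma (in prob_space) local_martingale_bdd_in_prob:
  assumes fs: "filtered_space M \<F>" and lm: "local_martingale M \<F> a b N" and t: "t \<in> time_set a b"
  shows "bdd_in_prob M (simple_integrals \<F> a t N)"
  unfolding bdd_in_prob_def
proof (intro allI impI)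
  fix \<eta> :: real assume "\<eta> > 0"
  then have e2: "\<eta> / 2 > 0" by simp
  obtain T where T: "\<And>n. stopping_time \<F> (T n)" "AE \<omega> in M. (\<lambda>n. T n \<omega>) \<longlonglongrightarrow> b"
    "\<And>n. martingale M \<F> a b (stopped_process (T n) N)" and ad: "adapted_process \<F> a b N"
    using lm unfolding local_martingale_def by auto
  define A where "A n = {\<omega> \<in> space M. T n \<omega> \<le> ereal t}" for n :: nat
  have A[measurable]: "A n \<in> sets M" for n
  proof -
    have "Measurable.pred (\<F> (ereal t)) (\<lambda>\<omega>. T n \<omega> \<le> ereal t)" using T(1) unfolding stopping_time_def by blast
    then have "Measurable.pred M (\<lambda>\<omega>. T n \<omega> \<le> ereal t)"
      using measurable_from_subalg[OF filtered_space_subalgebra(1)[OF fs]] by blast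
    then show ?thesis unfolding A_def by measurable
  qed
  have "(\<lambda>n. prob (A n)) \<longlonglongrightarrow> 0"
  proof (rule measure_tendsto_0_AE)
    show "AE \<omega> in M. \<forall>\<^sub>F n in sequentially. \<omega> \<notin> A n"
      using T(2)
    proof eventually_elim
      case (elim \<omega>)
      have "ereal t < b" using t unfolding time_set_def by auto
      from order_tendstoD(1)[OF elim this] show ?case unfolding A_def by eventually_elim auto
    qed
  qed (rule A)
  then obtain k where k: "prob (A k) < \<eta> / 2"
    using order_tendstoD(2)[OF _ e2] by (metis eventually_sequentially order_refl)
  let ?N = "stopped_process (T k) N"
  from martingale_bdd_in_prob[OF fs T(3) t] e2 obtain K where K: "K > 0"
    "\<And>Y. Y \<in> simple_integrals \<F> a t ?N \<Longrightarrow> tail_prob M Y K < \<eta> / 2"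
    unfolding bdd_in_prob_def by meson
  show "\<exists>K>0. \<forall>Y\<in>simple_integrals \<F> a t N. tail_prob M Y K < \<eta>"
  proof (intro exI[of _ K] conjI ballI)
    fix Y assume YS: "Y \<in> simple_integrals \<F> a t N"
    then obtain n p H where Y: "Y = (\<lambda>\<omega>. \<Sum>j<n. H j \<omega> * (N (p (Suc j)) \<omega> - N (p j) \<omega>))"
      and p: "ascending {a..t} n p" and H: "\<forall>j<n. H j \<in> borel_measurable (\<F> (ereal (p j))) \<and> (\<forall>\<omega>. \<bar>H j \<omega>\<bar> \<le> 1)"
      unfolding simple_integrals_def by blast
    define Y' where "Y' = (\<lambda>\<omega>. \<Sum>j<n. H j \<omega> * (?N (p (Suc j)) \<omega> - ?N (p j) \<omega>))"
    have Y'S: "Y' \<in> simple_integrals \<F> a t ?N" unfolding simple_integrals_def Y'_def using p H by blast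
    have [measurable]: "Y \<in> borel_measurable M" by (rule simple_integrals_measurable[OF fs ad t YS])
    have "adapted_process \<F> a b ?N" using T(3) unfolding martingale_def by auto
    then have [measurable]: "Y' \<in> borel_measurable M" by (rule simple_integrals_measurable[OF fs _ t Y'S])
    have eq: "Y \<omega> = Y' \<omega>" if "\<omega> \<in> space M" "\<omega> \<notin> A k" for \<omega>
    proof -
      have "?N s \<omega> = N s \<omega>" if "s \<le> t" for s
      proof -
        have "ereal s \<le> ereal t" using that by simp
        also have "\<dots> < T k \<omega>" using \<open>\<omega> \<notin> A k\<close> \<open>\<omega> \<in> space M\<close> unfolding A_def by (auto simp: not_le)
        finally have "ereal s \<le> T k \<omega>" by (rule less_imp_le)
        then show ?thesis unfolding stopped_process_def by (simp add: min_def)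
      qed
      then show ?thesis unfolding Y Y'_def using p unfolding ascending_def by (intro sum.cong) auto
    qed
    have "tail_prob M Y K \<le> prob (A k) + tail_prob M Y' K"
    proof (intro prob_le_add_AE AE_I2 impI)
      fix \<omega> assume "\<omega> \<in> space M" "\<omega> \<in> {\<omega> \<in> space M. K < \<bar>Y \<omega>\<bar>}"
      then show "\<omega> \<in> A k \<or> \<omega> \<in> {\<omega> \<in> space M. K < \<bar>Y' \<omega>\<bar>}" using eq[of \<omega>] by (cases "\<omega> \<in> A k") auto
    qed measurable
    then show "tail_prob M Y K < \<eta>" using k K(2)[OF Y'S] by linarith
  qed (rule K)
qed

lemma (in prob_space) semimartingale_bdd_in_prob:
  assumes sm: "semimartingale M \<F> a b X" and t: "t \<in> time_set a b"
  shows "bdd_in_prob M (simple_integrals \<F> a t X)"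
  unfolding bdd_in_prob_def
proof (intro allI impI)
  fix \<eta> :: real assume "\<eta> > 0"
  then have e2: "\<eta> / 2 > 0" by simp
  obtain N A where fs: "filtered_space M \<F>" and ad: "adapted_process \<F> a b X" and
    N: "local_martingale M \<F> a b N" and A: "finite_variation_process M \<F> a b A" and
    dec: "AE \<omega> in M. \<forall>t\<in>time_set a b. X t \<omega> = X a \<omega> + N t \<omega> + A t \<omega>"
    using sm unfolding semimartingale_def by auto
  from local_martingale_bdd_in_prob[OF fs N t] e2 obtain K where K: "K > 0"
    "\<And>Y. Y \<in> simple_integrals \<F> a t N \<Longrightarrow> tail_prob M Y K < \<eta> / 2"
    unfolding bdd_in_prob_def by meson
  from finite_variation_bdd_in_prob[OF fs A t] e2 obtain K' where K': "K' > 0"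
    "\<And>Y. Y \<in> simple_integrals \<F> a t A \<Longrightarrow> tail_prob M Y K' < \<eta> / 2"
    unfolding bdd_in_prob_def by meson
  have adN: "adapted_process \<F> a b N" and adA: "adapted_process \<F> a b A"
    using N A unfolding local_martingale_def finite_variation_process_def by auto
  show "\<exists>K>0. \<forall>Y\<in>simple_integrals \<F> a t X. tail_prob M Y K < \<eta>"
  proof (intro exI[of _ "K + K'"] conjI ballI)
    fix Y assume YS: "Y \<in> simple_integrals \<F> a t X"
    then obtain n p H where Y: "Y = (\<lambda>\<omega>. \<Sum>j<n. H j \<omega> * (X (p (Suc j)) \<omega> - X (p j) \<omega>))"
      and p: "ascending {a..t} n p" and H: "\<forall>j<n. H j \<in> borel_measurable (\<F> (ereal (p j))) \<and> (\<forall>\<omega>. \<bar>H j \<omega>\<bar> \<le> 1)"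
      unfolding simple_integrals_def by blast
    define U where "U = (\<lambda>\<omega>. \<Sum>j<n. H j \<omega> * (N (p (Suc j)) \<omega> - N (p j) \<omega>))"
    define V where "V = (\<lambda>\<omega>. \<Sum>j<n. H j \<omega> * (A (p (Suc j)) \<omega> - A (p j) \<omega>))"
    have US: "U \<in> simple_integrals \<F> a t N" and VS: "V \<in> simple_integrals \<F> a t A"
      unfolding simple_integrals_def U_def V_def using p H by blast+
    have [measurable]: "Y \<in> borel_measurable M" "U \<in> borel_measurable M" "V \<in> borel_measurable M"
      using simple_integrals_measurable[OF fs _ t] YS US VS ad adN adA by blast+
    have eq: "AE \<omega> in M. Y \<omega> = U \<omega> + V \<omega>"
      using dec
    proof eventually_elim
      case (elim \<omega>)
      have "X (p j) \<omega> = X a \<omega> + N (p j) \<omega> + A (p j) \<omega>" if "j \<le> n" for j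
        using elim time_set_mono[OF t, of "p j"] p that unfolding ascending_def by auto
      then show ?case unfolding Y U_def V_def sum.distrib[symmetric]
        by (intro sum.cong) (auto simp: algebra_simps)
    qed
    have "tail_prob M Y (K + K') \<le> tail_prob M U K + tail_prob M V K'"
      by (intro prob_le_add_AE) (use eq in auto)
    then show "tail_prob M Y (K + K') < \<eta>" using K(2)[OF US] K'(2)[OF VS] by linarith
  qed (use K K' in auto)
qed

section \<open>Bounds for the covariance of a Gaussian semimartingale\<close>

lemma cadlag_path_bounded:
  assumes x: "cadlag_path a b x" and t: "t \<in> time_set a b"
  shows "\<exists>B. \<forall>s\<in>{a..t}. \<bar>x s\<bar> \<le> B"
proof -
  have "a \<le> t" using t unfolding time_set_def by simp
  define P where "P u v \<longleftrightarrow> (\<exists>B. \<forall>s\<in>{u..v} \<inter> {a..t}. \<bar>x s\<bar> \<le> B)" for u v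
  have "P a t"
  proof (rule Bolzano[OF \<open>a \<le> t\<close>])
    fix u v w assume "P u v" "P v w" "u \<le> v" "v \<le> w"
    then obtain B B' where "\<forall>s\<in>{u..v} \<inter> {a..t}. \<bar>x s\<bar> \<le> B" "\<forall>s\<in>{v..w} \<inter> {a..t}. \<bar>x s\<bar> \<le> B'" unfolding P_def by blast
    then have "\<forall>s\<in>{u..w} \<inter> {a..t}. \<bar>x s\<bar> \<le> max B B'" by (fastforce simp: le_max_iff_disj)
    then show "P u w" unfolding P_def by blast
  next
    fix s assume local: "a \<le> s" "s \<le> t"
    then have sI: "s \<in> time_set a b" using time_set_mono[OF t] by simp
    have "\<exists>d>0. \<exists>B. \<forall>u>s. u < s + d \<longrightarrow> \<bar>x u\<bar> \<le> B"
    proof -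
      have "(x \<longlongrightarrow> x s) (at_right s)" using x sI unfolding cadlag_path_def by blast
      from tendstoD[OF this, of 1] obtain r where "r > s" "\<And>u. u > s \<Longrightarrow> u < r \<Longrightarrow> dist (x u) (x s) < 1"
        unfolding eventually_at_right_field by auto
      then show ?thesis by (intro exI[of _ "r - s"] conjI exI[of _ "\<bar>x s\<bar> + 1"]) (auto simp: dist_real_def, force)
    qed
    then obtain d1 B1 where 1: "d1 > 0" "\<And>u. u > s \<Longrightarrow> u < s + d1 \<Longrightarrow> \<bar>x u\<bar> \<le> B1" by blast
    have "\<exists>d>0. \<exists>B. \<forall>u<s. s - d < u \<longrightarrow> a \<le> u \<longrightarrow> \<bar>x u\<bar> \<le> B"
    proof (cases "a < s")
      case True
      then obtain l where "(x \<longlongrightarrow> l) (at_left s)" using x sI unfolding cadlag_path_def by blast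
      from tendstoD[OF this, of 1] obtain r where "r < s" "\<And>u. u < s \<Longrightarrow> r < u \<Longrightarrow> dist (x u) l < 1"
        unfolding eventually_at_left_field by auto
      then show ?thesis by (intro exI[of _ "s - r"] conjI exI[of _ "\<bar>l\<bar> + 1"]) (auto simp: dist_real_def, force)
    qed (use local in \<open>auto intro!: exI[of _ 1]\<close>)
    then obtain d2 B2 where 2: "d2 > 0" "\<And>u. u < s \<Longrightarrow> s - d2 < u \<Longrightarrow> a \<le> u \<Longrightarrow> \<bar>x u\<bar> \<le> B2" by blast
    show "\<exists>d>0. \<forall>u v. u \<le> s \<and> s \<le> v \<and> v - u < d \<longrightarrow> P u v"
    proof (intro exI[of _ "min d1 d2"] conjI allI impI)
      fix u v assume uv: "u \<le> s \<and> s \<le> v \<and> v - u < min d1 d2"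
      have "\<bar>x r\<bar> \<le> max \<bar>x s\<bar> (max B1 B2)" if "r \<in> {u..v} \<inter> {a..t}" for r
      proof -
        consider "r < s" | "r = s" | "r > s" by linarith
        then show ?thesis
        proof cases
          case 1
          then show ?thesis using 2(2)[of r] that uv by auto
        next
          case 3
          then show ?thesis using 1(2)[of r] that uv by auto
        qed auto
      qed
      then show "P u v" unfolding P_def by blast
    qed (use 1 2 in auto)
  qed
  then show ?thesis unfolding P_def by simp
qed

text \<open>The two families to which the bounds in probability are applied: integrals of \<open>X\<close> with a
deterministic sign, and with a sign times \<open>X\<close> itself, as integrand on each interval.\<close>

definition self_transforms :: "real \<Rightarrow> real \<Rightarrow> (real \<Rightarrow> 'a \<Rightarrow> real) \<Rightarrow> ('a \<Rightarrow> real) set" where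
  "self_transforms a t X = {\<lambda>\<omega>. \<Sum>j<n. \<sigma> j * (X (p j) \<omega> * (X (p (Suc j)) \<omega> - X (p j) \<omega>)) | n p \<sigma>.
     ascending {a..t} n p \<and> (\<forall>j. \<bar>\<sigma> j :: real\<bar> \<le> 1)}"

definition sign_transforms :: "real \<Rightarrow> real \<Rightarrow> (real \<Rightarrow> 'a \<Rightarrow> real) \<Rightarrow> ('a \<Rightarrow> real) set" where
  "sign_transforms a t X = {\<lambda>\<omega>. \<Sum>j<n. \<sigma> j * (X (p (Suc j)) \<omega> - X (p j) \<omega>) | n p \<sigma>.
     ascending {a..t} n p \<and> (\<forall>j. \<bar>\<sigma> j :: real\<bar> \<le> 1)}"

lemma (in prob_space) semimartingale_maximum_bdd_in_prob:
  assumes sm: "semimartingale M \<F> a b X" and t: "t \<in> time_set a b"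
  shows "bdd_in_prob M {\<lambda>\<omega>. Max ((\<lambda>j. \<bar>X (p j) \<omega>\<bar>) ` {..n}) | n p. ascending {a..t} n p}"
proof (rule bdd_in_prob_AE)
  have fs: "filtered_space M \<F>" and ad: "adapted_process \<F> a b X" and cl: "AE \<omega> in M. cadlag_path a b (\<lambda>t. X t \<omega>)"
    using sm unfolding semimartingale_def by auto
  fix Y assume "Y \<in> {\<lambda>\<omega>. Max ((\<lambda>j. \<bar>X (p j) \<omega>\<bar>) ` {..n}) | n p. ascending {a..t} n p}"
  then obtain n p where Y: "Y = (\<lambda>\<omega>. Max ((\<lambda>j. \<bar>X (p j) \<omega>\<bar>) ` {..n}))" and p: "ascending {a..t} n p" by blast
  have "X (p j) \<in> borel_measurable M" if "j \<le> n" for j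
    using p that time_set_mono[OF t] unfolding ascending_def by (intro adapted_process_measurable[OF fs ad]) auto
  then show "Y \<in> borel_measurable M" unfolding Y by (intro borel_measurable_Max) auto
next
  have cl: "AE \<omega> in M. cadlag_path a b (\<lambda>t. X t \<omega>)"
    using sm unfolding semimartingale_def by auto
  then show "AE \<omega> in M. \<exists>B. \<forall>Y\<in>{\<lambda>\<omega>. Max ((\<lambda>j. \<bar>X (p j) \<omega>\<bar>) ` {..n}) | n p. ascending {a..t} n p}. \<bar>Y \<omega>\<bar> \<le> B"
  proof eventually_elim
    case (elim \<omega>)
    obtain B where B: "\<And>s. s \<in> {a..t} \<Longrightarrow> \<bar>X s \<omega>\<bar> \<le> B" using cadlag_path_bounded[OF elim t] by blast
    have "\<bar>Max ((\<lambda>j. \<bar>X (p j) \<omega>\<bar>) ` {..n})\<bar> \<le> B" if "ascending {a..t} n p" for n p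
    proof -
      have "Max ((\<lambda>j. \<bar>X (p j) \<omega>\<bar>) ` {..n}) \<in> (\<lambda>j. \<bar>X (p j) \<omega>\<bar>) ` {..n}" by (intro Max_in) auto
      then obtain j where "j \<le> n" "Max ((\<lambda>j. \<bar>X (p j) \<omega>\<bar>) ` {..n}) = \<bar>X (p j) \<omega>\<bar>" by blast
      then show ?thesis using B[of "p j"] that unfolding ascending_def by simp
    qed
    then show ?case by blast
  qed
qed

lemma (in prob_space) semimartingale_sign_transforms:
  assumes sm: "semimartingale M \<F> a b X" and t: "t \<in> time_set a b"
  shows "bdd_in_prob M (sign_transforms a t X)"
proof (rule bdd_in_prob_mono[OF semimartingale_bdd_in_prob[OF assms]])
  show "sign_transforms a t X \<subseteq> simple_integrals \<F> a t X"
  proof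
    fix Y assume "Y \<in> sign_transforms a t X"
    then obtain n p \<sigma> where Y: "Y = (\<lambda>\<omega>. \<Sum>j<n. \<sigma> j * (X (p (Suc j)) \<omega> - X (p j) \<omega>))" "ascending {a..t} n p" "\<forall>j. \<bar>\<sigma> j\<bar> \<le> 1"
      unfolding sign_transforms_def by blast
    then show "Y \<in> simple_integrals \<F> a t X" unfolding simple_integrals_def
      by (intro CollectI exI[of _ n] exI[of _ p] exI[of _ "\<lambda>j \<omega>. \<sigma> j"]) auto
  qed
qed

text \<open>The integrand \<open>\<sigma> j * X (p j)\<close> is not bounded, but cutting \<open>X\<close> off at a level \<open>B\<close> that its maximum
exceeds only with small probability changes nothing outside a small event.\<close>

lemma (in prob_space) semimartingale_self_transforms:
  assumes sm: "semimartingale M \<F> a b X" and t: "t \<in> time_set a b"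
  shows "bdd_in_prob M (self_transforms a t X)"
  unfolding bdd_in_prob_def
proof (intro allI impI)
  fix \<eta> :: real assume "\<eta> > 0"
  then have e2: "\<eta> / 2 > 0" by simp
  have fs: "filtered_space M \<F>" and ad: "adapted_process \<F> a b X"
    using sm unfolding semimartingale_def by auto
  from semimartingale_bdd_in_prob[OF assms] e2 obtain K where K: "K > 0"
    "\<And>Y. Y \<in> simple_integrals \<F> a t X \<Longrightarrow> tail_prob M Y K < \<eta> / 2"
    unfolding bdd_in_prob_def by meson
  from semimartingale_maximum_bdd_in_prob[OF assms] e2 obtain B where B: "B > 0"
    "\<And>Y. Y \<in> {\<lambda>\<omega>. Max ((\<lambda>j. \<bar>X (p j) \<omega>\<bar>) ` {..n}) | n p. ascending {a..t} n p} \<Longrightarrow> tail_prob M Y B < \<eta> / 2"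
    unfolding bdd_in_prob_def by meson
  show "\<exists>K>0. \<forall>Y\<in>self_transforms a t X. tail_prob M Y K < \<eta>"
  proof (intro exI[of _ "B * K"] conjI ballI)
    fix Y assume "Y \<in> self_transforms a t X"
    then obtain n p \<sigma> where Y: "Y = (\<lambda>\<omega>. \<Sum>j<n. \<sigma> j * (X (p j) \<omega> * (X (p (Suc j)) \<omega> - X (p j) \<omega>)))"
      and p: "ascending {a..t} n p" and s: "\<And>j. \<bar>\<sigma> j\<bar> \<le> 1"
      unfolding self_transforms_def by blast
    have pt: "p j \<in> time_set a b" if "j \<le> n" for j
      using p that time_set_mono[OF t] unfolding ascending_def by auto
    have Xm: "X (p j) \<in> borel_measurable M" if "j \<le> n" for j
      using pt that by (intro adapted_process_measurable[OF fs ad]) auto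
    define H where "H j \<omega> = \<sigma> j * (max (-1) (min 1 (X (p j) \<omega> / B)))" for j \<omega>
    define U where "U = (\<lambda>\<omega>. \<Sum>j<n. H j \<omega> * (X (p (Suc j)) \<omega> - X (p j) \<omega>))"
    define V where "V = (\<lambda>\<omega>. Max ((\<lambda>j. \<bar>X (p j) \<omega>\<bar>) ` {..n}))"
    have H: "H j \<in> borel_measurable (\<F> (ereal (p j)))" if "j < n" for j
    proof -
      have [measurable]: "X (p j) \<in> borel_measurable (\<F> (ereal (p j)))"
        using ad pt[of j] that unfolding adapted_process_def by auto
      show ?thesis unfolding H_def by measurable
    qed
    have H1: "\<bar>H j \<omega>\<bar> \<le> 1" for j \<omega>
    proof -
      have "\<bar>max (-1) (min 1 (X (p j) \<omega> / B))\<bar> \<le> 1" by (auto simp: max_def min_def)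
      then show ?thesis unfolding H_def abs_mult using s[of j] by (intro mult_le_one) auto
    qed
    have US: "U \<in> simple_integrals \<F> a t X" unfolding simple_integrals_def U_def using p H H1 by blast
    have VS: "V \<in> {\<lambda>\<omega>. Max ((\<lambda>j. \<bar>X (p j) \<omega>\<bar>) ` {..n}) | n p. ascending {a..t} n p}" unfolding V_def using p by blast
    have [measurable]: "U \<in> borel_measurable M" by (rule simple_integrals_measurable[OF fs ad t US])
    have [measurable]: "V \<in> borel_measurable M" unfolding V_def using Xm by (intro borel_measurable_Max) auto
    have [measurable]: "Y \<in> borel_measurable M" unfolding Y using Xm
      by (intro borel_measurable_sum borel_measurable_times borel_measurable_diff) auto
    have eq: "Y \<omega> = B * U \<omega>" if "\<bar>V \<omega>\<bar> \<le> B" for \<omega>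
    proof -
      have Xb: "\<bar>X (p j) \<omega>\<bar> \<le> B" if "j \<le> n" for j
      proof -
        have "\<bar>X (p j) \<omega>\<bar> \<le> V \<omega>" unfolding V_def using that by (intro Max_ge) auto
        then show ?thesis using \<open>\<bar>V \<omega>\<bar> \<le> B\<close> by simp
      qed
      have "B * H j \<omega> = \<sigma> j * X (p j) \<omega>" if "j \<le> n" for j
      proof -
        have "max (-1) (min 1 (X (p j) \<omega> / B)) = X (p j) \<omega> / B" using Xb[OF that] B(1)
          by (auto simp: max_def min_def field_simps abs_le_iff)
        then show ?thesis unfolding H_def using B(1) by simp
      qed
      then show ?thesis unfolding Y U_def sum_distrib_left by (intro sum.cong) (auto simp: mult.assoc[symmetric])
    qed
    have "tail_prob M Y (B * K) \<le> tail_prob M U K + tail_prob M V B"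
    proof (intro prob_le_add_AE AE_I2 impI)
      fix \<omega> assume "\<omega> \<in> space M" "\<omega> \<in> {\<omega> \<in> space M. B * K < \<bar>Y \<omega>\<bar>}"
      then show "\<omega> \<in> {\<omega> \<in> space M. K < \<bar>U \<omega>\<bar>} \<or> \<omega> \<in> {\<omega> \<in> space M. B < \<bar>V \<omega>\<bar>}"
        using eq[of \<omega>] B(1) by (cases "\<bar>V \<omega>\<bar> \<le> B") (auto simp: abs_mult)
    qed measurable
    then show "tail_prob M Y (B * K) < \<eta>" using K(2)[OF US] B(2)[OF VS] by linarith
  qed (use K B in auto)
qed

context gaussian_space begin

lemma bdd_in_prob_second_moment:
  assumes "S \<subseteq> L" "bdd_in_prob M S"
  shows "\<exists>C. \<forall>Y\<in>S. ip Y Y \<le> C"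
proof -
  have "(0::real) < 1 / 12" by simp
  with assms(2) obtain K where K: "K > 0" "\<And>Y. Y \<in> S \<Longrightarrow> tail_prob M Y K < 1 / 12"
    unfolding bdd_in_prob_def by meson
  have "ip Y Y \<le> 2 * K\<^sup>2" if "Y \<in> S" for Y
  proof -
    have YL: "Y \<in> L" using that assms(1) by auto
    have eq: "(\<lambda>\<omega>. ((Y \<omega>)\<^sup>2)\<^sup>2) = (\<lambda>\<omega>. Y \<omega> ^ 4)" by simp
    have "(K\<^sup>2 < (Y \<omega>)\<^sup>2) = (K < \<bar>Y \<omega>\<bar>)" for \<omega>
      using K(1) abs_le_square_iff[of "Y \<omega>" K] by (simp add: not_le[symmetric])
    then have "prob {\<omega> \<in> space M. (Y \<omega>)\<^sup>2 > K\<^sup>2} < 1 / (4 * 3)" using K(2)[OF that] by simp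
    then have "expectation (\<lambda>\<omega>. (Y \<omega>)\<^sup>2) \<le> 2 * K\<^sup>2"
      using L_integrable_sq[OF YL] L_integrable4[OF YL] L_moment4[OF YL]
      by (intro paley_zygmund[where \<kappa> = 3]) (auto simp: eq)
    then show ?thesis by (simp add: ip_self)
  qed
  then show ?thesis by blast
qed

end

text \<open>A process on \<open>[c, e)\<close> with the covariance structure of one continuity interval. In the definitions
\<open>W\<close> is the innovation, \<open>w\<close> its variance, \<open>q\<close> the variance of the remainder \<open>(\<rho> s u - 1) * X s\<close>, and
\<open>\<beta> s u\<close> the absolute value of the covariance of \<open>X s\<close> and \<open>X u - X s\<close>. Division by zero is 0, so
\<open>\<rho> s u = 0\<close> and \<open>v s = 0\<close> at a zero of \<open>g\<close>; with this convention the identities below hold there as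
well.\<close>

locale segment = gaussian_space M L for M :: "'a measure" and L +
  fixes X :: "real \<Rightarrow> 'a \<Rightarrow> real" and c e :: real and f g :: "real \<Rightarrow> real"
  assumes c_less_e: "c < e"
    and XL: "s \<in> {c..<e} \<Longrightarrow> X s \<in> L"
    and cov: "c \<le> s \<Longrightarrow> s \<le> u \<Longrightarrow> u < e \<Longrightarrow> ip (X s) (X u) = f s * g u"
    and v_nonneg: "s \<in> {c..<e} \<Longrightarrow> 0 \<le> f s / g s"
    and v_mono: "mono_on {c..<e} (\<lambda>s. f s / g s)"
    and f_cont: "continuous_on {c..<e} f"
    and g_cont: "continuous_on {c..<e} g"
begin

abbreviation "v s \<equiv> f s / g s"
definition "\<rho> s u = g u / g s"
definition "W s u = (\<lambda>\<omega>. X u \<omega> - \<rho> s u * X s \<omega>)"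
definition "w s u = (g u)\<^sup>2 * (v u - v s)"
definition "q s u = v s * (g u - g s)\<^sup>2"
definition "\<beta> s u = \<bar>f s * (g u - g s)\<bar>"
definition "d s u = ip (\<lambda>\<omega>. X u \<omega> - X s \<omega>) (\<lambda>\<omega>. X u \<omega> - X s \<omega>)"

lemma WL: "c \<le> s \<Longrightarrow> s < u \<Longrightarrow> u < e \<Longrightarrow> W s u \<in> L"
  unfolding W_def by (intro L_diff L_scale XL) auto

lemma v_mono': "c \<le> s \<Longrightarrow> s \<le> u \<Longrightarrow> u < e \<Longrightarrow> v s \<le> v u"
  using mono_onD[OF v_mono, of s u] by auto

text \<open>At a zero of \<open>g\<close> the quotient \<open>v\<close> is 0, hence by monotonicity it is 0 at all earlier times \<open>r\<close>, so that
\<open>X r\<close> has variance 0 and by the Cauchy-Schwarz inequality is uncorrelated with everything.\<close>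

lemma cov_zero_past:
  assumes "c \<le> r" "r \<le> s" "s \<le> u" "u < e" "g s = 0"
  shows "f r * g u = 0"
proof -
  have "v r \<le> 0" using v_mono'[of r s] assms by simp
  then have "v r = 0" using v_nonneg[of r] assms by simp
  then have "ip (X r) (X r) = 0" using cov[of r r] assms by auto
  then have "(ip (X r) (X u))\<^sup>2 \<le> 0" using ip_cauchy_schwarz[OF XL XL, of r u] assms by auto
  then show ?thesis using cov[of r u] assms by simp
qed

lemma W_orth_past:
  assumes "c \<le> r" "r \<le> s" "s < u" "u < e"
  shows "ip (X r) (W s u) = 0"
proof -
  have "ip (X r) (W s u) = f r * g u - \<rho> s u * (f r * g s)"
    unfolding W_def using assms cov[of r u] cov[of r s] by (simp add: ip_diff_right ip_scale_right XL L_scale)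
  then show ?thesis using cov_zero_past[of r s u] assms by (cases "g s = 0") (auto simp: \<rho>_def)
qed

lemma W_orth:
  assumes "c \<le> r" "r < s" "s \<le> s'" "s' < u" "u < e"
  shows "ip (W r s) (W s' u) = 0"
proof -
  have "ip (W r s) (W s' u) = ip (X s) (W s' u) - \<rho> r s * ip (X r) (W s' u)"
    using assms unfolding W_def[of r s] by (intro trans[OF ip_diff_left]) (auto simp: XL L_scale WL ip_scale_left)
  then show ?thesis using W_orth_past assms by auto
qed

lemma ip_W:
  assumes "c \<le> s" "s < u" "u < e"
  shows "ip (W s u) (W s u) = w s u"
proof -
  have "ip (W s u) (W s u) = ip (X u) (W s u) - \<rho> s u * ip (X s) (W s u)"
    using assms unfolding W_def[of s u]
    by (intro trans[OF ip_diff_left]) (auto simp: XL L_scale L_diff ip_scale_left)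
  also have "\<dots> = ip (X u) (W s u)" using W_orth_past[of s s u] assms by simp
  also have "\<dots> = f u * g u - \<rho> s u * (f s * g u)"
    unfolding W_def using assms cov[of u u] cov[of s u] ip_commute[of "X u" "X s"]
    by (simp add: ip_diff_right ip_scale_right XL L_scale)
  also have "\<dots> = w s u" unfolding w_def \<rho>_def by (cases "g u = 0") (auto simp: field_simps power2_eq_square)
  finally show ?thesis .
qed

lemma ratio_variance:
  assumes "c \<le> s" "s < u" "u < e"
  shows "(\<rho> s u - 1)\<^sup>2 * ip (X s) (X s) = q s u" "\<bar>\<rho> s u - 1\<bar> * ip (X s) (X s) = \<beta> s u"
proof -
  have c: "ip (X s) (X s) = f s * g s" using cov[of s s] assms by simp
  show "(\<rho> s u - 1)\<^sup>2 * ip (X s) (X s) = q s u"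
    unfolding c q_def \<rho>_def by (cases "g s = 0") (auto simp: field_simps power2_eq_square)
  have "0 \<le> f s * g s" using ip_self_nonneg c by metis
  then have "\<bar>\<rho> s u - 1\<bar> * (f s * g s) = \<bar>(\<rho> s u - 1) * (f s * g s)\<bar>"
    by (simp only: abs_mult[of "\<rho> s u - 1"] abs_of_nonneg)
  also have "(\<rho> s u - 1) * (f s * g s) = f s * (g u - g s)"
    using cov_zero_past[of s s u] assms by (cases "g s = 0") (auto simp: field_simps \<rho>_def)
  finally show "\<bar>\<rho> s u - 1\<bar> * ip (X s) (X s) = \<beta> s u" unfolding c \<beta>_def .
qed

lemma increment_decomp: "X u \<omega> - X s \<omega> = W s u \<omega> + (\<rho> s u - 1) * X s \<omega>"
  unfolding W_def by (simp add: algebra_simps)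

lemma d_eq:
  assumes "c \<le> s" "s < u" "u < e"
  shows "d s u = w s u + q s u"
proof -
  have "d s u = ip (W s u) (W s u) + 2 * ((\<rho> s u - 1) * ip (X s) (W s u)) + (\<rho> s u - 1)\<^sup>2 * ip (X s) (X s)"
    unfolding d_def increment_decomp using assms ip_commute[of "X s" "W s u"]
    by (simp add: ip_simps XL WL, simp add: algebra_simps power2_eq_square)
  then show ?thesis using W_orth_past[of s s u] ip_W[OF assms] ratio_variance(1)[OF assms] assms by simp
qed

lemma w_nonneg: "c \<le> s \<Longrightarrow> s < u \<Longrightarrow> u < e \<Longrightarrow> 0 \<le> w s u"
  using ip_W[of s u] ip_self_nonneg by metis
lemma q_nonneg: "c \<le> s \<Longrightarrow> s < u \<Longrightarrow> u < e \<Longrightarrow> 0 \<le> q s u"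
  unfolding q_def using v_nonneg[of s] by (intro mult_nonneg_nonneg) auto
lemma \<beta>_nonneg: "0 \<le> \<beta> s u" unfolding \<beta>_def by simp
lemma d_cov: "c \<le> s \<Longrightarrow> s < u \<Longrightarrow> u < e \<Longrightarrow> d s u = f u * g u - 2 * (f s * g u) + f s * g s"
  unfolding d_def using cov[of s s] cov[of u u] cov[of s u] ip_commute[of "X u" "X s"]
  by (simp add: ip_simps XL)

text \<open>With signs chosen by \<open>greedy_signs\<close> the second moment of the Gaussian integral is at least the sum.\<close>

lemma sum_d_bounded:
  assumes "bdd_in_prob M (sign_transforms a t X)" "{c..<e} \<subseteq> {a..t}"
  shows "\<exists>C. \<forall>n p. ascending {c..<e} n p \<longrightarrow> (\<Sum>j<n. d (p j) (p (Suc j))) \<le> C"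
proof -
  let ?S = "{\<lambda>\<omega>. \<Sum>j<n. \<sigma> j * (X (p (Suc j)) \<omega> - X (p j) \<omega>) | n p \<sigma>. ascending {c..<e} n p \<and> (\<forall>j. \<bar>\<sigma> j :: real\<bar> \<le> 1)}"
  have "?S \<subseteq> sign_transforms a t X" unfolding sign_transforms_def ascending_def using assms(2) by blast
  then have "bdd_in_prob M ?S" using assms(1) bdd_in_prob_mono by blast
  moreover have "?S \<subseteq> L" by (auto simp: ascending_def intro!: L_sum L_scale L_diff XL)
  ultimately obtain C where "\<forall>Y\<in>?S. ip Y Y \<le> C" using bdd_in_prob_second_moment[of ?S] by meson
  then have C: "\<And>Y. Y \<in> ?S \<Longrightarrow> ip Y Y \<le> C" by (rule bspec)
  have "(\<Sum>j<n. d (p j) (p (Suc j))) \<le> C" if p: "ascending {c..<e} n p" for n p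
  proof -
    define D where "D j = (\<lambda>\<omega>. X (p (Suc j)) \<omega> - X (p j) \<omega>)" for j
    have "D j \<in> L" if "j < n" for j unfolding D_def using p that unfolding ascending_def by (intro L_diff XL) auto
    from greedy_signs[of n D, OF this] obtain \<sigma> :: "nat \<Rightarrow> real" where s: "\<forall>j. \<bar>\<sigma> j\<bar> \<le> 1"
      "(\<Sum>j<n. ip (D j) (D j)) \<le> ip (\<lambda>\<omega>. \<Sum>j<n. \<sigma> j * D j \<omega>) (\<lambda>\<omega>. \<Sum>j<n. \<sigma> j * D j \<omega>)" by blast
    have "(\<lambda>\<omega>. \<Sum>j<n. \<sigma> j * D j \<omega>) \<in> ?S" unfolding D_def using s(1) p by blast
    from C[OF this] s(2) show ?thesis unfolding d_def D_def by simp
  qed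
  then show ?thesis by blast
qed

text \<open>Take the sign of \<open>\<rho> - 1\<close> times \<open>X s\<close> as integrand. The integral is \<open>Y + T\<close>, where \<open>Y\<close> is the sum of
\<open>\<bar>\<rho> - 1\<bar> * (X s)\<^sup>2\<close>, whose mean is the sum of the \<open>\<beta> s u\<close>, and where \<open>T\<close> is a transform of the
innovations, bounded in mean square. So \<open>Y\<close> is bounded in probability, and by the Paley-Zygmund
inequality in mean.\<close>

lemma sum_\<beta>_bounded:
  assumes bp: "bdd_in_prob M (self_transforms a t X)" and sub: "{c..<e} \<subseteq> {a..t}"
    and var: "\<And>s. s \<in> {c..<e} \<Longrightarrow> ip (X s) (X s) \<le> C'"
    and C: "\<And>n p. ascending {c..<e} n p \<Longrightarrow> (\<Sum>j<n. d (p j) (p (Suc j))) \<le> C"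
  shows "\<exists>C. \<forall>n p. ascending {c..<e} n p \<longrightarrow> (\<Sum>j<n. \<beta> (p j) (p (Suc j))) \<le> C"
proof -
  \<comment> \<open>Two events of probability less than \<open>1 / 24\<close> make \<open>1 / (4 * \<kappa>)\<close>, with the moment ratio \<open>\<kappa> = 3\<close>.\<close>
  have "(0::real) < 1 / 24" by simp
  with bp obtain K where K: "K > 0" "\<And>Y. Y \<in> self_transforms a t X \<Longrightarrow> tail_prob M Y K < 1 / 24"
    unfolding bdd_in_prob_def by meson
  have C'0: "C' \<ge> 0" using order_trans[OF ip_self_nonneg var[of c]] c_less_e by auto
  have C0: "C \<ge> 0" using C[of 0 "\<lambda>_. c"] c_less_e unfolding ascending_def by auto
  define r where "r = 24 * (C' * C) + 1"
  have r: "r > 0" "24 * (C' * C) < r" "r \<ge> 1" unfolding r_def using C0 C'0 by (auto simp: add_nonneg_pos)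
  have "(\<Sum>j<n. \<beta> (p j) (p (Suc j))) \<le> 2 * (K + r)" if p: "ascending {c..<e} n p" for n p
  proof -
    have pj: "c \<le> p j" "p j < p (Suc j)" "p (Suc j) < e" if "j < n" for j
      using p that unfolding ascending_def by auto
    have pjk: "p (Suc j) \<le> p k" if "j < k" "k < n" for j k
      using strict_steps_less[of n p "Suc j" k] p that unfolding ascending_def by (cases "Suc j = k") auto
    define r' where "r' j = \<rho> (p j) (p (Suc j)) - 1" for j
    define U where "U j = X (p j)" for j
    define V where "V j = W (p j) (p (Suc j))" for j
    define Z where "Z = (\<lambda>\<omega>. \<Sum>j<n. sgn (r' j) * (X (p j) \<omega> * (X (p (Suc j)) \<omega> - X (p j) \<omega>)))"
    define Y where "Y = (\<lambda>\<omega>. \<Sum>j<n. \<bar>r' j\<bar> * (U j \<omega>)\<^sup>2)"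
    define T where "T = (\<lambda>\<omega>. \<Sum>j<n. sgn (r' j) * (U j \<omega> * V j \<omega>))"
    have UL: "U j \<in> L" if "j < n" for j unfolding U_def using pj[OF that] by (intro XL) auto
    have VL: "V j \<in> L" if "j < n" for j unfolding V_def using pj[OF that] by (intro WL) auto
    have ZS: "Z \<in> self_transforms a t X"
    proof -
      define \<sigma> where "\<sigma> j = sgn (r' j)" for j
      have "ascending {a..t} n p" using p sub unfolding ascending_def by blast
      moreover have "\<forall>j. \<bar>\<sigma> j\<bar> \<le> 1" unfolding \<sigma>_def by (simp add: abs_sgn_eq)
      ultimately show ?thesis unfolding self_transforms_def Z_def \<sigma>_def[symmetric] by blast
    qed
    have ZYT: "Z \<omega> = Y \<omega> + T \<omega>" for \<omega>
      unfolding Z_def Y_def T_def sum.distrib[symmetric] U_def V_def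
    proof (intro sum.cong refl)
      fix j
      have "sgn (r' j) * (X (p j) \<omega> * (r' j * X (p j) \<omega>)) = \<bar>r' j\<bar> * (X (p j) \<omega>)\<^sup>2"
        by (simp add: sgn_if power2_eq_square)
      then show "sgn (r' j) * (X (p j) \<omega> * (X (p (Suc j)) \<omega> - X (p j) \<omega>)) =
        \<bar>r' j\<bar> * (X (p j) \<omega>)\<^sup>2 + sgn (r' j) * (X (p j) \<omega> * W (p j) (p (Suc j)) \<omega>)"
        unfolding increment_decomp r'_def[symmetric] by (simp add: algebra_simps)
    qed
    have Ym: "integrable M Y" "integrable M (\<lambda>\<omega>. (Y \<omega>)\<^sup>2)" "expectation Y = (\<Sum>j<n. \<bar>r' j\<bar> * ip (U j) (U j))"
      "expectation (\<lambda>\<omega>. (Y \<omega>)\<^sup>2) \<le> 3 * (expectation Y)\<^sup>2"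
      unfolding Y_def by (rule weighted_squares_moment[OF UL abs_ge_zero]; assumption)+
    have orth1: "ip (V j) (V k) = 0" if "j < k" "k < n" for j k
      unfolding V_def using pj[of j] pj[of k] pjk[of j k] that by (intro W_orth) auto
    have orth2: "ip (U j) (V k) = 0" if "j \<le> k" "k < n" for j k
      unfolding U_def V_def using pj[of j] pj[of k] pjk[of j k] that by (intro W_orth_past) (auto simp: le_less)
    have Tm: "integrable M (\<lambda>\<omega>. (T \<omega>)\<^sup>2)"
      "expectation (\<lambda>\<omega>. (T \<omega>)\<^sup>2) = (\<Sum>j<n. (sgn (r' j))\<^sup>2 * (ip (U j) (U j) * ip (V j) (V j)))"
      unfolding T_def by (rule transform_second_moment[OF UL VL orth1 orth2]; assumption)+
    have "expectation (\<lambda>\<omega>. (T \<omega>)\<^sup>2) \<le> (\<Sum>j<n. C' * d (p j) (p (Suc j)))"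
      unfolding Tm(2)
    proof (intro sum_mono)
      fix j assume "j \<in> {..<n}"
      then have j: "j < n" by simp
      have "ip (V j) (V j) \<le> d (p j) (p (Suc j))"
        unfolding V_def ip_W[OF pj[OF j]] d_eq[OF pj[OF j]] using q_nonneg[OF pj[OF j]] by simp
      moreover have "ip (U j) (U j) \<le> C'" unfolding U_def using pj[OF j] by (intro var) auto
      ultimately have "ip (U j) (U j) * ip (V j) (V j) \<le> C' * d (p j) (p (Suc j))"
        using ip_self_nonneg C'0 by (intro mult_mono) auto
      moreover have "(sgn (r' j))\<^sup>2 * (ip (U j) (U j) * ip (V j) (V j)) \<le> 1 * (ip (U j) (U j) * ip (V j) (V j))"
        using ip_self_nonneg by (intro mult_right_mono mult_nonneg_nonneg) (auto simp: sgn_if)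
      ultimately show "(sgn (r' j))\<^sup>2 * (ip (U j) (U j) * ip (V j) (V j)) \<le> C' * d (p j) (p (Suc j))" by simp
    qed
    also have "\<dots> \<le> C' * C" using C[OF p] C'0 by (simp add: sum_distrib_left[symmetric] mult_left_mono)
    finally have ET: "expectation (\<lambda>\<omega>. (T \<omega>)\<^sup>2) \<le> C' * C" .
    have Tmeas[measurable]: "T \<in> borel_measurable M" unfolding T_def using UL VL L_measurable
      by (intro borel_measurable_sum borel_measurable_times) auto
    have Ymeas[measurable]: "Y \<in> borel_measurable M" using Ym(1) by auto
    have Zmeas[measurable]: "Z \<in> borel_measurable M" unfolding ZYT by measurable
    have "tail_prob M T r \<le> prob {\<omega> \<in> space M. (T \<omega>)\<^sup>2 \<ge> r}"
    proof (intro finite_measure_mono subsetI CollectI conjI)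
      fix \<omega> assume "\<omega> \<in> {\<omega> \<in> space M. \<bar>T \<omega>\<bar> > r}"
      then have *: "\<bar>T \<omega>\<bar> > r" "\<omega> \<in> space M" by auto
      show "\<omega> \<in> space M" by (rule *)
      have "r \<le> \<bar>T \<omega>\<bar> * 1" using * by simp
      also have "\<dots> \<le> \<bar>T \<omega>\<bar> * \<bar>T \<omega>\<bar>" using * r by (intro mult_left_mono) auto
      finally show "r \<le> (T \<omega>)\<^sup>2" by (simp add: power2_eq_square)
    qed measurable
    also have "\<dots> \<le> expectation (\<lambda>\<omega>. (T \<omega>)\<^sup>2) / r"
      using integral_Markov_inequality_measure[OF Tm(1), of "space M" r] r by simp
    also have "\<dots> < 1 / 24" using ET r by (simp add: field_simps)
    finally have PT: "tail_prob M T r < 1 / 24" .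
    have "prob {\<omega> \<in> space M. Y \<omega> > K + r} \<le> tail_prob M Z K + tail_prob M T r"
      by (intro prob_le_add_AE AE_I2) (auto simp: ZYT)
    also have "\<dots> < 1 / (4 * 3)" using K(2)[OF ZS] PT by simp
    finally have "expectation Y \<le> 2 * (K + r)"
      using Ym K r by (intro paley_zygmund[where \<kappa> = 3]) (auto simp: Y_def intro!: sum_nonneg)
    moreover have "expectation Y = (\<Sum>j<n. \<beta> (p j) (p (Suc j)))"
      unfolding Ym(3) U_def r'_def using ratio_variance(2) pj by (intro sum.cong) auto
    ultimately show ?thesis by simp
  qed
  then show ?thesis by blast
qed

end

section \<open>Deterministic limits on a continuity interval\<close>

lemma successively_sorted_mono:
  assumes "successively P xs" "sorted_wrt (<) xs" "set xs \<subseteq> S"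
    "\<And>s u. s \<in> S \<Longrightarrow> u \<in> S \<Longrightarrow> s < u \<Longrightarrow> P s u \<Longrightarrow> Q s u"
  shows "successively Q xs"
  using assms by (induction xs rule: induct_list012) auto

lemma csum_le_on:
  fixes \<nu> \<mu> :: "real \<Rightarrow> real \<Rightarrow> real"
  assumes "sorted_wrt (<) xs" "set xs \<subseteq> S" "\<And>s u. s \<in> S \<Longrightarrow> u \<in> S \<Longrightarrow> s < u \<Longrightarrow> \<nu> s u \<le> \<mu> s u"
  shows "csum \<nu> xs \<le> csum \<mu> xs"
  using assms by (intro csum_mono successively_sorted_imp) auto

lemma csum_nonneg_on:
  fixes \<nu> :: "real \<Rightarrow> real \<Rightarrow> real"
  assumes "sorted_wrt (<) xs" "set xs \<subseteq> S" "\<And>s u. s \<in> S \<Longrightarrow> u \<in> S \<Longrightarrow> s < u \<Longrightarrow> 0 \<le> \<nu> s u"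
  shows "0 \<le> csum \<nu> xs"
  using assms by (intro csum_nonneg successively_sorted_imp) auto

text \<open>The bound \<open>C\<close> is what the semimartingale property provides; the dichotomy for the variance holds
because the boundary of its zero set belongs to the independence partition.\<close>

locale segment_bv = segment M L X c e f g for M :: "'a measure" and L X c e f g +
  fixes C :: real
  assumes dichotomy: "(\<forall>s\<in>{c<..<e}. f s * g s \<noteq> 0) \<or> (\<forall>s\<in>{c<..<e}. f s * g s = 0)"
    and N_bound: "sorted_wrt (<) xs \<Longrightarrow> set xs \<subseteq> {c..<e} \<Longrightarrow> csum (\<lambda>s u. d s u + \<beta> s u) xs \<le> C"
begin

abbreviation "N s u \<equiv> d s u + \<beta> s u"

lemma C_nonneg: "0 \<le> C" using N_bound[of "[]"] by simp

lemma bounds: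
  assumes "c \<le> s" "s < u" "u < e"
  shows "0 \<le> w s u" "w s u \<le> d s u" "0 \<le> q s u" "q s u \<le> d s u" "d s u \<le> N s u" "0 \<le> d s u" "0 \<le> \<beta> s u" "\<beta> s u \<le> N s u"
  using w_nonneg[OF assms] q_nonneg[OF assms] d_eq[OF assms] \<beta>_nonneg[of s u] by auto

lemma csum_le_csum_N:
  assumes "sorted_wrt (<) xs" "set xs \<subseteq> {c..<e}"
  shows "csum q xs \<le> csum N xs" "csum w xs \<le> csum N xs" "csum \<beta> xs \<le> csum N xs" "0 \<le> csum w xs"
proof -
  have *: "q s u \<le> N s u" "w s u \<le> N s u" "\<beta> s u \<le> N s u" "0 \<le> w s u"
    if "s \<in> {c..<e}" "u \<in> {c..<e}" "s < u" for s u
    using bounds[of s u] that by auto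
  show "csum q xs \<le> csum N xs" "csum w xs \<le> csum N xs" "csum \<beta> xs \<le> csum N xs"
    by (rule csum_le_on[OF assms], rule *; assumption)+
  show "0 \<le> csum w xs" by (rule csum_nonneg_on[OF assms], rule *; assumption)
qed

lemma tails:
  assumes "\<epsilon> > 0"
  obtains x y where "c < x" "x \<le> y" "y < e"
    "\<And>xs. sorted_wrt (<) xs \<Longrightarrow> set xs \<subseteq> {c<..<x} \<Longrightarrow> csum N xs \<le> \<epsilon>"
    "\<And>xs. sorted_wrt (<) xs \<Longrightarrow> set xs \<subseteq> {y<..<e} \<Longrightarrow> csum N xs \<le> \<epsilon>"
proof -
  have "\<exists>x y. c < x \<and> x \<le> y \<and> y < e \<and>
    (\<forall>xs. sorted_wrt (<) xs \<longrightarrow> set xs \<subseteq> {c<..<x} \<or> set xs \<subseteq> {y<..<e} \<longrightarrow> csum N xs \<le> \<epsilon>)"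
  proof (rule csum_tail_small[OF c_less_e _ _ assms])
    show "0 \<le> N s u" if "c < s" "s < u" "u < e" for s u using bounds[of s u] that by simp
    show "csum N xs \<le> C" if "sorted_wrt (<) xs" "set xs \<subseteq> {c<..<e}" for xs
      using that by (intro N_bound) auto
  qed
  then show ?thesis using that by blast
qed

text \<open>Uniform mean square continuity on the half-open interval: the factors are uniformly continuous on
compact parts, and near \<open>e\<close>, where they need not have limits, a single increment is already small by
\<open>tails\<close>.\<close>

lemma d_uniform:
  assumes "\<epsilon> > 0"
  shows "\<exists>\<delta>>0. \<forall>s u. c \<le> s \<longrightarrow> s < u \<longrightarrow> u < e \<longrightarrow> u - s < \<delta> \<longrightarrow> d s u \<le> \<epsilon>"
proof -
  obtain x y where xy: "c < x" "x \<le> y" "y < e"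
    and head: "\<And>xs. sorted_wrt (<) xs \<Longrightarrow> set xs \<subseteq> {c<..<x} \<Longrightarrow> csum N xs \<le> \<epsilon>"
    and tail: "\<And>xs. sorted_wrt (<) xs \<Longrightarrow> set xs \<subseteq> {y<..<e} \<Longrightarrow> csum N xs \<le> \<epsilon>"
    by (rule tails[OF assms], rule that)
  \<comment> \<open>The regions \<open>[c, z]\<close> and \<open>(y, e)\<close> overlap, so short intervals lie in one of them.\<close>
  define z where "z = (y + e) / 2"
  have z: "y < z" "z < e" "c < z" unfolding z_def using xy by auto
  have sub: "{c..z} \<subseteq> {c..<e}" using z by auto
  have fc: "continuous_on {c..z} f" and gc: "continuous_on {c..z} g"
    using continuous_on_subset[OF f_cont sub] continuous_on_subset[OF g_cont sub] by auto
  have "bounded (f ` {c..z})" "bounded (g ` {c..z})"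
    using compact_continuous_image[OF fc] compact_continuous_image[OF gc] compact_imp_bounded by auto
  then obtain B1 B2 where B12: "\<And>s. s \<in> {c..z} \<Longrightarrow> \<bar>f s\<bar> \<le> B1" "\<And>s. s \<in> {c..z} \<Longrightarrow> \<bar>g s\<bar> \<le> B2"
    unfolding bounded_iff by (metis image_eqI real_norm_def)
  define B where "B = \<bar>B1\<bar> + \<bar>B2\<bar> + 1"
  have B: "B > 0" "\<And>s. s \<in> {c..z} \<Longrightarrow> \<bar>f s\<bar> \<le> B" "\<And>s. s \<in> {c..z} \<Longrightarrow> \<bar>g s\<bar> \<le> B"
    using B12 unfolding B_def by (force+)
  have uf: "uniformly_continuous_on {c..z} f" and ug: "uniformly_continuous_on {c..z} g"
    using fc gc compact_uniformly_continuous by auto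
  have e: "\<epsilon> / (2 * B) > 0" using assms B by simp
  obtain d1 where d1: "d1 > 0" "\<And>s u. s \<in> {c..z} \<Longrightarrow> u \<in> {c..z} \<Longrightarrow> dist u s < d1 \<Longrightarrow> dist (f u) (f s) < \<epsilon> / (2 * B)"
    using uf e unfolding uniformly_continuous_on_def by blast
  obtain d2 where d2: "d2 > 0" "\<And>s u. s \<in> {c..z} \<Longrightarrow> u \<in> {c..z} \<Longrightarrow> dist u s < d2 \<Longrightarrow> dist (g u) (g s) < \<epsilon> / (2 * B)"
    using ug e unfolding uniformly_continuous_on_def by blast
  show ?thesis
  proof (intro exI[of _ "min (min d1 d2) (z - y)"] conjI allI impI)
    fix s u assume su: "c \<le> s" "s < u" "u < e" "u - s < min (min d1 d2) (z - y)"
    show "d s u \<le> \<epsilon>"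
    proof (cases "u \<le> z")
      case True
      then have in': "s \<in> {c..z}" "u \<in> {c..z}" using su by auto
      have f': "\<bar>f u - f s\<bar> \<le> \<epsilon> / (2 * B)" using d1(2)[OF in'] su by (auto simp: dist_real_def)
      have g': "\<bar>g u - g s\<bar> \<le> \<epsilon> / (2 * B)" using d2(2)[OF in'] su by (auto simp: dist_real_def)
      have "d s u = (f u - f s) * g u - f s * (g u - g s)"
        unfolding d_cov[OF su(1-3)] by (simp add: algebra_simps)
      also have "\<dots> \<le> \<bar>(f u - f s) * g u\<bar> + \<bar>f s * (g u - g s)\<bar>" by linarith
      also have "\<dots> \<le> \<epsilon> / (2 * B) * B + B * (\<epsilon> / (2 * B))"
        unfolding abs_mult using f' g' B in' e by (intro add_mono mult_mono) auto
      also have "\<dots> = \<epsilon>" using B by simp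
      finally show ?thesis .
    next
      case False
      then have "set [s, u] \<subseteq> {y<..<e}" using su by auto
      then have "csum N [s, u] \<le> \<epsilon>" using su by (intro tail) auto
      then show ?thesis using \<beta>_nonneg[of s u] by simp
    qed
  qed (use d1 d2 z in auto)
qed

text \<open>Here \<open>q s u = \<beta> s u * \<bar>g u - g s\<bar> / \<bar>g s\<bar>\<close>, and \<open>\<bar>g\<bar>\<close> is bounded below on \<open>[x, y]\<close> unless the variance
vanishes identically, in which case \<open>q\<close> does too.\<close>

lemma q_le_small_\<beta>:
  assumes "c < x" "y < e" "\<zeta> > 0"
  shows "\<exists>\<delta>>0. \<forall>s\<in>{x..y}. \<forall>u\<in>{x..y}. s < u \<longrightarrow> u - s < \<delta> \<longrightarrow> q s u \<le> \<zeta> * \<beta> s u"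
  using dichotomy
proof
  assume z: "\<forall>s\<in>{c<..<e}. f s * g s = 0"
  have "q s u \<le> \<zeta> * \<beta> s u" if "s \<in> {x..y}" for s u
  proof -
    have "f s * g s = 0" using z that assms by auto
    then have "q s u = 0" unfolding q_def by auto
    then show ?thesis using \<beta>_nonneg[of s u] assms by simp
  qed
  then show ?thesis by (intro exI[of _ 1]) auto
next
  assume nz: "\<forall>s\<in>{c<..<e}. f s * g s \<noteq> 0"
  show ?thesis
  proof (cases "x \<le> y")
    case True
    have sub: "{x..y} \<subseteq> {c..<e}" using assms by auto
    have gc: "continuous_on {x..y} g" using continuous_on_subset[OF g_cont sub] .
    have "continuous_on {x..y} (\<lambda>s. \<bar>g s\<bar>)" using gc by (intro continuous_intros)
    from continuous_attains_inf[OF _ _ this] True obtain s0 where s0: "s0 \<in> {x..y}" "\<And>s. s \<in> {x..y} \<Longrightarrow> \<bar>g s0\<bar> \<le> \<bar>g s\<bar>"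
      by auto
    define \<theta> where "\<theta> = \<bar>g s0\<bar>"
    have t: "\<theta> > 0" using nz s0(1) assms unfolding \<theta>_def by auto
    have "uniformly_continuous_on {x..y} g" using gc compact_uniformly_continuous by auto
    then obtain \<delta> where d: "\<delta> > 0" "\<And>s u. s \<in> {x..y} \<Longrightarrow> u \<in> {x..y} \<Longrightarrow> dist u s < \<delta> \<Longrightarrow> dist (g u) (g s) < \<zeta> * \<theta>"
      using t assms(3) unfolding uniformly_continuous_on_def by (metis mult_pos_pos)
    show ?thesis
    proof (intro exI[of _ \<delta>] conjI ballI impI)
      fix s u assume su: "s \<in> {x..y}" "u \<in> {x..y}" "s < u" "u - s < \<delta>"
      have "\<bar>g u - g s\<bar> \<le> \<zeta> * \<theta>" using d(2)[OF su(1,2)] su by (auto simp: dist_real_def)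
      also have "\<dots> \<le> \<zeta> * \<bar>g s\<bar>" using s0(2)[OF su(1)] assms unfolding \<theta>_def by (intro mult_left_mono) auto
      finally have gs: "\<bar>g u - g s\<bar> \<le> \<zeta> * \<bar>g s\<bar>" .
      have g0: "\<bar>g s\<bar> > 0" using s0(2)[OF su(1)] t unfolding \<theta>_def by auto
      have "0 \<le> v s" using v_nonneg su(1) sub by blast
      then have "v s = \<bar>f s\<bar> / \<bar>g s\<bar>" by (metis abs_divide abs_of_nonneg)
      then have "q s u = \<bar>f s\<bar> / \<bar>g s\<bar> * (\<bar>g u - g s\<bar> * \<bar>g u - g s\<bar>)" unfolding q_def by (simp add: power2_eq_square)
      also have "\<dots> \<le> \<bar>f s\<bar> / \<bar>g s\<bar> * (\<bar>g u - g s\<bar> * (\<zeta> * \<bar>g s\<bar>))"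
        using gs by (intro mult_left_mono) auto
      also have "\<dots> = \<zeta> * \<beta> s u" unfolding \<beta>_def abs_mult using g0 by simp
      finally show "q s u \<le> \<zeta> * \<beta> s u" .
    qed (rule d)
  qed (auto intro!: exI[of _ 1])
qed

text \<open>Cut the list into a first point \<open>c\<close>, a part near \<open>c\<close>, a part in a compact interval \<open>[x, y]\<close> and a part
near \<open>e\<close>. The two end parts are controlled by \<open>tails\<close>, the middle part by \<open>q_le_small_\<beta>\<close>, and each of
the three connecting intervals by \<open>d_uniform\<close>.\<close>

lemma csum_q_small:
  assumes "\<epsilon> > 0"
  shows "\<exists>\<delta>>0. \<forall>xs. sorted_wrt (<) xs \<longrightarrow> set xs \<subseteq> {c..<e} \<longrightarrow> gaps_less \<delta> xs \<longrightarrow> csum q xs \<le> \<epsilon>"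
proof -
  define r where "r = \<epsilon> / 6"
  have r: "r > 0" using assms unfolding r_def by simp
  obtain x y where xy: "c < x" "x \<le> y" "y < e"
    and head: "\<And>xs. sorted_wrt (<) xs \<Longrightarrow> set xs \<subseteq> {c<..<x} \<Longrightarrow> csum N xs \<le> r"
    and tail: "\<And>xs. sorted_wrt (<) xs \<Longrightarrow> set xs \<subseteq> {y<..<e} \<Longrightarrow> csum N xs \<le> r"
    by (rule tails[OF r], rule that)
  obtain d1 where d1: "d1 > 0" "\<And>s u. c \<le> s \<Longrightarrow> s < u \<Longrightarrow> u < e \<Longrightarrow> u - s < d1 \<Longrightarrow> d s u \<le> r"
    using d_uniform[OF r] by blast
  define \<zeta> where "\<zeta> = r / (C + 1)"
  have \<zeta>: "\<zeta> > 0" "\<zeta> * C \<le> r" unfolding \<zeta>_def using C_nonneg r by (auto simp: field_simps)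
  obtain d2 where d2: "d2 > 0" "\<And>s u. s \<in> {x..y} \<Longrightarrow> u \<in> {x..y} \<Longrightarrow> s < u \<Longrightarrow> u - s < d2 \<Longrightarrow> q s u \<le> \<zeta> * \<beta> s u"
    using q_le_small_\<beta>[OF xy(1,3) \<zeta>(1)] by blast
  show ?thesis
  proof (intro exI[of _ "min d1 d2"] conjI allI impI)
    fix xs assume xs: "sorted_wrt (<) xs" "set xs \<subseteq> {c..<e}" "gaps_less (min d1 d2) xs"
    have qr: "successively (\<lambda>s u. q s u \<le> r) xs"
      using xs(3,1,2)
    proof (rule successively_sorted_mono)
      fix s u assume "s \<in> {c..<e}" "u \<in> {c..<e}" "s < u" "u - s < min d1 d2"
      then show "q s u \<le> r" using d1(2)[of s u] bounds[of s u] by auto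
    qed
    define A R where "A = filter (\<lambda>s. s \<le> c) xs" and "R = filter (\<lambda>s. c < s) xs"
    define A1 R1 where "A1 = filter (\<lambda>s. s < x) R" and "R1 = filter (\<lambda>s. x \<le> s) R"
    define A2 R2 where "A2 = filter (\<lambda>s. s \<le> y) R1" and "R2 = filter (\<lambda>s. y < s) R1"
    have s1: "xs = A @ R" unfolding A_def R_def by (rule sorted_filter_split'[OF xs(1)])
    have sR: "sorted_wrt (<) R" unfolding R_def using xs(1) by (rule sorted_wrt_filter)
    have s2: "R = A1 @ R1" unfolding A1_def R1_def by (rule sorted_filter_split[OF sR])
    have sR1: "sorted_wrt (<) R1" unfolding R1_def using sR by (rule sorted_wrt_filter)
    have s3: "R1 = A2 @ R2" unfolding A2_def R2_def by (rule sorted_filter_split'[OF sR1])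
    have sA: "sorted_wrt (<) A" "sorted_wrt (<) A1" "sorted_wrt (<) A2" "sorted_wrt (<) R2"
      unfolding A_def A1_def A2_def R2_def using xs(1) sR sR1 by (auto intro: sorted_wrt_filter)
    have qR: "successively (\<lambda>s u. q s u \<le> r) R" using qr unfolding s1 successively_append_iff by blast
    have qR1: "successively (\<lambda>s u. q s u \<le> r) R1" using qR unfolding s2 successively_append_iff by blast
    have gap: "gaps_less (min d1 d2) A2" using xs(3) unfolding s1 s2 s3 successively_append_iff by blast
    have "csum q A = 0"
    proof -
      have "set A \<subseteq> {c}" unfolding A_def using xs(2) by auto
      then show ?thesis using sA(1) by (cases "(q, A)" rule: csum.cases) auto
    qed
    moreover have "csum q A1 \<le> r"
    proof -
      have sub: "set A1 \<subseteq> {c<..<x}" unfolding A1_def R_def by auto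
      have "csum q A1 \<le> csum N A1" using sub xy by (intro csum_le_csum_N sA) auto
      then show ?thesis using head[OF sA(2) sub] by simp
    qed
    moreover have "csum q R2 \<le> r"
    proof -
      have sub: "set R2 \<subseteq> {y<..<e}" unfolding R2_def R1_def R_def using xs(2) by auto
      have "csum q R2 \<le> csum N R2" using sub xy by (intro csum_le_csum_N sA) auto
      then show ?thesis using tail[OF sA(4) sub] by simp
    qed
    moreover have "csum q A2 \<le> r"
    proof -
      have sub: "set A2 \<subseteq> {x..y}" unfolding A2_def R1_def by auto
      have "successively (\<lambda>s u. q s u \<le> \<zeta> * \<beta> s u) A2"
        by (rule successively_sorted_mono[OF gap sA(3) sub]) (use d2 in auto)
      then have "csum q A2 \<le> csum (\<lambda>s u. \<zeta> * \<beta> s u) A2" by (rule csum_mono)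
      also have "\<dots> = \<zeta> * csum \<beta> A2" by (rule csum_cmult)
      also have "csum \<beta> A2 \<le> csum N A2" using sub xy by (intro csum_le_csum_N sA) auto
      also have "csum N A2 \<le> C" using sub xy by (intro N_bound sA) auto
      finally show ?thesis using \<zeta> by (simp add: mult_left_mono)
    qed
    moreover have "csum q xs \<le> csum q A + csum q R + r" using csum_append_le[of q r A R] qr r s1 by simp
    moreover have "csum q R \<le> csum q A1 + csum q R1 + r" using csum_append_le[of q r A1 R1] qR r s2 by simp
    moreover have "csum q R1 \<le> csum q A2 + csum q R2 + r" using csum_append_le[of q r A2 R2] qR1 r s3 by simp
    ultimately have "csum q xs \<le> 6 * r" by linarith
    then show "csum q xs \<le> \<epsilon>" unfolding r_def by simp
  qed (use d1 d2 in auto)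
qed

lemma csum_w_le:
  assumes "sorted_wrt (<) xs" "set xs \<subseteq> {c..<e}"
  shows "csum w xs \<le> C" "0 \<le> csum w xs"
proof -
  have "csum w xs \<le> csum N xs" by (rule csum_le_csum_N[OF assms])
  then show "csum w xs \<le> C" using N_bound[OF assms] by simp
  show "0 \<le> csum w xs" by (rule csum_le_csum_N[OF assms])
qed

definition "I x = RS_integral c x (\<lambda>s. (g s)\<^sup>2) (\<lambda>s. f s / g s)"

lemma I_csum:
  assumes "c < x" "x < e" "\<epsilon> > 0"
  shows "\<exists>\<delta>>0. \<forall>xs. plist c x xs \<longrightarrow> gaps_less \<delta> xs \<longrightarrow> \<bar>csum w xs - I x\<bar> < \<epsilon>"
proof -
  have sub: "{c..x} \<subseteq> {c..<e}" using assms by auto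
  have "mono_on {c..x} (\<lambda>s. f s / g s)" using v_mono sub by (rule mono_on_subset)
  moreover have "continuous_on {c..x} (\<lambda>s. (g s)\<^sup>2)"
    using continuous_on_subset[OF g_cont sub] by (intro continuous_intros)
  ultimately show ?thesis using RS_integral_csum[OF assms(1) _ _ assms(3)] unfolding I_def w_def by fastforce
qed

lemma plist_subset: "plist c x xs \<Longrightarrow> x < e \<Longrightarrow> set xs \<subseteq> {c..<e}"
  using plist_bounds[of c x xs] by force

lemma I_le: assumes "c < x" "x < e" shows "I x \<le> C"
proof (rule field_le_epsilon)
  fix \<epsilon> :: real assume "\<epsilon> > 0"
  from I_csum[OF assms this] obtain \<delta> where d: "\<delta> > 0" "\<And>xs. plist c x xs \<Longrightarrow> gaps_less \<delta> xs \<Longrightarrow> \<bar>csum w xs - I x\<bar> < \<epsilon>" by blast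
  obtain xs where xs: "plist c x xs" "gaps_less \<delta> xs" using plist_exists[OF assms(1) d(1)] by blast
  have "csum w xs \<le> C" using xs(1) plist_subset[OF xs(1) assms(2)] unfolding plist_def by (intro csum_w_le) auto
  then show "I x \<le> C + \<epsilon>" using d(2)[OF xs] by linarith
qed

lemma I_mono: assumes "c < x" "x < y" "y < e" shows "I x \<le> I y"
proof (rule field_le_epsilon)
  fix \<epsilon> :: real assume "\<epsilon> > 0"
  then have e2: "\<epsilon> / 2 > 0" by simp
  from I_csum[of x, OF _ _ e2] assms obtain d1 where d1: "d1 > 0" "\<And>xs. plist c x xs \<Longrightarrow> gaps_less d1 xs \<Longrightarrow> \<bar>csum w xs - I x\<bar> < \<epsilon> / 2" by force
  from I_csum[of y, OF _ _ e2] assms obtain d2 where d2: "d2 > 0" "\<And>xs. plist c y xs \<Longrightarrow> gaps_less d2 xs \<Longrightarrow> \<bar>csum w xs - I y\<bar> < \<epsilon> / 2" by force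
  define \<delta> where "\<delta> = min d1 d2"
  have \<delta>: "\<delta> > 0" "\<delta> \<le> d1" "\<delta> \<le> d2" using d1 d2 unfolding \<delta>_def by auto
  obtain xs where xs: "plist c x xs" "gaps_less \<delta> xs" using plist_exists[OF assms(1) \<delta>(1)] by blast
  obtain ys where ys: "plist x y ys" "gaps_less \<delta> ys" using plist_exists[OF assms(2) \<delta>(1)] by blast
  obtain as where as: "xs = as @ [x]" using xs(1) unfolding plist_def by (metis append_butlast_last_id)
  obtain bs where bs: "ys = x # bs" using ys(1) unfolding plist_def by (metis list.collapse)
  have bsne: "bs \<noteq> []" using ys(1) assms(2) unfolding plist_def bs by auto
  have gm: "gaps_less d1 xs" using xs(2) \<delta> by (auto intro: successively_mono)
  have pl: "plist c y (as @ x # bs)"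
    using xs(1) ys(1) assms plist_bounds[OF xs(1)] plist_bounds[OF ys(1)] bsne unfolding plist_def as bs
    by (auto simp: sorted_wrt_append hd_append split: if_splits intro: less_trans)
  have "gaps_less \<delta> (as @ x # bs)" using xs(2) ys(2) unfolding as bs by (auto simp: successively_append_iff)
  then have gm2: "gaps_less d2 (as @ x # bs)" using \<delta> by (auto intro: successively_mono)
  have "csum w (as @ x # bs) = csum w xs + csum w ys" unfolding as bs by (rule csum_append_snoc)
  moreover have "0 \<le> csum w ys"
  proof (rule csum_w_le)
    show "sorted_wrt (<) ys" using ys(1) unfolding plist_def by simp
    show "set ys \<subseteq> {c..<e}" using plist_bounds[OF ys(1)] assms by force
  qed
  ultimately show "I x \<le> I y + \<epsilon>" using d1(2)[OF xs(1) gm] d2(2)[OF pl gm2] by linarith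
qed

definition "J = (SUP x\<in>{c<..<e}. I x)"

lemma I_tendsto_J: "(I \<longlongrightarrow> J) (at_left e)"
proof (rule order_tendstoI)
  have ne: "I ` {c<..<e} \<noteq> {}" using c_less_e dense by fastforce
  have bd: "bdd_above (I ` {c<..<e})" using I_le by (intro bdd_aboveI[of _ C]) auto
  fix l assume "l < J"
  then obtain x where x: "c < x" "x < e" "l < I x" unfolding J_def less_cSup_iff[OF ne bd] by auto
  have "\<forall>\<^sub>F y in at_left e. x < y \<and> y < e" unfolding eventually_at_left_field using x by blast
  then show "\<forall>\<^sub>F y in at_left e. l < I y"
  proof eventually_elim
    case (elim y)
    then show ?case using I_mono[of x y] x by linarith
  qed
next
  have bd: "bdd_above (I ` {c<..<e})" using I_le by (intro bdd_aboveI[of _ C]) auto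
  fix u assume "J < u"
  have "\<forall>\<^sub>F y in at_left e. c < y \<and> y < e" unfolding eventually_at_left_field using c_less_e by blast
  then show "\<forall>\<^sub>F y in at_left e. I y < u"
  proof eventually_elim
    case (elim y)
    then have "I y \<le> J" unfolding J_def using bd by (intro cSUP_upper) auto
    then show ?case using \<open>J < u\<close> by simp
  qed
qed

text \<open>Along such lists \<open>csum w\<close> is a Riemann-Stieltjes sum with tags at right end points, but the last point
varies with the list while the mesh needed for \<open>I x\<close> depends on \<open>x\<close>. So compare with \<open>I z\<close> for a fixed
\<open>z\<close> close to \<open>e\<close>; what the list contributes after \<open>z\<close> is small by \<open>tails\<close>.\<close>

lemma csum_w_tendsto_J:
  assumes "\<epsilon> > 0"
  shows "\<exists>\<delta>>0. \<forall>xs. sorted_wrt (<) xs \<longrightarrow> set xs \<subseteq> {c..<e} \<longrightarrow> xs \<noteq> [] \<longrightarrow> hd xs = c \<longrightarrow> gaps_less \<delta> xs \<longrightarrow>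
    e - last xs < \<delta> \<longrightarrow> \<bar>csum w xs - J\<bar> \<le> \<epsilon>"
proof -
  define r where "r = \<epsilon> / 5"
  have r: "r > 0" using assms unfolding r_def by simp
  obtain x y where xy: "c < x" "x \<le> y" "y < e"
    and head: "\<And>xs. sorted_wrt (<) xs \<Longrightarrow> set xs \<subseteq> {c<..<x} \<Longrightarrow> csum N xs \<le> r"
    and tail: "\<And>xs. sorted_wrt (<) xs \<Longrightarrow> set xs \<subseteq> {y<..<e} \<Longrightarrow> csum N xs \<le> r"
    by (rule tails[OF r], rule that)
  have "\<forall>\<^sub>F z in at_left e. dist (I z) J < r" using tendstoD[OF I_tendsto_J r] .
  moreover have "\<forall>\<^sub>F z in at_left e. y < z \<and> z < e" unfolding eventually_at_left_field using xy by blast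
  ultimately have "\<forall>\<^sub>F z in at_left e. dist (I z) J < r \<and> y < z \<and> z < e" by eventually_elim simp
  then obtain z where z: "\<bar>I z - J\<bar> < r" "y < z" "z < e"
    using eventually_happens'[OF trivial_limit_at_left_real] by (fastforce simp: dist_real_def)
  have cz: "c < z" using xy z by simp
  obtain d1 where d1: "d1 > 0" "\<And>xs. plist c z xs \<Longrightarrow> gaps_less d1 xs \<Longrightarrow> \<bar>csum w xs - I z\<bar> < r"
    using I_csum[OF cz z(3) r] by blast
  obtain d2 where d2: "d2 > 0" "\<And>s u. c \<le> s \<Longrightarrow> s < u \<Longrightarrow> u < e \<Longrightarrow> u - s < d2 \<Longrightarrow> d s u \<le> r"
    using d_uniform[OF r] by blast
  define \<delta> where "\<delta> = min (min d1 d2) (e - z)"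
  have \<delta>: "\<delta> > 0" "\<delta> \<le> d1" "\<delta> \<le> d2" "\<delta> \<le> e - z" using d1 d2 z unfolding \<delta>_def by auto
  show ?thesis
  proof (intro exI[of _ \<delta>] conjI allI impI)
    fix xs assume xs: "sorted_wrt (<) xs" "set xs \<subseteq> {c..<e}" "xs \<noteq> []" "hd xs = c" "gaps_less \<delta> xs" "e - last xs < \<delta>"
    define A B where "A = filter (\<lambda>s. s < z) xs" and "B = filter (\<lambda>s. z \<le> s) xs"
    have AB: "xs = A @ B" unfolding A_def B_def by (rule sorted_filter_split[OF xs(1)])
    have "c \<in> set xs" using xs(3,4) hd_in_set by force
    then have cA: "c \<in> set A" unfolding A_def using cz by simp
    then have Ane: "A \<noteq> []" by auto
    have "last xs \<in> set xs" using xs(3) by simp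
    then have "last xs \<in> set B" unfolding B_def using xs(6) \<delta> by simp
    then have Bne: "B \<noteq> []" by auto
    have sA: "sorted_wrt (<) A" and sB: "sorted_wrt (<) B" unfolding A_def B_def using xs(1) by (auto intro: sorted_wrt_filter)
    have lA: "last A \<in> set A" using Ane by simp
    then have lA': "c \<le> last A" "last A < z" unfolding A_def using xs(2) by auto
    have hB: "hd B \<in> set B" using Bne by simp
    then have hB': "z \<le> hd B" "hd B < e" unfolding B_def using xs(2) by auto
    have gap: "hd B - last A < \<delta>" "gaps_less \<delta> A" using xs(5) Ane Bne unfolding AB successively_append_iff by auto
    have pl: "plist c z (A @ [z])" unfolding plist_def using sA xs(4) Ane unfolding AB
      by (auto simp: sorted_wrt_append A_def)
    have "gaps_less \<delta> (A @ [z])" using gap hB' Ane by (auto simp: successively_append_iff)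
    then have gm: "gaps_less d1 (A @ [z])" using \<delta> by (auto intro: successively_mono)
    have 1: "\<bar>csum w (A @ [z]) - I z\<bar> < r" by (rule d1(2)[OF pl gm])
    have 2: "csum w (A @ [z]) = csum w A + w (last A) z" using csum_append[OF Ane, of "[z]" w] by simp
    have 3: "0 \<le> w (last A) z" "w (last A) z \<le> r"
      using bounds[of "last A" z] d2(2)[of "last A" z] lA' z gap hB' \<delta> by auto
    have 4: "csum w xs = csum w A + w (last A) (hd B) + csum w B" unfolding AB by (rule csum_append[OF Ane Bne])
    have 5: "0 \<le> w (last A) (hd B)" "w (last A) (hd B) \<le> r"
      using bounds[of "last A" "hd B"] d2(2)[of "last A" "hd B"] lA' z gap hB' \<delta> by auto
    have subB: "set B \<subseteq> {y<..<e}" unfolding B_def using xs(2) z by auto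
    have subB': "set B \<subseteq> {c..<e}" unfolding B_def using xs(2) by auto
    have "csum w B \<le> csum N B" by (rule csum_le_csum_N[OF sB subB'])
    then have 6: "csum w B \<le> r" using tail[OF sB subB] by simp
    have 7: "0 \<le> csum w B" by (rule csum_w_le(2)[OF sB subB'])
    have "\<bar>csum w xs - J\<bar> \<le> 5 * r" using 1 2 3 4 5 6 7 z(1) by linarith
    then show "\<bar>csum w xs - J\<bar> \<le> \<epsilon>" unfolding r_def by simp
  qed (rule \<delta>)
qed

end

section \<open>Quadratic variation on a continuity interval\<close>

abbreviation sq_variation :: "(real \<Rightarrow> 'a \<Rightarrow> real) \<Rightarrow> 'a \<Rightarrow> real list \<Rightarrow> real" where
  "sq_variation X \<omega> \<equiv> csum (\<lambda>s u. (X u \<omega> - X s \<omega>)\<^sup>2)"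

lemma young:
  fixes x y \<kappa> :: real
  assumes "\<kappa> > 0"
  shows "\<bar>2 * (x * y)\<bar> \<le> \<kappa> * x\<^sup>2 + 1 / \<kappa> * y\<^sup>2"
proof -
  have "0 \<le> (\<kappa> * \<bar>x\<bar> - \<bar>y\<bar>)\<^sup>2 / \<kappa>" using assms by simp
  also have "\<dots> = \<kappa> * x\<^sup>2 + 1 / \<kappa> * y\<^sup>2 - 2 * (\<bar>x\<bar> * \<bar>y\<bar>)"
    using assms by (simp add: field_simps power2_eq_square)
  finally show ?thesis by (simp add: abs_mult)
qed

context segment_bv begin

text \<open>Write an increment as \<open>V + b\<close> with innovation \<open>V\<close>. Young's inequality with parameter \<open>\<kappa>\<close> separates the
mixed terms \<open>2 * V * b\<close>, and the fluctuation of the sum of \<open>V\<^sup>2\<close> is estimated in mean square.\<close>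

lemma increments_L1:
  assumes xs: "sorted_wrt (<) xs" "set xs \<subseteq> {c..<e}" and "\<kappa> > 0" and wr: "successively (\<lambda>s u. w s u \<le> r) xs"
  shows "integrable M (\<lambda>\<omega>. sq_variation X \<omega> xs)" (is ?int)
    "expectation (\<lambda>\<omega>. \<bar>sq_variation X \<omega> xs - csum w xs\<bar>) \<le>
      \<kappa> + 2 * (\<bar>r\<bar> * C) / \<kappa> + \<kappa> * C + (1 + 1 / \<kappa>) * csum q xs" (is ?bound)
proof -
  define n where "n = length xs - 1"
  define p where "p = (!) xs"
  have pm: "p j < p k" if "j < k" "k \<le> n" for j k
    using xs(1) that unfolding p_def n_def sorted_wrt_iff_nth_less by auto
  have pin: "p j \<in> {c..<e}" if "j \<le> n" "n \<noteq> 0" for j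
  proof -
    have "xs ! j \<in> set xs" using that unfolding n_def by (intro nth_mem) auto
    then show ?thesis using xs(2) unfolding p_def by blast
  qed
  have pj: "c \<le> p j" "p j < p (Suc j)" "p (Suc j) < e" if "j < n" for j
    using pin[of j] pin[of "Suc j"] pm[of j "Suc j"] that by auto
  have pjk: "p (Suc j) \<le> p k" if "j < k" "k < n" for j k
    using pm[of "Suc j" k] that by (cases "Suc j = k") auto
  have cs: "csum \<nu> xs = (\<Sum>j<n. \<nu> (p j) (p (Suc j)))" for \<nu> :: "real \<Rightarrow> real \<Rightarrow> real"
    unfolding csum_conv_sum n_def p_def ..
  define V where "V j = W (p j) (p (Suc j))" for j
  define b where "b j = (\<lambda>\<omega>. (\<rho> (p j) (p (Suc j)) - 1) * X (p j) \<omega>)" for j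
  define w' where "w' j = ip (V j) (V j)" for j
  have w': "w' j = w (p j) (p (Suc j))" if "j < n" for j unfolding w'_def V_def using ip_W pj that by auto
  have VL: "V j \<in> L" if "j < n" for j unfolding V_def using pj[OF that] by (intro WL) auto
  have bL: "b j \<in> L" if "j < n" for j unfolding b_def using pj[OF that] by (intro L_scale XL) auto
  have orth: "ip (V j) (V k) = 0" if "j < k" "k < n" for j k
    unfolding V_def using pj[of j] pj[of k] pjk[of j k] that by (intro W_orth) auto
  have Eb: "expectation (\<lambda>\<omega>. (b j \<omega>)\<^sup>2) = q (p j) (p (Suc j))" if "j < n" for j
    unfolding ip_self[symmetric] b_def ip_scale_left ip_scale_right using ratio_variance(1)[OF pj[OF that]]
    by (simp add: power2_eq_square mult.assoc)
  have EV: "expectation (\<lambda>\<omega>. (V j \<omega>)\<^sup>2) = w' j" for j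
    unfolding ip_self[symmetric] w'_def ..
  define S where "S \<omega> = (\<Sum>j<n. (V j \<omega>)\<^sup>2) - (\<Sum>j<n. w' j)" for \<omega>
  have Sint: "integrable M (\<lambda>\<omega>. (S \<omega>)\<^sup>2)" and ES: "expectation (\<lambda>\<omega>. (S \<omega>)\<^sup>2) = 2 * (\<Sum>j<n. (w' j)\<^sup>2)"
    unfolding S_def w'_def by (rule variance_sum_squares_orthogonal[OF VL orth]; assumption)+
  have D: "X (p (Suc j)) \<omega> - X (p j) \<omega> = V j \<omega> + b j \<omega>" for j \<omega>
    unfolding V_def b_def by (rule increment_decomp)
  have R: "sq_variation X \<omega> xs = (\<Sum>j<n. (V j \<omega> + b j \<omega>)\<^sup>2)" for \<omega>
    unfolding cs D ..
  have Rint: "integrable M (\<lambda>\<omega>. (V j \<omega> + b j \<omega>)\<^sup>2)" if "j < n" for j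
    using L_integrable_sq[OF L_add[OF VL bL]] that by blast
  show ?int unfolding R using Rint by (intro Bochner_Integration.integrable_sum) auto
  have ptw: "\<bar>sq_variation X \<omega> xs - csum w xs\<bar> \<le>
    \<kappa> + 1 / \<kappa> * (S \<omega>)\<^sup>2 + (\<Sum>j<n. \<kappa> * (V j \<omega>)\<^sup>2 + (1 + 1 / \<kappa>) * (b j \<omega>)\<^sup>2)" for \<omega>
  proof -
    have "sq_variation X \<omega> xs - csum w xs = S \<omega> + (\<Sum>j<n. 2 * (V j \<omega> * b j \<omega>) + (b j \<omega>)\<^sup>2)"
      unfolding R S_def cs[of w] by (simp add: w' power2_sum sum.distrib algebra_simps)
    also have "\<bar>\<dots>\<bar> \<le> \<bar>S \<omega>\<bar> + (\<Sum>j<n. \<bar>2 * (V j \<omega> * b j \<omega>) + (b j \<omega>)\<^sup>2\<bar>)"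
      by (intro order_trans[OF abs_triangle_ineq] add_left_mono sum_abs)
    also have "(\<Sum>j<n. \<bar>2 * (V j \<omega> * b j \<omega>) + (b j \<omega>)\<^sup>2\<bar>) \<le> (\<Sum>j<n. \<kappa> * (V j \<omega>)\<^sup>2 + (1 + 1 / \<kappa>) * (b j \<omega>)\<^sup>2)"
    proof (intro sum_mono)
      fix j
      have "\<bar>2 * (V j \<omega> * b j \<omega>) + (b j \<omega>)\<^sup>2\<bar> \<le> \<bar>2 * (V j \<omega> * b j \<omega>)\<bar> + (b j \<omega>)\<^sup>2"
        by (rule order_trans[OF abs_triangle_ineq]) simp
      also have "\<dots> \<le> \<kappa> * (V j \<omega>)\<^sup>2 + 1 / \<kappa> * (b j \<omega>)\<^sup>2 + (b j \<omega>)\<^sup>2" by (intro add_right_mono young[OF \<open>\<kappa> > 0\<close>])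
      finally show "\<bar>2 * (V j \<omega> * b j \<omega>) + (b j \<omega>)\<^sup>2\<bar> \<le> \<kappa> * (V j \<omega>)\<^sup>2 + (1 + 1 / \<kappa>) * (b j \<omega>)\<^sup>2"
        by (simp add: algebra_simps)
    qed
    also have "\<bar>S \<omega>\<bar> \<le> \<kappa> + 1 / \<kappa> * (S \<omega>)\<^sup>2"
    proof -
      have "2 * \<bar>S \<omega>\<bar> \<le> \<kappa> * 1\<^sup>2 + 1 / \<kappa> * (S \<omega>)\<^sup>2" using young[OF \<open>\<kappa> > 0\<close>, of 1 "S \<omega>"] by (simp add: abs_mult)
      moreover have "0 \<le> \<kappa> + 1 / \<kappa> * (S \<omega>)\<^sup>2" using \<open>\<kappa> > 0\<close> by simp
      ultimately show ?thesis by simp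
    qed
    finally show ?thesis by simp
  qed
  have i1: "integrable M (\<lambda>\<omega>. \<Sum>j<n. \<kappa> * (V j \<omega>)\<^sup>2 + (1 + 1 / \<kappa>) * (b j \<omega>)\<^sup>2)"
    using L_integrable_sq[OF VL] L_integrable_sq[OF bL]
    by (intro Bochner_Integration.integrable_sum Bochner_Integration.integrable_add integrable_mult_right) auto
  have "expectation (\<lambda>\<omega>. \<bar>sq_variation X \<omega> xs - csum w xs\<bar>) \<le>
     expectation (\<lambda>\<omega>. \<kappa> + 1 / \<kappa> * (S \<omega>)\<^sup>2 + (\<Sum>j<n. \<kappa> * (V j \<omega>)\<^sup>2 + (1 + 1 / \<kappa>) * (b j \<omega>)\<^sup>2))"
    using ptw \<open>?int\<close> Sint i1 by (intro integral_mono integrable_abs Bochner_Integration.integrable_diff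
        Bochner_Integration.integrable_add integrable_mult_right) auto
  also have "\<dots> = \<kappa> + 1 / \<kappa> * expectation (\<lambda>\<omega>. (S \<omega>)\<^sup>2) +
      expectation (\<lambda>\<omega>. \<Sum>j<n. \<kappa> * (V j \<omega>)\<^sup>2 + (1 + 1 / \<kappa>) * (b j \<omega>)\<^sup>2)"
    using Sint i1 by (simp add: prob_space)
  also have "expectation (\<lambda>\<omega>. \<Sum>j<n. \<kappa> * (V j \<omega>)\<^sup>2 + (1 + 1 / \<kappa>) * (b j \<omega>)\<^sup>2) =
      (\<Sum>j<n. \<kappa> * w' j + (1 + 1 / \<kappa>) * q (p j) (p (Suc j)))"
    using L_integrable_sq[OF VL] L_integrable_sq[OF bL] by (simp add: Eb EV)
  also have "\<dots> = \<kappa> * csum w xs + (1 + 1 / \<kappa>) * csum q xs"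
    unfolding cs by (simp add: w' sum.distrib sum_distrib_left)
  also have "\<kappa> * csum w xs \<le> \<kappa> * C" using csum_w_le[OF xs] \<open>\<kappa> > 0\<close> by (intro mult_left_mono) auto
  also have "1 / \<kappa> * expectation (\<lambda>\<omega>. (S \<omega>)\<^sup>2) \<le> 1 / \<kappa> * (2 * (\<bar>r\<bar> * C))"
  proof -
    have "(\<Sum>j<n. (w' j)\<^sup>2) \<le> (\<Sum>j<n. \<bar>r\<bar> * w' j)"
    proof (intro sum_mono)
      fix j assume "j \<in> {..<n}"
      then have j: "j < n" by simp
      have "w' j \<le> r" using wr j unfolding w'[OF j] p_def n_def successively_conv_nth by auto
      moreover have "0 \<le> w' j" unfolding w'_def by (rule ip_self_nonneg)
      ultimately show "(w' j)\<^sup>2 \<le> \<bar>r\<bar> * w' j" unfolding power2_eq_square by (intro mult_right_mono) auto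
    qed
    also have "\<dots> = \<bar>r\<bar> * csum w xs" unfolding cs by (simp add: w' sum_distrib_left)
    also have "\<dots> \<le> \<bar>r\<bar> * C" using csum_w_le[OF xs] by (intro mult_left_mono) auto
    finally show ?thesis unfolding ES using \<open>\<kappa> > 0\<close> by (intro mult_left_mono) auto
  qed
  finally show ?bound by simp
qed

lemma increments_tendsto_J:
  assumes "\<epsilon> > 0"
  shows "\<exists>\<delta>>0. \<forall>xs. sorted_wrt (<) xs \<longrightarrow> set xs \<subseteq> {c..<e} \<longrightarrow> xs \<noteq> [] \<longrightarrow> hd xs = c \<longrightarrow> gaps_less \<delta> xs \<longrightarrow>
    e - last xs < \<delta> \<longrightarrow>
    integrable M (\<lambda>\<omega>. sq_variation X \<omega> xs) \<and>
    expectation (\<lambda>\<omega>. \<bar>sq_variation X \<omega> xs - J\<bar>) \<le> \<epsilon>"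
proof -
  define \<kappa> where "\<kappa> = \<epsilon> / (4 * (1 + C))"
  have "1 + C \<noteq> 0" using C_nonneg by simp
  then have "\<kappa> * (1 + C) = \<epsilon> / 4" unfolding \<kappa>_def by (simp add: divide_simps)
  moreover have "\<kappa> > 0" unfolding \<kappa>_def using C_nonneg assms by simp
  ultimately have \<kappa>: "\<kappa> > 0" "\<kappa> + \<kappa> * C = \<epsilon> / 4" by (simp_all add: algebra_simps)
  define D where "D = 1 + C"
  have D: "D > 0" "C \<le> D" unfolding D_def using C_nonneg by auto
  define r where "r = \<kappa> * \<epsilon> / (8 * D)"
  have r: "r > 0" unfolding r_def using \<kappa> assms D by simp
  have "2 * (\<bar>r\<bar> * C) / \<kappa> = \<epsilon> / 4 * (C / D)" unfolding r_def using \<kappa> assms D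
    by (simp add: abs_mult divide_simps)
  also have "\<dots> \<le> \<epsilon> / 4 * 1" using assms D by (intro mult_left_mono) auto
  finally have r2: "2 * (\<bar>r\<bar> * C) / \<kappa> \<le> \<epsilon> / 4" by simp
  define t where "t = \<epsilon> / (4 * (1 + 1 / \<kappa>))"
  have "0 < 1 + 1 / \<kappa>" using \<kappa> by (simp add: add_pos_pos)
  then have t: "t > 0" "(1 + 1 / \<kappa>) * t = \<epsilon> / 4" unfolding t_def using assms by (auto simp: field_simps)
  obtain d1 where d1: "d1 > 0" "\<And>xs. sorted_wrt (<) xs \<Longrightarrow> set xs \<subseteq> {c..<e} \<Longrightarrow> gaps_less d1 xs \<Longrightarrow> csum q xs \<le> t"
    using csum_q_small[OF t(1)] by blast
  obtain d2 where d2: "d2 > 0" "\<And>s u. c \<le> s \<Longrightarrow> s < u \<Longrightarrow> u < e \<Longrightarrow> u - s < d2 \<Longrightarrow> d s u \<le> r"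
    using d_uniform[OF r] by blast
  have e4: "\<epsilon> / 4 > 0" using assms by simp
  obtain d3 where d3: "d3 > 0" "\<And>xs. sorted_wrt (<) xs \<Longrightarrow> set xs \<subseteq> {c..<e} \<Longrightarrow> xs \<noteq> [] \<Longrightarrow> hd xs = c \<Longrightarrow> gaps_less d3 xs \<Longrightarrow>
    e - last xs < d3 \<Longrightarrow> \<bar>csum w xs - J\<bar> \<le> \<epsilon> / 4"
    using csum_w_tendsto_J[OF e4] by blast
  define \<delta> where "\<delta> = min d1 (min d2 d3)"
  have \<delta>: "\<delta> > 0" "\<delta> \<le> d1" "\<delta> \<le> d2" "\<delta> \<le> d3" unfolding \<delta>_def using d1 d2 d3 by auto
  show ?thesis
  proof (rule exI[of _ \<delta>], intro conjI allI impI)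
    fix xs assume xs: "sorted_wrt (<) xs" "set xs \<subseteq> {c..<e}" "xs \<noteq> []" "hd xs = c" "gaps_less \<delta> xs" "e - last xs < \<delta>"
    have g1: "gaps_less d1 xs" and g3: "gaps_less d3 xs" using xs(5) \<delta> by (auto intro: successively_mono)
    have wr: "successively (\<lambda>s u. w s u \<le> r) xs"
      using xs(5,1,2)
    proof (rule successively_sorted_mono)
      fix s u assume "s \<in> {c..<e}" "u \<in> {c..<e}" "s < u" "u - s < \<delta>"
      then show "w s u \<le> r" using d2(2)[of s u] bounds[of s u] \<delta> by auto
    qed
    note L1 = increments_L1[OF xs(1,2) \<kappa>(1) wr]
    show int: "integrable M (\<lambda>\<omega>. sq_variation X \<omega> xs)" by (rule L1)
    have "expectation (\<lambda>\<omega>. \<bar>sq_variation X \<omega> xs - J\<bar>) \<le>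
       expectation (\<lambda>\<omega>. \<bar>sq_variation X \<omega> xs - csum w xs\<bar> + \<bar>csum w xs - J\<bar>)"
      using int by (intro integral_mono integrable_abs Bochner_Integration.integrable_diff
        Bochner_Integration.integrable_add) auto
    also have "\<dots> = expectation (\<lambda>\<omega>. \<bar>sq_variation X \<omega> xs - csum w xs\<bar>) + \<bar>csum w xs - J\<bar>"
      using int by (simp add: prob_space)
    also have "\<dots> \<le> (\<kappa> + 2 * (\<bar>r\<bar> * C) / \<kappa> + \<kappa> * C + (1 + 1 / \<kappa>) * csum q xs) + \<epsilon> / 4"
      using L1(2) d3(2)[OF xs(1-4) g3] xs(6) \<delta> by (intro add_mono) auto
    also have "(1 + 1 / \<kappa>) * csum q xs \<le> (1 + 1 / \<kappa>) * t"
      using d1(2)[OF xs(1,2) g1] \<open>0 < 1 + 1 / \<kappa>\<close> by (intro mult_left_mono) auto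
    finally show "expectation (\<lambda>\<omega>. \<bar>sq_variation X \<omega> xs - J\<bar>) \<le> \<epsilon>"
      using \<kappa>(2) r2 t(2) by linarith
  qed (rule \<delta>)
qed

end

text \<open>\<open>has_quadratic_variation\<close> with partitions given as lists.\<close>

definition list_qv :: "'a measure \<Rightarrow> real \<Rightarrow> (real \<Rightarrow> 'a \<Rightarrow> real) \<Rightarrow> real \<Rightarrow> ('a \<Rightarrow> real) \<Rightarrow> bool" where
  "list_qv M c X t Q \<longleftrightarrow> Q \<in> borel_measurable M \<and>
     (\<forall>\<epsilon>>0. \<forall>\<eta>>0. \<exists>\<delta>>0. \<forall>xs. plist c t xs \<and> gaps_less \<delta> xs \<longrightarrow>
        tail_prob M (\<lambda>\<omega>. sq_variation X \<omega> xs - Q \<omega>) \<epsilon> < \<eta>)"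

lemma has_quadratic_variation_iff_list_qv: "has_quadratic_variation M c X t Q \<longleftrightarrow> list_qv M c X t Q"
proof -
  have "(\<forall>n p. partition_of c t n p \<and> mesh_less n p \<delta> \<longrightarrow>
        tail_prob M (\<lambda>\<omega>. (\<Sum>j<n. (X (p (Suc j)) \<omega> - X (p j) \<omega>)\<^sup>2) - Q \<omega>) \<epsilon> < \<eta>) \<longleftrightarrow>
     (\<forall>xs. plist c t xs \<and> gaps_less \<delta> xs \<longrightarrow>
        tail_prob M (\<lambda>\<omega>. sq_variation X \<omega> xs - Q \<omega>) \<epsilon> < \<eta>)" (is "?l = ?r") for \<epsilon> \<eta> \<delta>
  proof
    assume l: ?l
    show ?r
    proof (intro allI impI)
      fix xs assume "plist c t xs \<and> gaps_less \<delta> xs"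
      then have "partition_of c t (length xs - 1) ((!) xs) \<and> mesh_less (length xs - 1) ((!) xs) \<delta>"
        using plist_imp_partition_of gaps_less_imp_mesh_less by blast
      with l show "tail_prob M (\<lambda>\<omega>. sq_variation X \<omega> xs - Q \<omega>) \<epsilon> < \<eta>"
        unfolding csum_conv_sum by blast
    qed
  next
    assume r: ?r
    show ?l
    proof (intro allI impI)
      fix n p assume "partition_of c t n p \<and> mesh_less n p \<delta>"
      then have "plist c t (map p [0..<Suc n]) \<and> gaps_less \<delta> (map p [0..<Suc n])"
        using partition_of_imp_plist mesh_less_imp_gaps_less by blast
      with r have "tail_prob M (\<lambda>\<omega>. sq_variation X \<omega> (map p [0..<Suc n]) - Q \<omega>) \<epsilon> < \<eta>"
        by blast
      then show "tail_prob M (\<lambda>\<omega>. (\<Sum>j<n. (X (p (Suc j)) \<omega> - X (p j) \<omega>)\<^sup>2) - Q \<omega>) \<epsilon> < \<eta>"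
        unfolding csum_map_upt .
    qed
  qed
  then show ?thesis unfolding has_quadratic_variation_def list_qv_def by simp
qed

lemma csum_measurable:
  fixes \<nu> :: "real \<Rightarrow> real \<Rightarrow> 'a \<Rightarrow> real"
  assumes "\<And>s u. s \<in> set xs \<Longrightarrow> u \<in> set xs \<Longrightarrow> \<nu> s u \<in> borel_measurable M"
  shows "(\<lambda>\<omega>. csum (\<lambda>s u. \<nu> s u \<omega>) xs) \<in> borel_measurable M"
  using assms by (induction xs rule: induct_list012) auto

lemma (in prob_space) list_qv_unique:
  assumes "c \<le> t" and Xm: "\<And>s. s \<in> {c..t} \<Longrightarrow> X s \<in> borel_measurable M"
    and Q: "list_qv M c X t Q" and Q': "list_qv M c X t Q'"
  shows "AE \<omega> in M. Q \<omega> = Q' \<omega>"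
proof -
  have [measurable]: "Q \<in> borel_measurable M" "Q' \<in> borel_measurable M" using Q Q' unfolding list_qv_def by auto
  have zero: "tail_prob M (\<lambda>\<omega>. Q \<omega> - Q' \<omega>) \<epsilon> = 0" if "\<epsilon> > 0" for \<epsilon>
  proof -
    have e2: "\<epsilon> / 2 > 0" using that by simp
    have "tail_prob M (\<lambda>\<omega>. Q \<omega> - Q' \<omega>) \<epsilon> \<le> 0 + \<eta>" if "\<eta> > 0" for \<eta>
    proof -
      have h2: "\<eta> / 2 > 0" using that by simp
      obtain d where d: "d > 0" "\<And>xs. plist c t xs \<Longrightarrow> gaps_less d xs \<Longrightarrow>
        tail_prob M (\<lambda>\<omega>. sq_variation X \<omega> xs - Q \<omega>) (\<epsilon> / 2) < \<eta> / 2"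
        using Q e2 h2 unfolding list_qv_def by meson
      obtain d' where d': "d' > 0" "\<And>xs. plist c t xs \<Longrightarrow> gaps_less d' xs \<Longrightarrow>
        tail_prob M (\<lambda>\<omega>. sq_variation X \<omega> xs - Q' \<omega>) (\<epsilon> / 2) < \<eta> / 2"
        using Q' e2 h2 unfolding list_qv_def by meson
      have "\<exists>xs. plist c t xs \<and> gaps_less (min d d') xs"
      proof (cases "c = t")
        case True
        then show ?thesis by (intro exI[of _ "[c]"]) (auto simp: plist_def)
      next
        case False
        then show ?thesis using plist_exists[of c t "min d d'"] assms(1) d d' by auto
      qed
      then obtain xs where xs: "plist c t xs" "gaps_less (min d d') xs" by blast
      have g: "gaps_less d xs" "gaps_less d' xs" using xs(2) by (auto intro: successively_mono)
      have [measurable]: "(\<lambda>\<omega>. sq_variation X \<omega> xs) \<in> borel_measurable M"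
        using Xm plist_bounds[OF xs(1)] by (intro csum_measurable borel_measurable_power borel_measurable_diff) auto
      have "tail_prob M (\<lambda>\<omega>. Q \<omega> - Q' \<omega>) (\<epsilon> / 2 + \<epsilon> / 2) \<le>
        tail_prob M (\<lambda>\<omega>. sq_variation X \<omega> xs - Q \<omega>) (\<epsilon> / 2) + tail_prob M (\<lambda>\<omega>. sq_variation X \<omega> xs - Q' \<omega>) (\<epsilon> / 2)"
        by (intro tail_prob_add AE_I2; (linarith | measurable))
      then show ?thesis using d(2)[OF xs(1) g(1)] d'(2)[OF xs(1) g(2)] by simp
    qed
    then have "tail_prob M (\<lambda>\<omega>. Q \<omega> - Q' \<omega>) \<epsilon> \<le> 0" by (rule field_le_epsilon)
    then show ?thesis using measure_nonneg[of M] by (simp add: antisym)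
  qed
  have "AE \<omega> in M. \<forall>n. \<not> (\<bar>Q \<omega> - Q' \<omega>\<bar> > 1 / real (Suc n))"
    unfolding AE_all_countable
  proof
    fix n
    have "{\<omega> \<in> space M. \<bar>Q \<omega> - Q' \<omega>\<bar> > 1 / real (Suc n)} \<in> null_sets M"
      using zero[of "1 / real (Suc n)"] by (intro null_setsI) (auto simp: emeasure_eq_measure)
    then show "AE \<omega> in M. \<not> (\<bar>Q \<omega> - Q' \<omega>\<bar> > 1 / real (Suc n))"
      by (rule AE_I') auto
  qed
  then show ?thesis
  proof eventually_elim
    case (elim \<omega>)
    show ?case
    proof (rule ccontr)
      assume "Q \<omega> \<noteq> Q' \<omega>"
      then obtain n where "1 / real (Suc n) < \<bar>Q \<omega> - Q' \<omega>\<bar>" using nat_approx_posE[of "\<bar>Q \<omega> - Q' \<omega>\<bar>"] by auto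
      with elim show False by blast
    qed
  qed
qed

lemma (in prob_space) tendsto_at_left_in_prob:
  fixes Y :: "real \<Rightarrow> 'a \<Rightarrow> real" and c e :: real
  assumes Ym: "\<And>s. s \<in> {c..<e} \<Longrightarrow> Y s \<in> borel_measurable M" and Zm: "Z \<in> borel_measurable M"
    and ae: "AE \<omega> in M. ((\<lambda>s. Y s \<omega>) \<longlongrightarrow> Z \<omega>) (at_left e)"
    and "\<epsilon> > 0" "\<eta> > 0"
  shows "\<exists>\<delta>>0. \<forall>s\<in>{c..<e}. e - s < \<delta> \<longrightarrow> tail_prob M (\<lambda>\<omega>. Y s \<omega> - Z \<omega>) \<epsilon> < \<eta>"
proof (rule ccontr)
  assume neg: "\<not> ?thesis"
  have "\<exists>s\<in>{c..<e}. e - s < 1 / real (Suc n) \<and> \<eta> \<le> tail_prob M (\<lambda>\<omega>. Y s \<omega> - Z \<omega>) \<epsilon>" for n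
  proof -
    have "1 / real (Suc n) > 0" by simp
    with neg show ?thesis by (meson not_less)
  qed
  then obtain s where s: "\<And>n. s n \<in> {c..<e}" "\<And>n. e - s n < 1 / real (Suc n)"
    "\<And>n. \<eta> \<le> tail_prob M (\<lambda>\<omega>. Y (s n) \<omega> - Z \<omega>) \<epsilon>" by metis
  have [measurable]: "Y (s n) \<in> borel_measurable M" for n using Ym s(1) by blast
  note Zm[measurable]
  have "s \<longlonglongrightarrow> e"
  proof (rule LIMSEQ_I)
    fix r :: real assume "r > 0"
    then obtain n0 where n0: "1 / real (Suc n0) < r" using nat_approx_posE by blast
    have "norm (s n - e) < r" if "n \<ge> n0" for n
    proof -
      have "1 / real (Suc n) \<le> 1 / real (Suc n0)" using that by (intro divide_left_mono) auto
      then show ?thesis using s(1)[of n] s(2)[of n] n0 by auto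
    qed
    then show "\<exists>n0. \<forall>n\<ge>n0. norm (s n - e) < r" by blast
  qed
  then have fl: "filterlim s (at_left e) sequentially" using s(1) unfolding filterlim_at
    by (auto intro!: always_eventually simp: less_imp_neq)
  have "(\<lambda>n. tail_prob M (\<lambda>\<omega>. Y (s n) \<omega> - Z \<omega>) \<epsilon>) \<longlonglongrightarrow> 0"
  proof (rule measure_tendsto_0_AE)
    show "AE \<omega> in M. \<forall>\<^sub>F n in sequentially. \<omega> \<notin> {\<omega> \<in> space M. \<bar>Y (s n) \<omega> - Z \<omega>\<bar> > \<epsilon>}"
      using ae
    proof eventually_elim
      case (elim \<omega>)
      have "(\<lambda>n. Y (s n) \<omega>) \<longlonglongrightarrow> Z \<omega>" using filterlim_compose[OF elim fl] .
      from tendstoD[OF this \<open>\<epsilon> > 0\<close>] show ?case by eventually_elim (auto simp: dist_real_def)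
    qed
  qed measurable
  then have "\<eta> \<le> 0" by (rule LIMSEQ_le_const) (use s in auto)
  with \<open>\<eta> > 0\<close> show False by simp
qed

text \<open>The last point before \<open>e\<close> tends to \<open>e\<close> with the mesh. Thus the increments before it have squares adding
up to nearly \<open>J\<close>, and the last increment tends to the jump \<open>X e - Z\<close>.\<close>

lemma (in segment_bv) segment_qv:
  assumes Xe: "X e \<in> borel_measurable M" and Zm: "Z \<in> borel_measurable M"
    and ae: "AE \<omega> in M. ((\<lambda>s. X s \<omega>) \<longlongrightarrow> Z \<omega>) (at_left e)"
  shows "list_qv M c X e (\<lambda>\<omega>. J + (X e \<omega> - Z \<omega>)\<^sup>2)"
  unfolding list_qv_def
proof (intro conjI allI impI)
  note [measurable] = Xe Zm
  show "(\<lambda>\<omega>. J + (X e \<omega> - Z \<omega>)\<^sup>2) \<in> borel_measurable M" by measurable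
  fix \<epsilon> \<eta> :: real assume "\<epsilon> > 0" "\<eta> > 0"
  then have e2: "\<epsilon> / 2 > 0" and h2: "\<eta> / 2 > 0" and eh: "\<epsilon> * \<eta> / 8 > 0" by auto
  obtain d1 where d1: "d1 > 0" "\<And>xs. sorted_wrt (<) xs \<Longrightarrow> set xs \<subseteq> {c..<e} \<Longrightarrow> xs \<noteq> [] \<Longrightarrow> hd xs = c \<Longrightarrow> gaps_less d1 xs \<Longrightarrow>
    e - last xs < d1 \<Longrightarrow>
    integrable M (\<lambda>\<omega>. sq_variation X \<omega> xs) \<and>
    expectation (\<lambda>\<omega>. \<bar>sq_variation X \<omega> xs - J\<bar>) \<le> \<epsilon> * \<eta> / 8"
    using increments_tendsto_J[OF eh] by blast
  have Xm: "X s \<in> borel_measurable M" if "s \<in> {c..<e}" for s using XL[OF that] L_measurable by blast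
  have ae2: "AE \<omega> in M. ((\<lambda>s. (X e \<omega> - X s \<omega>)\<^sup>2) \<longlongrightarrow> (X e \<omega> - Z \<omega>)\<^sup>2) (at_left e)"
    using ae by eventually_elim (intro tendsto_intros)
  obtain d2 where d2: "d2 > 0" "\<And>s. s \<in> {c..<e} \<Longrightarrow> e - s < d2 \<Longrightarrow>
    tail_prob M (\<lambda>\<omega>. (X e \<omega> - X s \<omega>)\<^sup>2 - (X e \<omega> - Z \<omega>)\<^sup>2) (\<epsilon> / 2) < \<eta> / 2"
    using tendsto_at_left_in_prob[OF _ _ ae2 e2 h2, of c] Xm by auto
  show "\<exists>\<delta>>0. \<forall>xs. plist c e xs \<and> gaps_less \<delta> xs \<longrightarrow>
     tail_prob M (\<lambda>\<omega>. sq_variation X \<omega> xs - (J + (X e \<omega> - Z \<omega>)\<^sup>2)) \<epsilon> < \<eta>"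
  proof (rule exI[of _ "min d1 d2"], intro conjI allI impI)
    fix xs assume xs: "plist c e xs \<and> gaps_less (min d1 d2) xs"
    define ys where "ys = butlast xs"
    have xy: "xs = ys @ [e]" using xs append_butlast_last_id unfolding plist_def ys_def by metis
    have yne: "ys \<noteq> []" using xs c_less_e unfolding xy plist_def by (cases ys) auto
    have ys: "sorted_wrt (<) ys" "hd ys = c" "gaps_less (min d1 d2) ys" "e - last ys < min d1 d2"
      using xs yne unfolding xy plist_def by (auto simp: sorted_wrt_append successively_append_iff)
    have sub: "set ys \<subseteq> {c..<e}"
    proof
      fix s assume s: "s \<in> set ys"
      then have "c \<le> s" using plist_bounds(1)[of c e xs s] xs unfolding xy by auto
      moreover have "s < e" using xs s unfolding xy plist_def by (auto simp: sorted_wrt_append)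
      ultimately show "s \<in> {c..<e}" by simp
    qed
    have g1: "gaps_less d1 ys" using ys(3) by (auto intro: successively_mono)
    have ls: "last ys \<in> {c..<e}" using sub yne last_in_set by blast
    note R = d1(2)[OF ys(1) sub yne ys(2) g1]
    have int: "integrable M (\<lambda>\<omega>. sq_variation X \<omega> ys)"
      and ER: "expectation (\<lambda>\<omega>. \<bar>sq_variation X \<omega> ys - J\<bar>) \<le> \<epsilon> * \<eta> / 8"
      using R ys(4) by auto
    have [measurable]: "(\<lambda>\<omega>. sq_variation X \<omega> ys) \<in> borel_measurable M" using int by auto
    have [measurable]: "X (last ys) \<in> borel_measurable M" using Xm ls by blast
    have cs: "sq_variation X \<omega> xs = sq_variation X \<omega> ys + (X e \<omega> - X (last ys) \<omega>)\<^sup>2" for \<omega>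
      unfolding xy using csum_append[OF yne, of "[e]"] by simp
    have "tail_prob M (\<lambda>\<omega>. sq_variation X \<omega> ys - J) (\<epsilon> / 2) \<le>
       expectation (\<lambda>\<omega>. \<bar>sq_variation X \<omega> ys - J\<bar>) / (\<epsilon> / 2)"
      using int e2 by (intro tail_prob_le_mean) auto
    also have "\<dots> \<le> (\<epsilon> * \<eta> / 8) / (\<epsilon> / 2)" using ER e2 by (intro divide_right_mono) auto
    also have "\<dots> < \<eta> / 2" using \<open>\<epsilon> > 0\<close> \<open>\<eta> > 0\<close> by simp
    finally have P1: "tail_prob M (\<lambda>\<omega>. sq_variation X \<omega> ys - J) (\<epsilon> / 2) < \<eta> / 2" .
    have P2: "tail_prob M (\<lambda>\<omega>. (X e \<omega> - X (last ys) \<omega>)\<^sup>2 - (X e \<omega> - Z \<omega>)\<^sup>2) (\<epsilon> / 2) < \<eta> / 2"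
      using d2(2)[OF ls] ys(4) by simp
    have "tail_prob M (\<lambda>\<omega>. sq_variation X \<omega> xs - (J + (X e \<omega> - Z \<omega>)\<^sup>2)) (\<epsilon> / 2 + \<epsilon> / 2) \<le>
      tail_prob M (\<lambda>\<omega>. sq_variation X \<omega> ys - J) (\<epsilon> / 2) +
      tail_prob M (\<lambda>\<omega>. (X e \<omega> - X (last ys) \<omega>)\<^sup>2 - (X e \<omega> - Z \<omega>)\<^sup>2) (\<epsilon> / 2)"
      unfolding cs by (intro tail_prob_add AE_I2; (linarith | measurable))
    then show "tail_prob M (\<lambda>\<omega>. sq_variation X \<omega> xs - (J + (X e \<omega> - Z \<omega>)\<^sup>2)) \<epsilon> < \<eta>"
      using P1 P2 by simp
  qed (use d1 d2 in auto)
qed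

text \<open>A partition of \<open>[c, e]\<close> has an interval \<open>[s, u]\<close> with \<open>s < k \<le> u\<close>. Inserting \<open>k\<close> changes the sum of
squares by \<open>2 * (X k - X s) * (X u - X k)\<close>, which tends to 0 in mean because \<open>X\<close> is right continuous
in mean square at \<open>k\<close> and bounded in mean square.\<close>

lemma (in gaussian_space) list_qv_concat:
  assumes "c < k" "k < e" and XL: "\<And>s. s \<in> {c..<e} \<Longrightarrow> X s \<in> L" and Xe: "X e \<in> L"
    and var: "\<And>s. s \<in> {c..k} \<Longrightarrow> ip (X s) (X s) \<le> B"
    and rc: "\<And>\<epsilon>. \<epsilon> > 0 \<Longrightarrow> \<exists>\<delta>>0. \<forall>u. k < u \<longrightarrow> u < e \<longrightarrow> u - k < \<delta> \<longrightarrow>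
       ip (\<lambda>\<omega>. X u \<omega> - X k \<omega>) (\<lambda>\<omega>. X u \<omega> - X k \<omega>) \<le> \<epsilon>"
    and Q: "list_qv M c X k Q" and Q': "list_qv M k X e Q'"
  shows "list_qv M c X e (\<lambda>\<omega>. Q \<omega> + Q' \<omega>)"
  unfolding list_qv_def
proof (intro conjI allI impI)
  have [measurable]: "Q \<in> borel_measurable M" "Q' \<in> borel_measurable M" using Q Q' unfolding list_qv_def by auto
  show "(\<lambda>\<omega>. Q \<omega> + Q' \<omega>) \<in> borel_measurable M" by measurable
  have XL': "X s \<in> L" if "s \<in> {c..e}" for s using that XL[of s] Xe by (cases "s = e") auto
  have Xm: "X s \<in> borel_measurable M" if "s \<in> {c..e}" for s using XL'[OF that] L_measurable by blast
  fix \<epsilon> \<eta> :: real assume "\<epsilon> > 0" "\<eta> > 0"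
  then have e3: "\<epsilon> / 3 > 0" and h3: "\<eta> / 3 > 0" by auto
  obtain d1 where d1: "d1 > 0" "\<And>xs. plist c k xs \<Longrightarrow> gaps_less d1 xs \<Longrightarrow>
    tail_prob M (\<lambda>\<omega>. sq_variation X \<omega> xs - Q \<omega>) (\<epsilon> / 3) < \<eta> / 3"
    using Q e3 h3 unfolding list_qv_def by meson
  obtain d2 where d2: "d2 > 0" "\<And>xs. plist k e xs \<Longrightarrow> gaps_less d2 xs \<Longrightarrow>
    tail_prob M (\<lambda>\<omega>. sq_variation X \<omega> xs - Q' \<omega>) (\<epsilon> / 3) < \<eta> / 3"
    using Q' e3 h3 unfolding list_qv_def by meson
  define \<theta> where "\<theta> = \<epsilon> * \<eta> / 36"
  have \<theta>: "\<theta> > 0" unfolding \<theta>_def using \<open>\<epsilon> > 0\<close> \<open>\<eta> > 0\<close> by simp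
  have B0: "B \<ge> 0" using order_trans[OF ip_self_nonneg var[of c]] assms(1) by auto
  define \<kappa> where "\<kappa> = \<theta> / (4 * B + 1)"
  have \<kappa>: "\<kappa> > 0" "\<kappa> * (4 * B) \<le> \<theta>" unfolding \<kappa>_def using \<theta> B0 by (auto simp: field_simps)
  have "\<kappa> * \<theta> > 0" using \<kappa> \<theta> by simp
  from rc[OF this] obtain d3 where d3: "d3 > 0" "\<And>u. k < u \<Longrightarrow> u < e \<Longrightarrow> u - k < d3 \<Longrightarrow>
       ip (\<lambda>\<omega>. X u \<omega> - X k \<omega>) (\<lambda>\<omega>. X u \<omega> - X k \<omega>) \<le> \<kappa> * \<theta>" by blast
  define \<delta> where "\<delta> = min (min d1 d2) (min d3 (e - k))"
  have \<delta>: "\<delta> > 0" "\<delta> \<le> d1" "\<delta> \<le> d2" "\<delta> \<le> d3" "\<delta> \<le> e - k" unfolding \<delta>_def using d1 d2 d3 assms by auto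
  show "\<exists>\<delta>>0. \<forall>xs. plist c e xs \<and> gaps_less \<delta> xs \<longrightarrow>
     tail_prob M (\<lambda>\<omega>. sq_variation X \<omega> xs - (Q \<omega> + Q' \<omega>)) \<epsilon> < \<eta>"
  proof (rule exI[of _ \<delta>], intro conjI allI impI)
    fix xs assume "plist c e xs \<and> gaps_less \<delta> xs"
    then have pl: "plist c e xs" and gap: "gaps_less \<delta> xs" by auto
    then have xs: "sorted_wrt (<) xs" "xs \<noteq> []" "hd xs = c" "last xs = e" unfolding plist_def by auto
    define A D where "A = filter (\<lambda>s. s < k) xs" and "D = filter (\<lambda>s. k \<le> s) xs"
    have AD: "xs = A @ D" unfolding A_def D_def by (rule sorted_filter_split[OF xs(1)])
    have "c \<in> set A" unfolding A_def using xs(2,3) hd_in_set[of xs] assms by auto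
    then have Ane: "A \<noteq> []" by auto
    have "e \<in> set D" unfolding D_def using xs(2,4) last_in_set[of xs] assms by auto
    then have Dne: "D \<noteq> []" by auto
    have sA: "sorted_wrt (<) A" and sB: "sorted_wrt (<) D" unfolding A_def D_def using xs(1) by (auto intro: sorted_wrt_filter)
    define s u where "s = last A" and "u = hd D"
    have "s \<in> set A" "u \<in> set D" unfolding s_def u_def using Ane Dne by auto
    then have su: "s \<in> set xs" "s < k" "u \<in> set xs" "k \<le> u" unfolding A_def D_def by auto
    then have su': "s \<in> {c..k}" "u \<in> {c..e}" "s \<in> {c..e}" using plist_bounds[OF pl] by force+
    have kk: "k \<in> {c..e}" using assms by auto
    have gap': "u - s < \<delta>" "gaps_less \<delta> A" "gaps_less \<delta> D" using gap Ane Dne unfolding AD successively_append_iff s_def u_def by auto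
    have gA: "gaps_less d1 (A @ [k])"
    proof -
      have "gaps_less \<delta> (A @ [k])" using gap' su Ane by (auto simp: successively_append_iff s_def[symmetric])
      then show ?thesis using \<delta> by (auto intro: successively_mono)
    qed
    have pA: "plist c k (A @ [k])" unfolding plist_def using sA xs(3) Ane unfolding AD
      by (auto simp: sorted_wrt_append A_def)
    define D' where "D' = (if u = k then D else k # D)"
    have gB: "gaps_less d2 D'"
    proof -
      have "gaps_less \<delta> D'" using gap' su Dne unfolding D'_def u_def by (cases D) auto
      then show ?thesis using \<delta> by (auto intro: successively_mono)
    qed
    have pB: "plist k e D'"
    proof -
      have "k < z" if "u \<noteq> k" "z \<in> set D" for z
      proof -
        have "plist u e D" unfolding plist_def using sB Dne xs(4) AD by (auto simp: u_def)
        then have "u \<le> z" using plist_bounds that by blast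
        then show ?thesis using that su by simp
      qed
      then show ?thesis unfolding plist_def D'_def using sB Dne xs(4) AD by (auto simp: u_def)
    qed
    define T where "T \<omega> = 2 * ((X k \<omega> - X s \<omega>) * (X u \<omega> - X k \<omega>))" for \<omega>
    have cs: "sq_variation X \<omega> xs = sq_variation X \<omega> (A @ [k]) + sq_variation X \<omega> D' + T \<omega>" for \<omega>
    proof -
      have 1: "sq_variation X \<omega> xs = sq_variation X \<omega> A + (X u \<omega> - X s \<omega>)\<^sup>2 + sq_variation X \<omega> D"
        unfolding AD s_def u_def by (rule csum_append[OF Ane Dne])
      have 2: "sq_variation X \<omega> (A @ [k]) = sq_variation X \<omega> A + (X k \<omega> - X s \<omega>)\<^sup>2"
        using csum_append[OF Ane, of "[k]"] unfolding s_def by simp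
      have 3: "sq_variation X \<omega> D' = (X u \<omega> - X k \<omega>)\<^sup>2 + sq_variation X \<omega> D"
        unfolding D'_def u_def using Dne by (cases D) auto
      show ?thesis unfolding 1 2 3 T_def by (simp add: power2_eq_square algebra_simps)
    qed
    have XA: "X z \<in> borel_measurable M" if "z \<in> set (A @ [k])" for z
      using plist_bounds[OF pA that] assms(1,2) by (intro Xm) auto
    have XD: "X z \<in> borel_measurable M" if "z \<in> set D'" for z
      using plist_bounds[OF pB that] assms(1,2) by (intro Xm) auto
    have mA[measurable]: "(\<lambda>\<omega>. sq_variation X \<omega> (A @ [k])) \<in> borel_measurable M"
      by (rule csum_measurable, intro borel_measurable_power borel_measurable_diff XA)
    have mB[measurable]: "(\<lambda>\<omega>. sq_variation X \<omega> D') \<in> borel_measurable M"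
      by (rule csum_measurable, intro borel_measurable_power borel_measurable_diff XD)
    define U V where "U = (\<lambda>\<omega>. X k \<omega> - X s \<omega>)" and "V = (\<lambda>\<omega>. X u \<omega> - X k \<omega>)"
    have UL: "U \<in> L" and VL: "V \<in> L" unfolding U_def V_def using su' kk by (auto intro!: L_diff XL')
    have Tm[measurable]: "T \<in> borel_measurable M" unfolding T_def using Xm su' kk by measurable
    have UU: "ip U U \<le> 4 * B"
    proof -
      have sL: "X s \<in> L" "X k \<in> L" using XL' su' kk by auto
      have "0 \<le> ip (\<lambda>\<omega>. X k \<omega> + X s \<omega>) (\<lambda>\<omega>. X k \<omega> + X s \<omega>)" by (rule ip_self_nonneg)
      then have "ip U U \<le> 2 * ip (X k) (X k) + 2 * ip (X s) (X s)"
        unfolding U_def using sL by (simp add: ip_simps)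
      then show ?thesis using var[of k] var[of s] su' assms(1) by auto
    qed
    have VV: "ip V V \<le> \<kappa> * \<theta>"
    proof (cases "u = k")
      case True
      then show ?thesis unfolding V_def ip_def using \<open>\<kappa> * \<theta> > 0\<close> by simp
    next
      case False
      have "u - k < e - k" using gap'(1) su \<delta> by auto
      then show ?thesis unfolding V_def using False su gap'(1) \<delta> by (intro d3(2)) auto
    qed
    have Tb: "\<bar>T \<omega>\<bar> \<le> \<kappa> * (U \<omega>)\<^sup>2 + 1 / \<kappa> * (V \<omega>)\<^sup>2" for \<omega>
      using young[OF \<kappa>(1), of "U \<omega>" "V \<omega>"] unfolding T_def U_def V_def by simp
    have Tint: "integrable M T"
      unfolding T_def using L_integrable_prod2[OF UL VL] unfolding U_def V_def by simp
    have "expectation (\<lambda>\<omega>. \<bar>T \<omega>\<bar>) \<le> expectation (\<lambda>\<omega>. \<kappa> * (U \<omega>)\<^sup>2 + 1 / \<kappa> * (V \<omega>)\<^sup>2)"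
      using Tb Tint L_integrable_sq[OF UL] L_integrable_sq[OF VL]
      by (intro integral_mono Bochner_Integration.integrable_add integrable_mult_right integrable_abs) auto
    also have "\<dots> = \<kappa> * ip U U + 1 / \<kappa> * ip V V"
      using L_integrable_sq[OF UL] L_integrable_sq[OF VL] by (simp add: ip_self)
    also have "\<dots> \<le> \<theta> + 1 / \<kappa> * (\<kappa> * \<theta>)"
    proof (intro add_mono mult_left_mono VV)
      have "\<kappa> * ip U U \<le> \<kappa> * (4 * B)" using UU \<kappa> by (intro mult_left_mono) auto
      then show "\<kappa> * ip U U \<le> \<theta>" using \<kappa>(2) by linarith
    qed (use \<kappa> in auto)
    also have "\<dots> = 2 * \<theta>" using \<kappa> by simp
    finally have ET: "expectation (\<lambda>\<omega>. \<bar>T \<omega>\<bar>) \<le> 2 * \<theta>" .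
    have "tail_prob M T (\<epsilon> / 3) \<le> expectation (\<lambda>\<omega>. \<bar>T \<omega>\<bar>) / (\<epsilon> / 3)"
      using Tint e3 by (intro tail_prob_le_mean) auto
    also have "\<dots> \<le> 2 * \<theta> / (\<epsilon> / 3)" using ET e3 by (intro divide_right_mono) auto
    also have "\<dots> < \<eta> / 3" unfolding \<theta>_def using \<open>\<epsilon> > 0\<close> \<open>\<eta> > 0\<close> by simp
    finally have PT: "tail_prob M T (\<epsilon> / 3) < \<eta> / 3" .
    let ?U = "\<lambda>\<omega>. sq_variation X \<omega> (A @ [k]) - Q \<omega>" and ?V = "\<lambda>\<omega>. sq_variation X \<omega> D' - Q' \<omega>"
    have "tail_prob M (\<lambda>\<omega>. sq_variation X \<omega> xs - (Q \<omega> + Q' \<omega>)) ((\<epsilon> / 3 + \<epsilon> / 3) + \<epsilon> / 3) \<le>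
       tail_prob M (\<lambda>\<omega>. ?U \<omega> + ?V \<omega>) (\<epsilon> / 3 + \<epsilon> / 3) + tail_prob M T (\<epsilon> / 3)"
      unfolding cs by (intro tail_prob_add AE_I2; (linarith | measurable))
    moreover have "tail_prob M (\<lambda>\<omega>. ?U \<omega> + ?V \<omega>) (\<epsilon> / 3 + \<epsilon> / 3) \<le> tail_prob M ?U (\<epsilon> / 3) + tail_prob M ?V (\<epsilon> / 3)"
      by (intro tail_prob_add AE_I2 abs_triangle_ineq; measurable)
    ultimately show "tail_prob M (\<lambda>\<omega>. sq_variation X \<omega> xs - (Q \<omega> + Q' \<omega>)) \<epsilon> < \<eta>"
      using PT d1(2)[OF pA gA] d2(2)[OF pB gB] by simp
  qed (rule \<delta>)
qed

section \<open>Enumeration of the transition times\<close>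

context
  fixes a :: real and b :: ereal and S :: "real set"
  assumes ab: "ereal a < b" and S_sub: "S \<subseteq> {s. a < s \<and> ereal s < b}"
    and S_fin: "\<forall>s\<in>time_set a b. finite {u \<in> S. u < s}"
begin

lemma listing_Suc_cases:
  "(listing a b S (Suc n) = b \<and> (\<forall>u\<in>S. \<not> listing a b S n < ereal u)) \<or>
   (\<exists>s\<in>S. listing a b S (Suc n) = ereal s \<and> listing a b S n < ereal s \<and> (\<forall>u\<in>S. listing a b S n < ereal u \<longrightarrow> s \<le> u))"
proof -
  define A where "A = {s \<in> S. listing a b S n < ereal s}"
  have eq: "listing a b S (Suc n) = Inf (insert b (ereal ` A))" unfolding A_def by simp
  show ?thesis
  proof (cases "A = {}")
    case True
    then have "listing a b S (Suc n) = b" using eq by simp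
    then show ?thesis using True unfolding A_def by blast
  next
    case False
    then obtain s0 where s0: "s0 \<in> A" by blast
    define B where "B = {u \<in> A. u \<le> s0}"
    have "s0 \<in> time_set a b" using s0 S_sub unfolding A_def time_set_def by (auto simp: less_imp_le)
    then have "finite {u \<in> S. u < s0}" using S_fin by blast
    then have "finite (insert s0 {u \<in> S. u < s0})" by simp
    moreover have "B \<subseteq> insert s0 {u \<in> S. u < s0}" unfolding B_def A_def by auto
    ultimately have finB: "finite B" by (rule finite_subset[rotated])
    have s0B: "s0 \<in> B" unfolding B_def using s0 by simp
    define s where "s = Min B"
    have sB: "s \<in> B" unfolding s_def using finB s0B by (intro Min_in) auto
    have sA: "s \<in> A" using sB unfolding B_def by simp
    have le: "s \<le> u" if "u \<in> A" for u
    proof (cases "u \<le> s0")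
      case True
      then have "u \<in> B" using that unfolding B_def by simp
      then show ?thesis unfolding s_def using finB by (intro Min_le)
    next
      case False
      then show ?thesis using sB unfolding B_def by auto
    qed
    have "ereal s < b" using sA S_sub unfolding A_def by auto
    then have "Inf (insert b (ereal ` A)) = ereal s"
      using sA le by (intro antisym Inf_lower Inf_greatest) auto
    then show ?thesis using eq sA le unfolding A_def by auto
  qed
qed

lemma listing_le_b: "listing a b S n \<le> b"
  using listing_Suc_cases[of "n - 1"] ab S_sub by (cases n) (auto simp: less_imp_le)

lemma listing_step: "listing a b S n \<le> listing a b S (Suc n)"
  "listing a b S n < b \<Longrightarrow> listing a b S n < listing a b S (Suc n)"
  using listing_Suc_cases[of n] listing_le_b[of n] by (auto simp: less_imp_le simp del: listing.simps)

lemma listing_mono: "i \<le> j \<Longrightarrow> listing a b S i \<le> listing a b S j"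
  by (rule lift_Suc_mono_le[where f = "listing a b S"]) (rule listing_step(1))

lemma listing_strict_mono:
  assumes "i < j" "listing a b S i < b"
  shows "listing a b S i < listing a b S j"
proof -
  have "listing a b S i < listing a b S (Suc i)" by (rule listing_step(2)[OF assms(2)])
  also have "\<dots> \<le> listing a b S j" using assms(1) by (intro listing_mono) auto
  finally show ?thesis .
qed

lemma listing_ge_a: "ereal a \<le> listing a b S n"
  using listing_mono[of 0 n] by simp

lemma listing_real:
  assumes "listing a b S n < b"
  shows "\<exists>r\<in>time_set a b. listing a b S n = ereal r"
  using assms listing_ge_a[of n] unfolding time_set_def by (cases "listing a b S n") auto

lemma listing_in_S:
  assumes "listing a b S (Suc n) < b"
  shows "\<exists>s\<in>S. listing a b S (Suc n) = ereal s"
  using listing_Suc_cases[of n] assms by (auto simp del: listing.simps)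

lemma listing_gap: "u \<in> S \<Longrightarrow> listing a b S n < ereal u \<Longrightarrow> listing a b S (Suc n) \<le> ereal u"
  using listing_Suc_cases[of n] by (auto simp del: listing.simps)

lemma listing_finite_below:
  assumes t: "t \<in> time_set a b"
  shows "finite {i. listing a b S i < ereal t}"
proof -
  define h where "h i = real_of_ereal (listing a b S (Suc i))" for i
  define A where "A = {i. listing a b S (Suc i) < ereal t}"
  have tb: "ereal t < b" using t unfolding time_set_def by simp
  have hi: "listing a b S (Suc i) = ereal (h i)" "h i \<in> S" "h i < t" if "i \<in> A" for i
  proof -
    have "listing a b S (Suc i) < ereal t" using that unfolding A_def by simp
    moreover then obtain s where "s \<in> S" "listing a b S (Suc i) = ereal s"
      using listing_in_S[of i] tb less_trans by blast
    ultimately show "listing a b S (Suc i) = ereal (h i)" "h i \<in> S" "h i < t" unfolding h_def by (auto simp del: listing.simps)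
  qed
  have "inj_on h A"
  proof (rule linorder_inj_onI)
    fix i j assume "i < j" "i \<in> A" "j \<in> A"
    then have "listing a b S (Suc i) < listing a b S (Suc j)"
      using tb by (intro listing_strict_mono) (auto simp: A_def simp del: listing.simps intro: less_trans)
    then show "h i \<noteq> h j" using hi(1)[OF \<open>i \<in> A\<close>] hi(1)[OF \<open>j \<in> A\<close>] by (simp del: listing.simps)
  qed auto
  moreover have "h ` A \<subseteq> {u \<in> S. u < t}" using hi by auto
  then have "finite (h ` A)" using S_fin t finite_subset by blast
  ultimately have "finite A" by (metis finite_imageD)
  then have "finite (insert 0 (Suc ` A))" by simp
  moreover have "{i. listing a b S i < ereal t} \<subseteq> insert 0 (Suc ` A)"
  proof
    fix i assume "i \<in> {i. listing a b S i < ereal t}"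
    then show "i \<in> insert 0 (Suc ` A)" unfolding A_def by (cases i) (auto simp del: listing.simps)
  qed
  ultimately show ?thesis by (rule finite_subset[rotated])
qed

lemma last_index_listing:
  assumes t: "t \<in> time_set a b" and "a < t" and m: "m = last_index (listing a b S) t"
  shows "\<And>i. i \<le> m \<Longrightarrow> listing a b S i < ereal t" "ereal t \<le> listing a b S (Suc m)"
proof -
  have "listing a b S 0 < ereal t" using \<open>a < t\<close> by simp
  then have ex: "\<exists>i. listing a b S i < ereal t" by blast
  have m: "m = Max {i. listing a b S i < ereal t}" using m ex unfolding last_index_def by simp
  have "m \<in> {i. listing a b S i < ereal t}" unfolding m using ex listing_finite_below[OF t] by (intro Max_in) auto
  then show "\<And>i. i \<le> m \<Longrightarrow> listing a b S i < ereal t" using listing_mono le_less_trans by blast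
  show "ereal t \<le> listing a b S (Suc m)"
  proof (rule ccontr)
    assume "\<not> ?thesis"
    then have "Suc m \<in> {i. listing a b S i < ereal t}" by (simp del: listing.simps)
    then have "Suc m \<le> m" unfolding m using listing_finite_below[OF t] by (intro Max_ge)
    then show False by simp
  qed
qed

lemma listing_pieces_disjoint:
  assumes "s \<in> piece (listing a b S) i" "s \<in> piece (listing a b S) j"
  shows "i = j"
proof -
  have "\<not> i < j" if "s \<in> piece (listing a b S) i" "s \<in> piece (listing a b S) j" for i j
    using listing_mono[of "Suc i" j] that unfolding piece_def by (auto simp del: listing.simps)
  then show ?thesis using assms by (metis linorder_neqE_nat)
qed

lemma listing_covers:
  assumes s: "s \<in> time_set a b"
  shows "\<exists>k. s \<in> piece (listing a b S) k"
proof -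
  have sb: "ereal s < b" "a \<le> s" using s unfolding time_set_def by auto
  then obtain u where u: "ereal s < ereal u" "ereal u < b"
    using ereal_dense2[of "ereal s" b] by (auto simp: ereal_dense2)
  then have uI: "u \<in> time_set a b" "a < u" using sb unfolding time_set_def by auto
  define k where "k = Max {i. listing a b S i \<le> ereal s}"
  have fin: "finite {i. listing a b S i \<le> ereal s}"
    using listing_finite_below[OF uI(1)] by (rule finite_subset[rotated]) (use u(1) in \<open>auto intro: le_less_trans\<close>)
  have "k \<in> {i. listing a b S i \<le> ereal s}" unfolding k_def using fin sb(2) by (intro Max_in) (auto intro!: exI[of _ 0])
  moreover have "\<not> listing a b S (Suc k) \<le> ereal s"
  proof
    assume "listing a b S (Suc k) \<le> ereal s"
    then have "Suc k \<le> k" unfolding k_def using fin by (intro Max_ge) auto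
    then show False by simp
  qed
  ultimately show ?thesis unfolding piece_def by (intro exI[of _ k]) (auto simp del: listing.simps)
qed

end

text \<open>A point of the coarser set \<open>S\<close> strictly inside an interval of the finer partition would be a point of
\<open>T\<close> between two consecutive ones.\<close>

lemma listing_refines:
  assumes ab: "ereal a < b" and TS: "T \<subseteq> {s. a < s \<and> ereal s < b}" "\<forall>s\<in>time_set a b. finite {u \<in> T. u < s}"
    and sub: "S \<subseteq> T" and i: "listing a b T i < b"
  shows "\<exists>k. piece (listing a b T) i \<subseteq> piece (listing a b S) k"
proof -
  have SS: "S \<subseteq> {s. a < s \<and> ereal s < b}" "\<forall>s\<in>time_set a b. finite {u \<in> S. u < s}"
    using TS sub by (auto intro: finite_subset[of "{u \<in> S. u < _}" "{u \<in> T. u < _}"])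
  obtain r where r: "r \<in> time_set a b" "listing a b T i = ereal r" using listing_real[OF ab TS i] by blast
  obtain k where k: "r \<in> piece (listing a b S) k" using listing_covers[OF ab SS r(1)] by blast
  have "listing a b T (Suc i) \<le> listing a b S (Suc k)"
  proof (cases "listing a b S (Suc k) < b")
    case True
    then obtain s where s: "s \<in> S" "listing a b S (Suc k) = ereal s" using listing_in_S[OF ab SS] by blast
    then have "listing a b T i < ereal s" using k r unfolding piece_def by (simp del: listing.simps)
    then show ?thesis using listing_gap[OF ab TS, of s i] s sub by (auto simp del: listing.simps)
  next
    case False
    then show ?thesis using listing_le_b[OF ab TS, of "Suc i"] by (simp del: listing.simps)
  qed
  moreover have "listing a b S k \<le> listing a b T i" using k r unfolding piece_def by (simp del: listing.simps)
  ultimately have "piece (listing a b T) i \<subseteq> piece (listing a b S) k"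
    unfolding piece_def by (auto simp del: listing.simps intro: order_trans less_le_trans)
  then show ?thesis ..
qed

section \<open>Gauss-Markov semimartingales\<close>

definition linear_span :: "real set \<Rightarrow> (real \<Rightarrow> 'a \<Rightarrow> real) \<Rightarrow> ('a \<Rightarrow> real) set" where
  "linear_span I X = {\<lambda>\<omega>. \<Sum>s\<in>S. k s * X s \<omega> | S k. finite S \<and> S \<subseteq> I}"

lemma linear_span_base: "s \<in> I \<Longrightarrow> X s \<in> linear_span I X"
  unfolding linear_span_def by (intro CollectI exI[of _ "{s}"] exI[of _ "\<lambda>_. 1"]) auto

lemma gaussian_space_linear_span:
  assumes "prob_space M" "gaussian_process M I X" "centred M I X"
  shows "gaussian_space M (linear_span I X)"
proof -
  interpret prob_space M by fact
  show ?thesis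
  proof
    fix U V r assume "U \<in> linear_span I X" "V \<in> linear_span I X"
    then obtain S k S' k' where U: "U = (\<lambda>\<omega>. \<Sum>s\<in>S. k s * X s \<omega>)" "finite S" "S \<subseteq> I"
      and V: "V = (\<lambda>\<omega>. \<Sum>s\<in>S'. k' s * X s \<omega>)" "finite S'" "S' \<subseteq> I" unfolding linear_span_def by blast
    define l where "l s = (if s \<in> S then k s else 0) + (if s \<in> S' then k' s else 0)" for s
    have "(\<lambda>\<omega>. U \<omega> + V \<omega>) = (\<lambda>\<omega>. \<Sum>s\<in>S \<union> S'. l s * X s \<omega>)"
    proof
      fix \<omega>
      have 1: "U \<omega> = (\<Sum>s\<in>S \<union> S'. if s \<in> S then k s * X s \<omega> else 0)"
        unfolding U(1) using U V by (subst sum.inter_restrict[symmetric]) (auto intro: arg_cong2[where f = sum])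
      have 2: "V \<omega> = (\<Sum>s\<in>S \<union> S'. if s \<in> S' then k' s * X s \<omega> else 0)"
        unfolding V(1) using U V by (subst sum.inter_restrict[symmetric]) (auto intro: arg_cong2[where f = sum])
      show "U \<omega> + V \<omega> = (\<Sum>s\<in>S \<union> S'. l s * X s \<omega>)"
        unfolding 1 2 l_def sum.distrib[symmetric] by (intro sum.cong) (auto simp: algebra_simps)
    qed
    then show "(\<lambda>\<omega>. U \<omega> + V \<omega>) \<in> linear_span I X" unfolding linear_span_def using U V by blast
  next
    fix U r assume "U \<in> linear_span I X"
    then obtain S k where U: "U = (\<lambda>\<omega>. \<Sum>s\<in>S. k s * X s \<omega>)" "finite S" "S \<subseteq> I" unfolding linear_span_def by blast
    have "(\<lambda>\<omega>. r * U \<omega>) = (\<lambda>\<omega>. \<Sum>s\<in>S. (r * k s) * X s \<omega>)" unfolding U by (simp add: sum_distrib_left mult.assoc)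
    then show "(\<lambda>\<omega>. r * U \<omega>) \<in> linear_span I X" unfolding linear_span_def using U
      by (intro CollectI exI[of _ S] exI[of _ "\<lambda>s. r * k s"]) auto
  next
    show "(\<lambda>_. 0) \<in> linear_span I X" unfolding linear_span_def by (intro CollectI exI[of _ "{}"]) auto
  next
    fix U assume "U \<in> linear_span I X"
    then obtain S k where U: "U = (\<lambda>\<omega>. \<Sum>s\<in>S. k s * X s \<omega>)" "finite S" "S \<subseteq> I" unfolding linear_span_def by blast
    have g: "gaussian_rv M U" using assms(2) U unfolding gaussian_process_def by blast
    have i: "integrable M (X s)" "expectation (X s) = 0" if "s \<in> S" for s
      using assms(3) that U unfolding centred_def by auto
    have m: "expectation U = 0" unfolding U(1) using i by simp
    show "U \<in> borel_measurable M" using g unfolding gaussian_rv_def by auto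
    show "integrable M (\<lambda>\<omega>. U \<omega> ^ 4)" "expectation (\<lambda>\<omega>. U \<omega> ^ 4) = 3 * (expectation (\<lambda>\<omega>. (U \<omega>)\<^sup>2))\<^sup>2"
      by (rule gaussian_rv_moments[OF assms(1) g m])+
  qed
qed

text \<open>The function \<open>jump a X e\<close> may fail to be measurable on a null set. The limit \<open>Z\<close> along a fixed sequence
is measurable and agrees almost surely with the left limit.\<close>

lemma jump_version:
  assumes "prob_space M" and ce: "a \<le> c" "c < e" "e \<in> time_set a b"
    and Xm: "\<And>s. s \<in> {c..<e} \<Longrightarrow> X s \<in> borel_measurable M"
    and cl: "AE \<omega> in M. cadlag_path a b (\<lambda>t. X t \<omega>)"
  shows "\<exists>Z\<in>borel_measurable M. AE \<omega> in M. ((\<lambda>s. X s \<omega>) \<longlongrightarrow> Z \<omega>) (at_left e) \<and> jump a X e \<omega> = X e \<omega> - Z \<omega>"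
proof -
  define s where "s n = e - (e - c) / real (Suc n)" for n
  have s: "s n \<in> {c..<e}" for n
  proof -
    have "(e - c) / real (Suc n) \<le> (e - c) / 1" using ce by (intro divide_left_mono) auto
    moreover have "0 < (e - c) / real (Suc n)" using ce by simp
    ultimately show ?thesis unfolding s_def by simp
  qed
  define Z where "Z = (\<lambda>\<omega>. lim (\<lambda>n. X (s n) \<omega>))"
  have "(\<lambda>n. (e - c) / real (Suc n)) \<longlonglongrightarrow> 0" by (intro LIMSEQ_Suc[OF lim_const_over_n])
  then have "(\<lambda>n. e - (e - c) / real (Suc n)) \<longlonglongrightarrow> e - 0" by (intro tendsto_intros)
  then have "s \<longlonglongrightarrow> e" unfolding s_def by simp
  then have fl: "filterlim s (at_left e) sequentially" using s unfolding filterlim_at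
    by (auto intro!: always_eventually simp: less_imp_neq)
  have "Z \<in> borel_measurable M" unfolding Z_def using Xm s by (intro borel_measurable_lim_metric) auto
  moreover have "AE \<omega> in M. ((\<lambda>s. X s \<omega>) \<longlongrightarrow> Z \<omega>) (at_left e) \<and> jump a X e \<omega> = X e \<omega> - Z \<omega>"
    using cl
  proof eventually_elim
    case (elim \<omega>)
    then obtain l where l: "((\<lambda>s. X s \<omega>) \<longlongrightarrow> l) (at_left e)" using ce unfolding cadlag_path_def by force
    have "(\<lambda>n. X (s n) \<omega>) \<longlonglongrightarrow> l" using filterlim_compose[OF l fl] .
    then have "Z \<omega> = l" unfolding Z_def by (rule limI)
    moreover have "Lim (at_left e) (\<lambda>s. X s \<omega>) = l" by (rule tendsto_Lim[OF _ l]) simp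
    ultimately show ?case using l ce unfolding jump_def by simp
  qed
  ultimately show ?thesis by blast
qed

lemma (in segment_bv) segment_qv_RS:
  assumes Xe: "X e \<in> borel_measurable M" and Zm: "Z \<in> borel_measurable M"
    and ae: "AE \<omega> in M. ((\<lambda>s. X s \<omega>) \<longlongrightarrow> Z \<omega>) (at_left e)"
  shows "list_qv M c X e (\<lambda>\<omega>. RS_integral_left c e (\<lambda>s. (g s)\<^sup>2) (\<lambda>s. f s / g s) + (X e \<omega> - Z \<omega>)\<^sup>2)"
proof -
  have "RS_integral_left c e (\<lambda>s. (g s)\<^sup>2) (\<lambda>s. f s / g s) = J"
    unfolding RS_integral_left_def using c_less_e tendsto_Lim[OF _ I_tendsto_J] unfolding I_def by simp
  then show ?thesis using segment_qv[OF assms] by simp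
qed

lemma (in gaussian_space) semimartingale_second_moment_bounded:
  assumes sm: "semimartingale M \<F> a b X" and t: "t \<in> time_set a b" and XL: "\<And>s. s \<in> {a..t} \<Longrightarrow> X s \<in> L"
  shows "\<exists>B. \<forall>s\<in>{a..t}. ip (X s) (X s) \<le> B"
proof -
  have "bdd_in_prob M (X ` {a..t})"
  proof (rule bdd_in_prob_AE)
    show "Y \<in> borel_measurable M" if "Y \<in> X ` {a..t}" for Y using that XL L_measurable by blast
    have "AE \<omega> in M. cadlag_path a b (\<lambda>t. X t \<omega>)" using sm unfolding semimartingale_def by auto
    then show "AE \<omega> in M. \<exists>B. \<forall>Y\<in>X ` {a..t}. \<bar>Y \<omega>\<bar> \<le> B"
    proof eventually_elim
      case (elim \<omega>)
      from cadlag_path_bounded[OF this t] show ?case by auto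
    qed
  qed
  then show ?thesis using bdd_in_prob_second_moment[of "X ` {a..t}"] XL by blast
qed

lemma (in segment) segment_bv_of_semimartingale:
  assumes sm: "semimartingale M \<F> a b X" and e: "e \<in> time_set a b" "a \<le> c" and XL: "\<And>s. s \<in> {a..e} \<Longrightarrow> X s \<in> L"
    and dich: "(\<forall>s\<in>{c<..<e}. f s * g s \<noteq> 0) \<or> (\<forall>s\<in>{c<..<e}. f s * g s = 0)"
  shows "\<exists>C. segment_bv M L X c e f g C"
proof -
  have sub: "{c..<e} \<subseteq> {a..e}" using e by auto
  obtain C1 where C1: "\<And>n p. ascending {c..<e} n p \<Longrightarrow> (\<Sum>j<n. d (p j) (p (Suc j))) \<le> C1"
    using sum_d_bounded[OF semimartingale_sign_transforms[OF sm e(1)] sub] by blast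
  obtain B where B: "\<And>s. s \<in> {a..e} \<Longrightarrow> ip (X s) (X s) \<le> B"
    using semimartingale_second_moment_bounded[OF sm e(1) XL] by blast
  obtain C2 where C2: "\<And>n p. ascending {c..<e} n p \<Longrightarrow> (\<Sum>j<n. \<beta> (p j) (p (Suc j))) \<le> C2"
    using sum_\<beta>_bounded[OF semimartingale_self_transforms[OF sm e(1)] sub B C1] sub by blast
  have "csum (\<lambda>s u. d s u + \<beta> s u) xs \<le> \<bar>C1\<bar> + \<bar>C2\<bar>" if xs: "sorted_wrt (<) xs" "set xs \<subseteq> {c..<e}" for xs
  proof (cases "xs = []")
    case False
    have asc: "ascending {c..<e} (length xs - 1) ((!) xs)" unfolding ascending_def
    proof (intro conjI allI impI)
      fix j assume "j \<le> length xs - 1"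
      then have "xs ! j \<in> set xs" using False by (intro nth_mem) (cases xs, auto)
      then show "xs ! j \<in> {c..<e}" using xs(2) by blast
    next
      fix j assume "j < length xs - 1"
      then show "xs ! j < xs ! Suc j" using xs(1) by (simp add: sorted_wrt_iff_nth_less)
    qed
    show ?thesis unfolding csum_conv_sum sum.distrib using C1[OF asc] C2[OF asc] by linarith
  qed simp
  then have "segment_bv M L X c e f g (\<bar>C1\<bar> + \<bar>C2\<bar>)" using dich by unfold_locales auto
  then show ?thesis ..
qed

lemma (in prob_space) list_qv_trivial: "list_qv M a X a (\<lambda>_. 0)"
  unfolding list_qv_def
proof (intro conjI allI impI)
  fix \<epsilon> \<eta> :: real assume "\<epsilon> > 0" "\<eta> > 0"
  have "csum \<nu> xs = (0::real)" if "plist a a xs" for xs \<nu>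
  proof (cases xs)
    case (Cons x ys)
    then have "ys = []" using that last_in_set[of ys] unfolding plist_def by (cases "ys = []") force+
    then show ?thesis using Cons by simp
  qed simp
  then show "\<exists>\<delta>>0. \<forall>xs. plist a a xs \<and> gaps_less \<delta> xs \<longrightarrow>
    tail_prob M (\<lambda>\<omega>. sq_variation X \<omega> xs - 0) \<epsilon> < \<eta>"
    using \<open>\<epsilon> > 0\<close> \<open>\<eta> > 0\<close> by (intro exI[of _ 1]) auto
qed simp

lemma covariance_piece:
  assumes cf: "covariance_factors M a b X F G" and su: "s \<in> time_set a b" "u \<in> time_set a b" "s \<le> u"
    and ab: "ereal a < b" and S: "independence_partition M a b X \<subseteq> {s. a < s \<and> ereal s < b}"
      "\<forall>s\<in>time_set a b. finite {u \<in> independence_partition M a b X. u < s}"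
    and k: "s \<in> piece (iota M a b X) k" "u \<in> piece (iota M a b X) k"
  shows "cov_fun M X s u = F k s * G k u"
proof -
  let ?h = "\<lambda>i. F i (min s u) * G i (max s u) *
                indicator (piece (iota M a b X) i) s * indicator (piece (iota M a b X) i) u :: real"
  have "cov_fun M X s u = (\<Sum>i. ?h i)" using cf su unfolding covariance_factors_def by blast
  also have "\<dots> = (\<Sum>i\<in>{k}. ?h i)"
  proof (rule suminf_finite)
    fix i assume "i \<notin> {k}"
    then have "s \<notin> piece (iota M a b X) i" using listing_pieces_disjoint[OF ab S k(1)] by auto
    then show "?h i = 0" by simp
  qed simp
  also have "\<dots> = F k s * G k u" using su(3) k by (simp add: min_def max_def)
  finally show ?thesis .
qed

lemma independence_partition_subset: "independence_partition M a b X \<subseteq> {s. a < s \<and> ereal s < b}"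
  unfolding independence_partition_def by auto

lemma transition_times_facts:
  assumes ab: "ereal a < b" and fin: "\<forall>s\<in>time_set a b. finite {u \<in> transition_times M a b X F G. u < s}"
  shows "independence_partition M a b X \<subseteq> transition_times M a b X F G"
    "\<forall>s\<in>time_set a b. finite {u \<in> independence_partition M a b X. u < s}"
    "transition_times M a b X F G \<subseteq> {s. a < s \<and> ereal s < b}"
proof -
  define T S where "T = transition_times M a b X F G" and "S = independence_partition M a b X"
  show ST: "S \<subseteq> T" unfolding S_def T_def transition_times_def by simp
  have Ssub: "S \<subseteq> {s. a < s \<and> ereal s < b}" unfolding S_def by (rule independence_partition_subset)
  show Sfin: "\<forall>s\<in>time_set a b. finite {u \<in> S. u < s}"
    using fin ST unfolding T_def by (auto intro: finite_subset[of "{u \<in> S. u < _}" "{u \<in> transition_times M a b X F G. u < _}"])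
  note SS = ab Ssub Sfin
  show "T \<subseteq> {s. a < s \<and> ereal s < b}"
  proof
    fix s assume "s \<in> T"
    then consider "s \<in> S" | i where "listing a b S i < ereal s" "ereal s < listing a b S (Suc i)"
      unfolding T_def S_def transition_times_def discontinuity_times_def by blast
    then show "s \<in> {s. a < s \<and> ereal s < b}"
    proof cases
      case 1
      then show ?thesis using Ssub by blast
    next
      case (2 i)
      have "ereal a < ereal s" using listing_ge_a[OF SS] 2(1) by (rule le_less_trans)
      moreover have "ereal s < b" using 2(2) listing_le_b[OF SS] by (rule less_le_trans)
      ultimately show ?thesis by simp
    qed
  qed
qed

text \<open>
No transition time lies strictly between \<open>\<tau> i\<close> and \<open>\<tau> (Suc i)\<close>. So the interval is contained in one piece
of the independence partition, where only one product of factors contributes to the covariance, and it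
contains no boundary point of the zero set of the variance, which by connectedness then either covers
\<open>(c, e)\<close> or misses it.
\<close>

lemma (in gaussian_space) continuity_interval:
  fixes c e :: real and i :: nat
  assumes ab: "ereal a < b" and cen: "centred M (time_set a b) X" and sm: "semimartingale M \<F> a b X"
    and cf: "covariance_factors M a b X F G"
    and fin: "\<forall>s\<in>time_set a b. finite {u \<in> transition_times M a b X F G. u < s}"
    and XL: "\<And>s. s \<in> time_set a b \<Longrightarrow> X s \<in> L"
  defines "\<tau> \<equiv> listing a b (transition_times M a b X F G)"
  assumes cdF: "continuous_decomposition (iota M a b X) \<tau> F f"
    and cdG: "continuous_decomposition (iota M a b X) \<tau> G g"
    and c: "\<tau> i = ereal c" and "c < e" and e: "ereal e \<le> \<tau> (Suc i)" and eI: "e \<in> time_set a b"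
  shows "\<exists>C. segment_bv M L X c e (f i) (g i) C"
proof -
  define T S where "T = transition_times M a b X F G" and "S = independence_partition M a b X"
  have \<tau>: "\<tau> = listing a b T" unfolding \<tau>_def T_def ..
  note facts = transition_times_facts[OF ab fin, folded T_def S_def]
  have Ssub: "S \<subseteq> {s. a < s \<and> ereal s < b}" unfolding S_def by (rule independence_partition_subset)
  note ST = facts(1) and Sfin = facts(2) and TT = ab facts(3) fin[folded T_def]
  have "a \<le> c" using listing_ge_a[OF TT, of i] c unfolding \<tau> by simp
  have "ereal c < ereal e" "ereal e < b" using \<open>c < e\<close> eI unfolding time_set_def by auto
  then have ib: "listing a b T i < b" using c unfolding \<tau> by (metis less_trans)
  obtain k where k: "piece \<tau> i \<subseteq> piece (iota M a b X) k"
    using listing_refines[OF TT ST ib] unfolding \<tau> S_def by blast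
  have sub: "{c..<e} \<subseteq> piece \<tau> i"
  proof
    fix s assume "s \<in> {c..<e}"
    then have "ereal c \<le> ereal s" "ereal s < ereal e" by auto
    moreover have "ereal s < \<tau> (Suc i)" using \<open>ereal s < ereal e\<close> e by (rule less_le_trans)
    ultimately show "s \<in> piece \<tau> i" unfolding piece_def using c by simp
  qed
  have subp: "s \<in> piece (iota M a b X) k" if "s \<in> {c..<e}" for s using that sub k by blast
  have ne: "piece \<tau> i \<noteq> {}" using sub \<open>c < e\<close> by auto
  have fc: "continuous_on {c..<e} (f i)" and fF: "\<And>s. s \<in> {c..<e} \<Longrightarrow> f i s = F k s"
    using cdF ne k sub unfolding continuous_decomposition_def by (blast intro: continuous_on_subset)+
  have gc: "continuous_on {c..<e} (g i)" and gG: "\<And>s. s \<in> {c..<e} \<Longrightarrow> g i s = G k s"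
    using cdG ne k sub unfolding continuous_decomposition_def by (blast intro: continuous_on_subset)+
  have inI: "s \<in> time_set a b" if "s \<in> {c..<e}" for s
    using that \<open>a \<le> c\<close> by (intro time_set_mono[OF eI]) auto
  have ipc: "cov_fun M X s u = ip (X s) (X u)" if "s \<in> time_set a b" "u \<in> time_set a b" for s u
    using cen that unfolding cov_fun_def ip_def centred_def by simp
  have cov: "ip (X s) (X u) = f i s * g i u" if "c \<le> s" "s \<le> u" "u < e" for s u
  proof -
    have su: "s \<in> {c..<e}" "u \<in> {c..<e}" using that by auto
    have "cov_fun M X s u = F k s * G k u"
      using covariance_piece[OF cf inI[OF su(1)] inI[OF su(2)] that(2) ab] Ssub Sfin k sub su unfolding S_def by blast
    then show ?thesis using ipc[OF inI[OF su(1)] inI[OF su(2)]] fF[OF su(1)] gG[OF su(2)] by simp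
  qed
  have Fk: "\<And>s. s \<in> piece (iota M a b X) k \<Longrightarrow> 0 \<le> F k s / G k s" "mono_on (piece (iota M a b X) k) (\<lambda>s. F k s / G k s)"
    using cf unfolding covariance_factors_def by blast+
  have seg: "segment M L X c e (f i) (g i)"
  proof unfold_locales
    show "c < e" by fact
    show "X s \<in> L" if "s \<in> {c..<e}" for s using XL inI that by blast
    show "ip (X s) (X u) = f i s * g i u" if "c \<le> s" "s \<le> u" "u < e" for s u using cov that by blast
    show "0 \<le> f i s / g i s" if "s \<in> {c..<e}" for s
      using Fk(1)[OF subp[OF that]] fF[OF that] gG[OF that] by simp
    show "mono_on {c..<e} (\<lambda>s. f i s / g i s)"
    proof (rule mono_onI)
      fix r s assume rs: "r \<in> {c..<e}" "s \<in> {c..<e}" "r \<le> s"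
      show "f i r / g i r \<le> f i s / g i s"
        using mono_onD[OF Fk(2) subp[OF rs(1)] subp[OF rs(2)] rs(3)] fF[OF rs(1)] gG[OF rs(1)] fF[OF rs(2)] gG[OF rs(2)]
        by simp
    qed
  qed (rule fc gc)+
  define Z where "Z = {t \<in> time_set a b. variance (X t) = 0}"
  have varX: "variance (X s) = f i s * g i s" if "s \<in> {c<..<e}" for s
  proof -
    have "s \<in> time_set a b" using inI that by auto
    then have "variance (X s) = ip (X s) (X s)" using cen unfolding centred_def by (simp add: ip_self)
    then show ?thesis using cov[of s s] that by simp
  qed
  \<comment> \<open>A boundary point of the zero set of the variance would be a transition time inside the interval.\<close>
  have noS: "{c<..<e} \<inter> frontier Z = {}"
  proof (rule ccontr)
    assume "{c<..<e} \<inter> frontier Z \<noteq> {}"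
    then obtain s where s: "s \<in> {c<..<e}" "s \<in> frontier Z" by blast
    have "s \<in> time_set a b" using inI s by auto
    then have "s \<in> S" using s \<open>a \<le> c\<close> unfolding S_def independence_partition_def Z_def time_set_def by auto
    then have "s \<in> T" using ST by blast
    have "ereal c < ereal s" using s by simp
    then have "\<tau> i < ereal s" using c by simp
    then have "\<tau> (Suc i) \<le> ereal s" using listing_gap[OF TT \<open>s \<in> T\<close>] unfolding \<tau> by blast
    then have "ereal e \<le> ereal s" using e order_trans by blast
    then show False using s by simp
  qed
  have dich: "(\<forall>s\<in>{c<..<e}. f i s * g i s \<noteq> 0) \<or> (\<forall>s\<in>{c<..<e}. f i s * g i s = 0)"
  proof -
    have "{c<..<e} \<inter> Z = {} \<or> {c<..<e} - Z = {}"
      using connected_Int_frontier[of "{c<..<e}" Z] noS by auto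
    then show ?thesis
    proof
      assume "{c<..<e} \<inter> Z = {}"
      then have "\<forall>s\<in>{c<..<e}. variance (X s) \<noteq> 0" using inI unfolding Z_def by fastforce
      then show ?thesis using varX by simp
    next
      assume "{c<..<e} - Z = {}"
      then have "\<forall>s\<in>{c<..<e}. variance (X s) = 0" unfolding Z_def by blast
      then show ?thesis using varX by simp
    qed
  qed
  show ?thesis
    using \<open>a \<le> c\<close> by (intro segment.segment_bv_of_semimartingale[OF seg sm eI _ _ dich] XL time_set_mono[OF eI]) auto
qed

theorem theorem2p1:
  fixes M :: "'a measure" and \<F> :: "ereal \<Rightarrow> 'a measure"
    and X :: "real \<Rightarrow> 'a \<Rightarrow> real"
    and a t :: real and b :: ereal
    and F G f g :: "nat \<Rightarrow> real \<Rightarrow> real"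
    and \<tau> :: "nat \<Rightarrow> ereal" and m :: nat
  assumes "prob_space M"
    and "ereal a < b"
    and "gaussian_process M (time_set a b) X"
    and "markov_process M (time_set a b) X"
    and "centred M (time_set a b) X"
    and "semimartingale M \<F> a b X"
    and "covariance_factors M a b X F G"
    and "\<forall>s\<in>time_set a b. finite {u \<in> transition_times M a b X F G. u < s}"
    and "\<tau> = listing a b (transition_times M a b X F G)"
    and "continuous_decomposition (iota M a b X) \<tau> F f"
    and "continuous_decomposition (iota M a b X) \<tau> G g"
    and "t \<in> time_set a b"
    and "m = last_index \<tau> t"
  shows "(\<exists>Q. has_quadratic_variation M a X t Q) \<and>
    (\<forall>Q. has_quadratic_variation M a X t Q \<longrightarrow>
      (AE \<omega> in M. Q \<omega> =
         RS_integral_left (real_of_ereal (\<tau> m)) t (\<lambda>s. (g m s)\<^sup>2) (\<lambda>s. f m s / g m s)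
         + (jump a X t \<omega>)\<^sup>2
         + (\<Sum>i<m.
              RS_integral_left (real_of_ereal (\<tau> i)) (real_of_ereal (\<tau> (Suc i)))
                (\<lambda>s. (g i s)\<^sup>2) (\<lambda>s. f i s / g i s)
              + (jump a X (real_of_ereal (\<tau> (Suc i))) \<omega>)\<^sup>2)))"
proof -
  define T where "T = transition_times M a b X F G"
  note prob = assms(1) and ab = assms(2)
  have fin: "\<forall>s\<in>time_set a b. finite {u \<in> T. u < s}" and \<tau>: "\<tau> = listing a b T"
    and t: "t \<in> time_set a b" and m: "m = last_index (listing a b T) t"
    using assms unfolding T_def by auto
  interpret prob_space M by (rule prob)
  let ?L = "linear_span (time_set a b) X"
  interpret gaussian_space M ?L by (rule gaussian_space_linear_span[OF prob assms(3,5)])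
  have XL: "X s \<in> ?L" if "s \<in> time_set a b" for s using linear_span_base[OF that] .
  have Xm: "X s \<in> borel_measurable M" if "s \<in> time_set a b" for s using L_measurable[OF XL[OF that]] .
  have at: "a \<le> t" "ereal t < b" using t unfolding time_set_def by auto
  have tI: "s \<in> time_set a b" if "s \<in> {a..t}" for s by (rule time_set_mono[OF t that])
  have cl: "AE \<omega> in M. cadlag_path a b (\<lambda>t. X t \<omega>)" using assms(6) unfolding semimartingale_def by auto
  let ?R = "\<lambda>i e. RS_integral_left (real_of_ereal (\<tau> i)) e (\<lambda>s. (g i s)\<^sup>2) (\<lambda>s. f i s / g i s)"
  let ?Q = "\<lambda>\<omega>. ?R m t + (jump a X t \<omega>)\<^sup>2
         + (\<Sum>i<m. ?R i (real_of_ereal (\<tau> (Suc i))) + (jump a X (real_of_ereal (\<tau> (Suc i))) \<omega>)\<^sup>2)"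
  have Tsub: "T \<subseteq> {s. a < s \<and> ereal s < b}"
    unfolding T_def by (rule transition_times_facts(3)[OF ab assms(8)])
  note TT = ab Tsub fin
  have main: "\<exists>Q. list_qv M a X t Q \<and> (AE \<omega> in M. Q \<omega> = ?Q \<omega>)"
  proof (cases "a = t")
    case True
    have "\<not> (\<exists>i. listing a b T i < ereal t)"
    proof
      assume "\<exists>i. listing a b T i < ereal t"
      then obtain i where "listing a b T i < ereal a" using True by auto
      moreover have "ereal a \<le> listing a b T i" by (rule listing_ge_a[OF TT])
      ultimately show False by simp
    qed
    then have "m = 0" using m unfolding last_index_def by simp
    then have "?Q \<omega> = 0" for \<omega> using True unfolding \<tau> RS_integral_left_def jump_def by simp
    then show ?thesis using list_qv_trivial True by (intro exI[of _ "\<lambda>_. 0"]) auto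
  next
    case False
    then have "a < t" using at by simp
    have below: "\<tau> i < ereal t" if "i \<le> m" for i using last_index_listing(1)[OF TT t \<open>a < t\<close> m that] unfolding \<tau> .
    have above: "ereal t \<le> \<tau> (Suc m)" using last_index_listing(2)[OF TT t \<open>a < t\<close> m] unfolding \<tau> .
    \<comment> \<open>The end points of the intervals: \<open>\<tau> 0, \<dots>, \<tau> m\<close> and then \<open>t\<close>, which lies in the piece of \<open>\<tau> m\<close> or at its end.\<close>
    define E where "E i = (if i \<le> m then real_of_ereal (\<tau> i) else t)" for i
    have Et: "ereal (E i) = \<tau> i" "a \<le> E i" "E i < t" if "i \<le> m" for i
    proof -
      have "\<tau> i < b" using below[OF that] at(2) by (rule less_trans)
      then obtain r where "r \<in> time_set a b" "\<tau> i = ereal r" using listing_real[OF TT] unfolding \<tau> by blast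
      then show "ereal (E i) = \<tau> i" "a \<le> E i" "E i < t" using that below[OF that] unfolding E_def time_set_def by auto
    qed
    have Em: "E (Suc m) = t" unfolding E_def by simp
    have E0: "E 0 = a" unfolding E_def \<tau> by simp
    have ESuc: "E i < E (Suc i)" "ereal (E (Suc i)) \<le> \<tau> (Suc i)" "E (Suc i) \<in> {a..t}" if "i \<le> m" for i
    proof -
      have "\<tau> i < b" using below[OF that] at(2) by (rule less_trans)
      then have st: "\<tau> i < \<tau> (Suc i)" unfolding \<tau> by (rule listing_step(2)[OF TT])
      show "ereal (E (Suc i)) \<le> \<tau> (Suc i)" using Et(1)[of "Suc i"] above that Em by (cases "i = m") auto
      show "E i < E (Suc i)"
      proof (cases "i = m")
        case True
        then show ?thesis using Et(3)[of m] Em by simp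
      next
        case False
        then have "ereal (E i) < ereal (E (Suc i))" using st Et(1)[of i] Et(1)[of "Suc i"] that by simp
        then show ?thesis by simp
      qed
      show "E (Suc i) \<in> {a..t}" using Et[of "Suc i"] that Em at by (cases "i = m") (auto simp: less_imp_le)
    qed
    have seg: "\<exists>C. segment_bv M ?L X (E i) (E (Suc i)) (f i) (g i) C" if i: "i \<le> m" for i
      using Et(1)[OF i] ESuc[OF i] tI assms(10,11) XL
      by (intro continuity_interval[OF ab assms(5,6,7,8)]) (auto simp: \<tau> T_def)
    define left_limit where "left_limit i Z \<longleftrightarrow> Z \<in> borel_measurable M \<and>
      (AE \<omega> in M. ((\<lambda>s. X s \<omega>) \<longlongrightarrow> Z \<omega>) (at_left (E (Suc i))) \<and> jump a X (E (Suc i)) \<omega> = X (E (Suc i)) \<omega> - Z \<omega>)"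
      for i Z
    have "\<exists>Z. left_limit i Z" if i: "i \<le> m" for i
    proof -
      have "\<exists>Z\<in>borel_measurable M. AE \<omega> in M. ((\<lambda>s. X s \<omega>) \<longlongrightarrow> Z \<omega>) (at_left (E (Suc i))) \<and>
        jump a X (E (Suc i)) \<omega> = X (E (Suc i)) \<omega> - Z \<omega>"
      proof (rule jump_version[OF prob Et(2)[OF i] ESuc(1)[OF i] _ _ cl])
        show "E (Suc i) \<in> time_set a b" using tI ESuc(3)[OF i] .
        show "X s \<in> borel_measurable M" if "s \<in> {E i..<E (Suc i)}" for s
          using that Et(2)[OF i] ESuc(3)[OF i] by (intro Xm tI) auto
      qed
      then show ?thesis unfolding left_limit_def by blast
    qed
    then obtain Z where "\<And>i. i \<le> m \<Longrightarrow> left_limit i (Z i)" by metis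
    then have Z: "Z i \<in> borel_measurable M"
      "AE \<omega> in M. ((\<lambda>s. X s \<omega>) \<longlongrightarrow> Z i \<omega>) (at_left (E (Suc i))) \<and> jump a X (E (Suc i)) \<omega> = X (E (Suc i)) \<omega> - Z i \<omega>"
      if "i \<le> m" for i using that unfolding left_limit_def by auto
    define q where "q i \<omega> = RS_integral_left (E i) (E (Suc i)) (\<lambda>s. (g i s)\<^sup>2) (\<lambda>s. f i s / g i s) + (X (E (Suc i)) \<omega> - Z i \<omega>)\<^sup>2" for i \<omega>
    have qi: "list_qv M (E i) X (E (Suc i)) (q i)" if i: "i \<le> m" for i
    proof -
      obtain C where C: "segment_bv M ?L X (E i) (E (Suc i)) (f i) (g i) C" using seg[OF i] by blast
      have ae: "AE \<omega> in M. ((\<lambda>s. X s \<omega>) \<longlongrightarrow> Z i \<omega>) (at_left (E (Suc i)))" using Z(2)[OF i] by eventually_elim simp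
      show ?thesis unfolding q_def
        by (rule segment_bv.segment_qv_RS[OF C Xm[OF tI[OF ESuc(3)[OF i]]] Z(1)[OF i] ae])
    qed
    obtain B where B: "\<And>s. s \<in> {a..t} \<Longrightarrow> ip (X s) (X s) \<le> B"
      using semimartingale_second_moment_bounded[OF assms(6) t XL[OF tI]] by blast
    \<comment> \<open>Glue the intervals; \<open>d_uniform\<close> on the next interval is the right continuity at the common point.\<close>
    have tot: "list_qv M a X (E (Suc n)) (\<lambda>\<omega>. \<Sum>i\<le>n. q i \<omega>)" if "n \<le> m" for n
      using that
    proof (induction n)
      case 0
      then show ?case using qi[of 0] E0 by simp
    next
      case (Suc n)
      have "list_qv M a X (E (Suc (Suc n))) (\<lambda>\<omega>. (\<Sum>i\<le>n. q i \<omega>) + q (Suc n) \<omega>)"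
      proof (rule list_qv_concat[where k = "E (Suc n)"])
        show "a < E (Suc n)" using ESuc(1)[of n] Et(2)[of n] Suc.prems by auto
        show "E (Suc n) < E (Suc (Suc n))" using ESuc(1) Suc.prems by blast
        have et: "E (Suc (Suc n)) \<in> {a..t}" "E (Suc n) \<in> {a..t}" using ESuc(3)[of "Suc n"] ESuc(3)[of n] Suc.prems by auto
        show "X s \<in> ?L" if "s \<in> {a..<E (Suc (Suc n))}" for s using that et by (intro XL tI) auto
        show "X (E (Suc (Suc n))) \<in> ?L" using et by (intro XL tI) auto
        show "ip (X s) (X s) \<le> B" if "s \<in> {a..E (Suc n)}" for s using that et by (intro B) auto
        show "list_qv M a X (E (Suc n)) (\<lambda>\<omega>. \<Sum>i\<le>n. q i \<omega>)" using Suc by simp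
        show "list_qv M (E (Suc n)) X (E (Suc (Suc n))) (q (Suc n))" by (rule qi[OF Suc.prems])
        fix \<epsilon> :: real assume "\<epsilon> > 0"
        obtain C where C: "segment_bv M ?L X (E (Suc n)) (E (Suc (Suc n))) (f (Suc n)) (g (Suc n)) C"
          using seg[OF Suc.prems] by blast
        interpret sg: segment_bv M ?L X "E (Suc n)" "E (Suc (Suc n))" "f (Suc n)" "g (Suc n)" C by (rule C)
        show "\<exists>\<delta>>0. \<forall>u. E (Suc n) < u \<longrightarrow> u < E (Suc (Suc n)) \<longrightarrow> u - E (Suc n) < \<delta> \<longrightarrow>
           ip (\<lambda>\<omega>. X u \<omega> - X (E (Suc n)) \<omega>) (\<lambda>\<omega>. X u \<omega> - X (E (Suc n)) \<omega>) \<le> \<epsilon>"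
          using sg.d_uniform[OF \<open>\<epsilon> > 0\<close>] unfolding sg.d_def by blast
      qed
      then show ?case by simp
    qed
    have "AE \<omega> in M. \<forall>i\<in>{..m}. jump a X (E (Suc i)) \<omega> = X (E (Suc i)) \<omega> - Z i \<omega>"
    proof (rule AE_finite_allI)
      show "AE \<omega> in M. jump a X (E (Suc i)) \<omega> = X (E (Suc i)) \<omega> - Z i \<omega>" if "i \<in> {..m}" for i
        using Z(2)[of i] that by (auto elim: eventually_mono)
    qed simp
    then have "AE \<omega> in M. (\<Sum>i\<le>m. q i \<omega>) = ?Q \<omega>"
    proof eventually_elim
      case (elim \<omega>)
      have qj: "q i \<omega> = ?R i (E (Suc i)) + (jump a X (E (Suc i)) \<omega>)\<^sup>2" if "i \<le> m" for i
        using elim that unfolding q_def E_def[of i] by auto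
      have "(\<Sum>i\<le>m. q i \<omega>) = (\<Sum>i<m. q i \<omega>) + q m \<omega>" by (simp add: lessThan_Suc_atMost[symmetric])
      also have "(\<Sum>i<m. q i \<omega>) = (\<Sum>i<m. ?R i (real_of_ereal (\<tau> (Suc i))) + (jump a X (real_of_ereal (\<tau> (Suc i))) \<omega>)\<^sup>2)"
        by (intro sum.cong refl) (simp add: qj E_def)
      finally show ?case using qj[of m] Em by simp
    qed
    then show ?thesis using tot[of m] Em by auto
  qed
  then obtain Q0 where Q0: "list_qv M a X t Q0" "AE \<omega> in M. Q0 \<omega> = ?Q \<omega>" by blast
  show ?thesis
  proof (intro conjI allI impI)
    show "\<exists>Q. has_quadratic_variation M a X t Q" using Q0(1) has_quadratic_variation_iff_list_qv by blast
    fix Q assume "has_quadratic_variation M a X t Q"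
    then have "list_qv M a X t Q" using has_quadratic_variation_iff_list_qv by blast
    then have "AE \<omega> in M. Q \<omega> = Q0 \<omega>" using list_qv_unique[OF at(1) Xm[OF tI] _ Q0(1)] by blast
    then show "AE \<omega> in M. Q \<omega> = ?Q \<omega>" using Q0(2) by eventually_elim simp
  qed
qed

end
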